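(* Let $\Omega\subset\mathbb{R}^d$, $d\in\{2,3\}$, be a bounded, simply connected Lipschitz domain. Let $w:\Omega\times\mathbb{R}^d\to\mathbb{R}$ be piecewise smooth in the first variable and such that for every $x\in\Omega$: $w(x,\cdot)\in C^2(\mathbb{R}^d)$, $|\partial_{\mathbf b} w(x,0)|\le C$ for a constant $C$ independent of $x$, and $$\gamma|\xi|^2\le \langle \partial^2_{\mathbf{bb}} w(x,\eta)\xi,\xi\rangle\le L|\xi|^2\qquad\forall\,\xi,\eta\in\mathbb{R}^d,$$ with constants $0<\gamma\le L$. Let $\mathbf{h_s}\in H(\operatorname{curl};\Omega)$ and let $V_0$ be the closed subspace of $H_0(\operatorname{curl};\Omega)$ described in the context, with $\|\mathbf v\|_{L^2(\Omega)}\le C_\Omega\|\operatorname{curl}\mathbf v\|_{L^2(\Omega)}$ for all $\mathbf v\in V_0$. Let $\nu^n:\Omega\times\mathbb{R}^d\to\mathbb{R}^{d\times d}$, $n\ge 0$, be generalized reluctivity tensors that are symmetric and uniformly elliptic and bounded: $\nu^n(x,\eta)=\nu^n(x,\eta)^T$ and $\alpha|\xi|^2\le\langle\nu^n(x,\eta)\xi,\xi\rangle\le\beta|\xi|^2$ for all $x\in\Omega$, $\xi,\eta\in\mathbb{R}^d$, $n\ge0$, with constants $\alpha,\beta>0$. Let $0<\rho<1$ and $0<\sigma<1/2$. Define $\phi(x,\mathbf b)=w(x,\mathbf b)-\mathbf{h_s}(x)\cdot\mathbf b$ and $\Phi(\mathbf a)=\int_\Omega\phi(x,\operatorname{curl}\mathbf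 a(x))\,dx$. For $\mathbf a^0\in V_0$ consider the iteration $\mathbf a^{n+1}=\mathbf a^n+\tau^n\,\delta\mathbf a^n$, $n\ge0$, where $\delta\mathbf a^n\in V_0$ solves $$\langle \nu^n\operatorname{curl}\delta\mathbf a^n,\operatorname{curl}\mathbf v\rangle_\Omega=\langle \mathbf{h_s}-\partial_{\mathbf b}w(\operatorname{curl}\mathbf a^n),\operatorname{curl}\mathbf v\rangle_\Omega\qquad\forall\,\mathbf v\in V_0,$$ and the stepsize is chosen by Armijo backtracking: $$\tau^n=\max\Big\{\tau=\rho^k:\ k\ge0,\ \Phi(\mathbf a^n+\tau\,\delta\mathbf a^n)\le\Phi(\mathbf a^n)+\sigma\,\tau\,\langle\partial_{\mathbf b}\phi(\operatorname{curl}\mathbf a^n),\operatorname{curl}\delta\mathbf a^n\rangle_\Omega\Big\}.$$ Then for any $\mathbf a^0\in V_0$ this iteration is well-defined and the iterates $\mathbf a^n$ converge to the unique minimizer $\mathbf a\in V_0$ of $\Phi$ over $V_0$ (equivalently, the unique solution $\mathbf a\in V_0$ of $\langle \partial_{\mathbf b} w(\operatorname{curl}\mathbf a),\operatorname{curl}\mathbf v\rangle_\Omega=\langle \mathbf{h_s},\operatorname{curl}\mathbf v\rangle_\Omega$ for all $\mathbf v\in V_0$). Moreover, the convergence is $r$-linear: $$\|\operatorname{curl}(\mathbf a^n-\mathbf a)\|^2_{L^2(\Omega)}\le C\,q^n\,\|\operatorname{curl}(\mathbf a^0-\mathbf a)\|^2_{L^2(\Omega)}$$ with $C=\frac{L}{\gamma}$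 and $q=1-\rho\,\min\{2(1-\sigma)\frac{\alpha}{L},1\}\,\sigma\,\frac{2\gamma^2}{L\beta}$.
   Context: $\langle\cdot,\cdot\rangle_\Omega$ denotes the $L^2(\Omega)$ scalar product, and $w(\mathbf b)$, $\nu^n$ acting on $\operatorname{curl}\delta\mathbf a^n$ etc. suppress the dependence on $x$ (the tensor $\nu^n$ is evaluated pointwise as $\nu^n(x,\cdot)$, e.g. at $\operatorname{curl}\mathbf a^n(x)$). $H_0^1(\Omega)$ and $H_0(\operatorname{curl};\Omega)$ are the usual spaces with homogeneous (tangential trace) boundary conditions. In three dimensions, $V_0$ is a closed subspace of $H_0(\operatorname{curl};\Omega)$ such that $H_0(\operatorname{curl};\Omega)=\nabla H_0^1(\Omega)\oplus V_0$ is a stable splitting (e.g. the $L^2$-orthogonal complement of $\nabla H_0^1(\Omega)$ in $H_0(\operatorname{curl};\Omega)$). In two dimensions, $V_0:=H_0(\operatorname{curl};\Omega)\simeq H_0^1(\Omega)$, i.e. scalar potentials with the (vector-valued) two-dimensional curl. Examples of admissible $\nu^n$: a constant $\bar\nu>0$ (fixed-point iteration), $\partial^2_{\mathbf{bb}}w(\operatorname{curl}\mathbf a^n)$ (damped Newton method), or a chord reluctivity (Kačanov iteration). *)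

theory Defs
  imports "HOL-Analysis.Analysis"
begin

fun Ck :: "nat \<Rightarrow> ('a::euclidean_space \<Rightarrow> 'b::real_normed_vector) \<Rightarrow> bool" where
  "Ck 0 f = continuous_on UNIV f"
| "Ck (Suc k) f = ((\<forall>x. f differentiable (at x)) \<and>
                    (\<forall>v. Ck k (\<lambda>x. frechet_derivative f (at x) v)))"

definition C_inf :: "('a::euclidean_space \<Rightarrow> 'b::real_normed_vector) \<Rightarrow> bool" where
  "C_inf f \<longleftrightarrow> (\<forall>k. Ck k f)"

definition pd :: "(real^'n \<Rightarrow> 'b::real_normed_vector) \<Rightarrow> 'n \<Rightarrow> real^'n \<Rightarrow> 'b" where
  "pd f j x = frechet_derivative f (at x) (axis j 1)"

definition grad :: "(real^'n \<Rightarrow> real) \<Rightarrow> real^'n \<Rightarrow> real^'n" where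
  "grad f b = (\<chi> i. pd f i b)"

definition hess :: "(real^'n \<Rightarrow> real) \<Rightarrow> real^'n \<Rightarrow> real^'n^'n" where
  "hess f b = (\<chi> i j. pd (\<lambda>y. grad f y $ i) j b)"

definition lipschitz_domain :: "(real^'n) set \<Rightarrow> bool" where
  "lipschitz_domain \<Omega> \<longleftrightarrow> open \<Omega> \<and> bounded \<Omega> \<and> connected \<Omega> \<and> \<Omega> \<noteq> {} \<and>
     (\<forall>p\<in>frontier \<Omega>. \<exists>U e g M. open U \<and> p \<in> U \<and> norm e = 1 \<and>
        (\<forall>y z. \<bar>g y - g z\<bar> \<le> M * norm (y - z)) \<and>
        \<Omega> \<inter> U = {y \<in> U. y \<bullet> e < g (y - (y \<bullet> e) *\<^sub>R e)})"

definition test_fun :: "(real^'n) set \<Rightarrow> (real^'n \<Rightarrow> 'b::real_normed_vector) \<Rightarrow> bool" where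
  "test_fun \<Omega> \<phi> \<longleftrightarrow> C_inf \<phi> \<and> (\<exists>K. compact K \<and> K \<subseteq> \<Omega> \<and> (\<forall>x. x \<notin> K \<longrightarrow> \<phi> x = 0))"

text \<open>w is piecewise smooth in its first variable: Omega is, up to a null set, the union
  of finitely many disjoint open pieces, on each of which w(.,b) is the restriction of a
  smooth function (i.e. smooth up to the boundary of the piece).\<close>
definition piecewise_smooth_fst :: "(real^'n) set \<Rightarrow> (real^'n \<Rightarrow> real^'n \<Rightarrow> real) \<Rightarrow> bool" where
  "piecewise_smooth_fst \<Omega> w \<longleftrightarrow> (\<exists>P. finite P \<and> (\<forall>S\<in>P. open S \<and> S \<subseteq> \<Omega>) \<and>
     disjoint P \<and> \<Omega> - \<Union>P \<in> null_sets lebesgue \<and>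
     (\<forall>S\<in>P. \<forall>b. \<exists>g::real^'n \<Rightarrow> real. C_inf g \<and> (\<forall>x\<in>S. g x = w x b)))"

definition L2 :: "(real^'n) set \<Rightarrow> (real^'n \<Rightarrow> 'b::euclidean_space) \<Rightarrow> bool" where
  "L2 \<Omega> f \<longleftrightarrow> (\<lambda>x. indicator \<Omega> x *\<^sub>R f x) \<in> borel_measurable lebesgue \<and>
               set_integrable lebesgue \<Omega> (\<lambda>x. (norm (f x))\<^sup>2)"

definition l2_ip :: "(real^'n) set \<Rightarrow> (real^'n \<Rightarrow> 'b::euclidean_space) \<Rightarrow> (real^'n \<Rightarrow> 'b) \<Rightarrow> real" where
  "l2_ip \<Omega> f g = (LINT x:\<Omega>|lebesgue. f x \<bullet> g x)"

definition l2_norm :: "(real^'n) set \<Rightarrow> (real^'n \<Rightarrow> 'b::euclidean_space) \<Rightarrow> real" where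
  "l2_norm \<Omega> f = sqrt (l2_ip \<Omega> f f)"

definition curl3s :: "(real^3 \<Rightarrow> real^3) \<Rightarrow> real^3 \<Rightarrow> real^3" where
  "curl3s \<psi> x = vector [pd \<psi> 2 x $ 3 - pd \<psi> 3 x $ 2,
                         pd \<psi> 3 x $ 1 - pd \<psi> 1 x $ 3,
                         pd \<psi> 1 x $ 2 - pd \<psi> 2 x $ 1]"

definition curl2s :: "(real^2 \<Rightarrow> real) \<Rightarrow> real^2 \<Rightarrow> real^2" where
  "curl2s \<phi> x = vector [pd \<phi> 2 x, - pd \<phi> 1 x]"

definition rot2s :: "(real^2 \<Rightarrow> real^2) \<Rightarrow> real^2 \<Rightarrow> real" where
  "rot2s \<psi> x = pd \<psi> 1 x $ 2 - pd \<psi> 2 x $ 1"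

definition weak_curl3 :: "(real^3) set \<Rightarrow> (real^3 \<Rightarrow> real^3) \<Rightarrow> (real^3 \<Rightarrow> real^3) \<Rightarrow> bool" where
  "weak_curl3 \<Omega> u c \<longleftrightarrow> L2 \<Omega> u \<and> L2 \<Omega> c \<and>
     (\<forall>\<psi>. test_fun \<Omega> \<psi> \<longrightarrow> l2_ip \<Omega> c \<psi> = l2_ip \<Omega> u (curl3s \<psi>))"

definition weak_curl2 :: "(real^2) set \<Rightarrow> (real^2 \<Rightarrow> real) \<Rightarrow> (real^2 \<Rightarrow> real^2) \<Rightarrow> bool" where
  "weak_curl2 \<Omega> u c \<longleftrightarrow> L2 \<Omega> u \<and> L2 \<Omega> c \<and>
     (\<forall>\<psi>. test_fun \<Omega> \<psi> \<longrightarrow> l2_ip \<Omega> c \<psi> = l2_ip \<Omega> u (rot2s \<psi>))"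

definition weak_rot2 :: "(real^2) set \<Rightarrow> (real^2 \<Rightarrow> real^2) \<Rightarrow> (real^2 \<Rightarrow> real) \<Rightarrow> bool" where
  "weak_rot2 \<Omega> h r \<longleftrightarrow> L2 \<Omega> h \<and> L2 \<Omega> r \<and>
     (\<forall>\<phi>. test_fun \<Omega> \<phi> \<longrightarrow> l2_ip \<Omega> r \<phi> = l2_ip \<Omega> h (curl2s \<phi>))"

definition weak_grad :: "(real^'n) set \<Rightarrow> (real^'n \<Rightarrow> real) \<Rightarrow> (real^'n \<Rightarrow> real^'n) \<Rightarrow> bool" where
  "weak_grad \<Omega> p g \<longleftrightarrow> L2 \<Omega> p \<and> L2 \<Omega> g \<and>
     (\<forall>\<psi>. test_fun \<Omega> \<psi> \<longrightarrow> l2_ip \<Omega> g \<psi> = - (LINT x:\<Omega>|lebesgue. p x * (\<Sum>i\<in>UNIV. pd \<psi> i x $ i)))"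

definition curl3 :: "(real^3) set \<Rightarrow> (real^3 \<Rightarrow> real^3) \<Rightarrow> real^3 \<Rightarrow> real^3" where
  "curl3 \<Omega> u = (SOME c. weak_curl3 \<Omega> u c)"

definition curl2 :: "(real^2) set \<Rightarrow> (real^2 \<Rightarrow> real) \<Rightarrow> real^2 \<Rightarrow> real^2" where
  "curl2 \<Omega> u = (SOME c. weak_curl2 \<Omega> u c)"

definition wgrad :: "(real^'n) set \<Rightarrow> (real^'n \<Rightarrow> real) \<Rightarrow> real^'n \<Rightarrow> real^'n" where
  "wgrad \<Omega> p = (SOME g. weak_grad \<Omega> p g)"

definition Hcurl3 :: "(real^3) set \<Rightarrow> (real^3 \<Rightarrow> real^3) set" where
  "Hcurl3 \<Omega> = {u. \<exists>c. weak_curl3 \<Omega> u c}"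

definition Hcurl2 :: "(real^2) set \<Rightarrow> (real^2 \<Rightarrow> real^2) set" where
  "Hcurl2 \<Omega> = {h. \<exists>r. weak_rot2 \<Omega> h r}"

definition H0curl3 :: "(real^3) set \<Rightarrow> (real^3 \<Rightarrow> real^3) set" where
  "H0curl3 \<Omega> = {u \<in> Hcurl3 \<Omega>. \<exists>\<psi>. (\<forall>k. test_fun \<Omega> (\<psi> k)) \<and>
      (\<lambda>k. l2_norm \<Omega> (\<lambda>x. u x - \<psi> k x)) \<longlonglongrightarrow> 0 \<and>
      (\<lambda>k. l2_norm \<Omega> (\<lambda>x. curl3 \<Omega> u x - curl3s (\<psi> k) x)) \<longlonglongrightarrow> 0}"

text \<open>In 2D, H_0(curl) is the space of scalar potentials (= H_0^1) with the vector curl.\<close>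
definition H0curl2 :: "(real^2) set \<Rightarrow> (real^2 \<Rightarrow> real) set" where
  "H0curl2 \<Omega> = {u. (\<exists>c. weak_curl2 \<Omega> u c) \<and> (\<exists>\<psi>. (\<forall>k. test_fun \<Omega> (\<psi> k)) \<and>
      (\<lambda>k. l2_norm \<Omega> (\<lambda>x. u x - \<psi> k x)) \<longlonglongrightarrow> 0 \<and>
      (\<lambda>k. l2_norm \<Omega> (\<lambda>x. curl2 \<Omega> u x - curl2s (\<psi> k) x)) \<longlonglongrightarrow> 0)}"

definition H01 :: "(real^'n) set \<Rightarrow> (real^'n \<Rightarrow> real) set" where
  "H01 \<Omega> = {p. (\<exists>g. weak_grad \<Omega> p g) \<and> (\<exists>\<psi>. (\<forall>k. test_fun \<Omega> (\<psi> k)) \<and>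
      (\<lambda>k. l2_norm \<Omega> (\<lambda>x. p x - \<psi> k x)) \<longlonglongrightarrow> 0 \<and>
      (\<lambda>k. l2_norm \<Omega> (\<lambda>x. wgrad \<Omega> p x - grad (\<psi> k) x)) \<longlonglongrightarrow> 0)}"

definition hcurl3_norm :: "(real^3) set \<Rightarrow> (real^3 \<Rightarrow> real^3) \<Rightarrow> real" where
  "hcurl3_norm \<Omega> u = sqrt ((l2_norm \<Omega> u)\<^sup>2 + (l2_norm \<Omega> (curl3 \<Omega> u))\<^sup>2)"

text \<open>V_0 is a closed subspace of H_0(curl) such that H_0(curl) = grad H_0^1 (+) V_0 is a
  stable (direct, bounded) splitting.  Functions equal a.e. are identified via norms.\<close>
definition stable_splitting_space :: "(real^3) set \<Rightarrow> (real^3 \<Rightarrow> real^3) set \<Rightarrow> bool" where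
  "stable_splitting_space \<Omega> V0 \<longleftrightarrow>
     V0 \<subseteq> H0curl3 \<Omega> \<and>
     (\<forall>u\<in>V0. \<forall>v\<in>V0. \<forall>t::real. (\<lambda>x. u x + t *\<^sub>R v x) \<in> V0) \<and> (\<lambda>x. 0) \<in> V0 \<and>
     (\<forall>v u. (\<forall>k. v k \<in> V0) \<and> u \<in> H0curl3 \<Omega> \<and>
            (\<lambda>k. hcurl3_norm \<Omega> (\<lambda>x. v k x - u x)) \<longlonglongrightarrow> 0 \<longrightarrow> u \<in> V0) \<and>
     (\<forall>u\<in>H0curl3 \<Omega>. \<exists>p\<in>H01 \<Omega>. \<exists>v\<in>V0. \<forall>x. u x = wgrad \<Omega> p x + v x) \<and>
     (\<forall>p\<in>H01 \<Omega>. \<forall>v\<in>V0. hcurl3_norm \<Omega> (\<lambda>x. wgrad \<Omega> p x + v x) = 0 \<longrightarrow>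
            hcurl3_norm \<Omega> v = 0) \<and>
     (\<exists>K. \<forall>p\<in>H01 \<Omega>. \<forall>v\<in>V0.
            hcurl3_norm \<Omega> (wgrad \<Omega> p) + hcurl3_norm \<Omega> v
              \<le> K * hcurl3_norm \<Omega> (\<lambda>x. wgrad \<Omega> p x + v x))"

definition energy_density :: "(real^'n) set \<Rightarrow> (real^'n \<Rightarrow> real^'n \<Rightarrow> real) \<Rightarrow> real \<Rightarrow> real \<Rightarrow> bool" where
  "energy_density \<Omega> w \<gamma> L \<longleftrightarrow> piecewise_smooth_fst \<Omega> w \<and>
     (\<forall>x\<in>\<Omega>. Ck 2 (w x)) \<and>
     (\<exists>C. \<forall>x\<in>\<Omega>. norm (grad (w x) 0) \<le> C) \<and>
     (\<forall>x\<in>\<Omega>. \<forall>\<xi> \<eta>. \<gamma> * (norm \<xi>)\<^sup>2 \<le> (hess (w x) \<eta> *v \<xi>) \<bullet> \<xi> \<and>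
                      (hess (w x) \<eta> *v \<xi>) \<bullet> \<xi> \<le> L * (norm \<xi>)\<^sup>2)"

text \<open>Generalized reluctivity tensors nu^n(x,eta): symmetric, uniformly elliptic and bounded.
  Measurability (needed for the integrals to make sense) is made explicit.\<close>
definition reluctivities :: "(real^'n) set \<Rightarrow> (nat \<Rightarrow> real^'n \<Rightarrow> real^'n \<Rightarrow> real^'n^'n) \<Rightarrow> real \<Rightarrow> real \<Rightarrow> bool" where
  "reluctivities \<Omega> \<nu> \<alpha> \<beta> \<longleftrightarrow>
     (\<forall>n. \<forall>x\<in>\<Omega>. \<forall>\<eta>. transpose (\<nu> n x \<eta>) = \<nu> n x \<eta>) \<and>
     (\<forall>n. \<forall>x\<in>\<Omega>. \<forall>\<xi> \<eta>. \<alpha> * (norm \<xi>)\<^sup>2 \<le> (\<nu> n x \<eta> *v \<xi>) \<bullet> \<xi> \<and>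
                            (\<nu> n x \<eta> *v \<xi>) \<bullet> \<xi> \<le> \<beta> * (norm \<xi>)\<^sup>2) \<and>
     (\<forall>n f. f \<in> borel_measurable lebesgue \<longrightarrow>
            (\<lambda>x. indicator \<Omega> x *\<^sub>R \<nu> n x (f x)) \<in> borel_measurable lebesgue)"

text \<open>Phi(a) = int_Omega w(x, curl a) - h_s . curl a, written in terms of b = curl a.\<close>
definition Phi :: "(real^'n) set \<Rightarrow> (real^'n \<Rightarrow> real^'n \<Rightarrow> real) \<Rightarrow> (real^'n \<Rightarrow> real^'n) \<Rightarrow>
                   (real^'n \<Rightarrow> real^'n) \<Rightarrow> real" where
  "Phi \<Omega> w hs b = (LINT x:\<Omega>|lebesgue. w x (b x) - hs x \<bullet> b x)"

definition lin_step :: "(real^'n) set \<Rightarrow> ('p set) \<Rightarrow> (('p) \<Rightarrow> real^'n \<Rightarrow> real^'n) \<Rightarrow>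
     (real^'n \<Rightarrow> real^'n \<Rightarrow> real) \<Rightarrow> (real^'n \<Rightarrow> real^'n) \<Rightarrow>
     (real^'n \<Rightarrow> real^'n \<Rightarrow> real^'n^'n) \<Rightarrow> 'p \<Rightarrow> 'p \<Rightarrow> bool" where
  "lin_step \<Omega> V0 crl w hs \<nu>n a \<delta> \<longleftrightarrow> \<delta> \<in> V0 \<and>
     (\<forall>v\<in>V0. l2_ip \<Omega> (\<lambda>x. \<nu>n x (crl a x) *v crl \<delta> x) (crl v) =
             l2_ip \<Omega> (\<lambda>x. hs x - grad (w x) (crl a x)) (crl v))"

definition armijo_set :: "(real^'n) set \<Rightarrow> ((real^'n \<Rightarrow> 'p::real_vector) \<Rightarrow> real^'n \<Rightarrow> real^'n) \<Rightarrow>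
     (real^'n \<Rightarrow> real^'n \<Rightarrow> real) \<Rightarrow> (real^'n \<Rightarrow> real^'n) \<Rightarrow> real \<Rightarrow> real \<Rightarrow>
     (real^'n \<Rightarrow> 'p) \<Rightarrow> (real^'n \<Rightarrow> 'p) \<Rightarrow> real set" where
  "armijo_set \<Omega> crl w hs \<rho> \<sigma> a \<delta> = {\<tau>. \<exists>k::nat. \<tau> = \<rho> ^ k \<and>
     Phi \<Omega> w hs (crl (\<lambda>x. a x + \<tau> *\<^sub>R \<delta> x)) \<le>
       Phi \<Omega> w hs (crl a) +
       \<sigma> * \<tau> * l2_ip \<Omega> (\<lambda>x. grad (w x) (crl a x) - hs x) (crl \<delta>)}"

end

theory Submission
  imports Defs
begin

text \<open>Weak curls are unique almost everywhere (fundamental lemma of the calculus of variations), so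
  the curl is linear on the space of potentials, and by the Poincare inequality and the completeness
  of \<open>L\<^sup>2\<close> the curls form a closed subspace. On it \<open>\<Phi>\<close> lies between two quadratic models with
  constants \<open>\<gamma>\<close> and \<open>L\<close>; hence minimizing sequences are Cauchy and the minimizer \<open>a\<close> exists.
  The linear step is the Euler-Lagrange equation of another such energy.

  With \<open>s = \<langle>\<nu> curl \<delta>, curl \<delta>\<rangle> = - \<Phi>'(a\<^sup>n) \<delta>\<close> the upper model accepts every step up to
  \<open>2 (1 - \<sigma>) \<alpha> / L\<close>, so backtracking stops at some \<open>\<tau> \<ge> \<rho> min (2 (1 - \<sigma>) \<alpha> / L) 1\<close> and the
  energy drops by \<open>\<sigma> \<tau> s\<close>. Strong monotonicity and \<open>|\<nu> \<xi>|\<^sup>2 \<le> \<beta> \<langle>\<nu> \<xi>, \<xi>\<rangle>\<close> give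
  \<open>\<gamma>\<^sup>2 \<parallel>curl (a\<^sup>n - a)\<parallel>\<^sup>2 \<le> \<beta> s\<close>, and the upper model at \<open>a\<close> turns this into
  \<open>s \<ge> 2 \<gamma>\<^sup>2 / (L \<beta>) (\<Phi>(a\<^sup>n) - \<Phi>(a))\<close>: the energy gap contracts by the factor \<open>q\<close>. The two
  models convert the gap into the curl norm at the price of \<open>L / \<gamma>\<close>.\<close>

subsection \<open>Square integrable fields\<close>

text \<open>The spaces here consist of functions, not of classes, and \<open>curl2\<close>,
  \<open>curl3\<close> pick one weak curl by Hilbert choice; so identities between curls hold only
  almost everywhere, and uniqueness of a potential means a difference of \<open>L2\<close> norm
  zero. The Hessian bounds enter once, through Taylor's formula at each point; from then on only the
  two quadratic models matter. A quadratic form with tensor \<nu> has such models too, with \<alpha>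
  and \<beta> in place of \<gamma> and \<open>L\<close>, so one existence and uniqueness argument
  serves the nonlinear problem and the linear step. Comparing two members of a minimizing sequence
  with their midpoint replaces weak compactness. The threshold 2 (1 - \<sigma>) \<alpha> / L comes
  from the upper model F a - t s + L t^2 D / 2, where D is the squared norm of curl \<delta> and
  \<alpha> D <= s. A single factor \<beta>, rather than \<beta>^2 / \<alpha>, appears in
  \<open>q\<close> because \<nu> is symmetric: its quadratic form is convex with gradient of
  Lipschitz constant \<beta>, hence cocoercive.\<close>

locale finite_domain =
  fixes \<Omega> :: "(real^'n) set"
  assumes lmeasurable_domain: "\<Omega> \<in> lmeasurable"
begin

abbreviation M :: "(real^'n) measure" where "M \<equiv> lebesgue_on \<Omega>"

lemma sets_domain [simp, measurable]: "\<Omega> \<in> sets lebesgue"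
  using lmeasurable_domain by blast

sublocale finite_measure M
  by (rule finite_measure_lebesgue_on[OF lmeasurable_domain])

text \<open>The definitions integrate over Lebesgue measure with an indicator; the later arguments
  live on the restricted finite measure \<open>M\<close>, and this is the passage between the
  two.\<close>

lemma L2_iff:
  fixes f :: "real^'n \<Rightarrow> 'b::euclidean_space"
  shows "L2 \<Omega> f \<longleftrightarrow> f \<in> borel_measurable M \<and> integrable M (\<lambda>x. (norm (f x))\<^sup>2)"
  unfolding L2_def set_integrable_def
  by (simp add: borel_measurable_restrict_space_iff integrable_restrict_space)

lemma set_integral_eq:
  fixes f :: "real^'n \<Rightarrow> 'b::euclidean_space"
  shows "(LINT x:\<Omega>|lebesgue. f x) = (\<integral>x. f x \<partial>M)"
  unfolding set_lebesgue_integral_def by (simp add: integral_restrict_space)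

lemma l2_ip_eq: "l2_ip \<Omega> f g = (\<integral>x. f x \<bullet> g x \<partial>M)"
  unfolding l2_ip_def by (rule set_integral_eq)

lemma L2_dominated:
  fixes f :: "real^'n \<Rightarrow> 'b::euclidean_space"
  assumes [measurable]: "f \<in> borel_measurable M" and g: "integrable M g"
    and le: "AE x in M. (norm (f x))\<^sup>2 \<le> g x"
  shows "L2 \<Omega> f"
proof -
  have "integrable M (\<lambda>x. (norm (f x))\<^sup>2)"
  proof (rule Bochner_Integration.integrable_bound[OF g])
    show "AE x in M. norm ((norm (f x))\<^sup>2) \<le> norm (g x)"
      using le by eventually_elim simp
  qed measurable
  then show ?thesis by (simp add: L2_iff)
qed

lemma L2_add:
  fixes f g :: "real^'n \<Rightarrow> 'b::euclidean_space"
  assumes "L2 \<Omega> f" "L2 \<Omega> g"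
  shows "L2 \<Omega> (\<lambda>x. f x + g x)"
proof (rule L2_dominated)
  have [measurable]: "f \<in> borel_measurable M" "g \<in> borel_measurable M"
    using assms by (auto simp: L2_iff)
  show "(\<lambda>x. f x + g x) \<in> borel_measurable M" by measurable
  show "integrable M (\<lambda>x. 2 * (norm (f x))\<^sup>2 + 2 * (norm (g x))\<^sup>2)"
    using assms by (auto simp: L2_iff)
  show "AE x in M. (norm (f x + g x))\<^sup>2 \<le> 2 * (norm (f x))\<^sup>2 + 2 * (norm (g x))\<^sup>2"
  proof (rule AE_I2)
    fix x
    \<comment> \<open>Parallelogram law; dropping the square of the difference leaves the
      majorant.\<close>
    have "(norm (f x + g x))\<^sup>2 + (norm (f x - g x))\<^sup>2 = 2 * (norm (f x))\<^sup>2 + 2 * (norm (g x))\<^sup>2"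
      by (simp add: power2_norm_eq_inner algebra_simps)
    then show "(norm (f x + g x))\<^sup>2 \<le> 2 * (norm (f x))\<^sup>2 + 2 * (norm (g x))\<^sup>2"
      using zero_le_power2[of "norm (f x - g x)"] by linarith
  qed
qed

lemma L2_scaleR:
  fixes f :: "real^'n \<Rightarrow> 'b::euclidean_space"
  assumes "L2 \<Omega> f"
  shows "L2 \<Omega> (\<lambda>x. t *\<^sub>R f x)"
  using assms by (auto simp: L2_iff power_mult_distrib)

lemma L2_diff:
  fixes f g :: "real^'n \<Rightarrow> 'b::euclidean_space"
  assumes "L2 \<Omega> f" "L2 \<Omega> g"
  shows "L2 \<Omega> (\<lambda>x. f x - g x)"
  using L2_add[OF assms(1) L2_scaleR[OF assms(2), of "-1"]] by simp

lemma L2_bounded: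
  fixes f :: "real^'n \<Rightarrow> 'b::euclidean_space"
  assumes "f \<in> borel_measurable M" "AE x in M. norm (f x) \<le> B"
  shows "L2 \<Omega> f"
proof (rule L2_dominated[OF assms(1)])
  show "AE x in M. (norm (f x))\<^sup>2 \<le> B\<^sup>2"
    using assms(2) by eventually_elim (simp add: power_mono)
qed simp

lemma L2_norm:
  fixes f :: "real^'n \<Rightarrow> 'b::euclidean_space"
  shows "L2 \<Omega> f \<Longrightarrow> L2 \<Omega> (\<lambda>x. norm (f x))"
  by (auto simp: L2_iff)

lemma integrable_L2_inner:
  fixes f g :: "real^'n \<Rightarrow> 'b::euclidean_space"
  assumes "L2 \<Omega> f" "L2 \<Omega> g"
  shows "integrable M (\<lambda>x. f x \<bullet> g x)"
proof (rule Bochner_Integration.integrable_bound)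
  have [measurable]: "f \<in> borel_measurable M" "g \<in> borel_measurable M"
    using assms by (auto simp: L2_iff)
  show "(\<lambda>x. f x \<bullet> g x) \<in> borel_measurable M" by measurable
  show "integrable M (\<lambda>x. (norm (f x))\<^sup>2 + (norm (g x))\<^sup>2)"
    using assms by (auto simp: L2_iff)
  show "AE x in M. norm (f x \<bullet> g x) \<le> norm ((norm (f x))\<^sup>2 + (norm (g x))\<^sup>2)"
  proof (rule AE_I2)
    fix x
    have "\<bar>f x \<bullet> g x\<bar> \<le> norm (f x) * norm (g x)" by (rule Cauchy_Schwarz_ineq2)
    also have "\<dots> \<le> (norm (f x))\<^sup>2 + (norm (g x))\<^sup>2"
      using sum_squares_bound[of "norm (f x)" "norm (g x)"]
        mult_nonneg_nonneg[OF norm_ge_zero norm_ge_zero, of "f x" "g x"] by linarith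
    finally show "norm (f x \<bullet> g x) \<le> norm ((norm (f x))\<^sup>2 + (norm (g x))\<^sup>2)" by simp
  qed
qed

text \<open>Finiteness of the measure enters here: the constant 1 is square integrable, and the norm
  is paired with it.\<close>

lemma integrable_L2_norm:
  fixes f :: "real^'n \<Rightarrow> 'b::euclidean_space"
  assumes "L2 \<Omega> f"
  shows "integrable M (\<lambda>x. norm (f x))"
  using integrable_L2_inner[OF L2_norm[OF assms] L2_bounded[of "\<lambda>x. 1::real" 1]] by simp

lemma integrable_L2:
  fixes f :: "real^'n \<Rightarrow> 'b::euclidean_space"
  assumes "L2 \<Omega> f"
  shows "integrable M f"
  using integrable_L2_norm[OF assms] assms by (subst (asm) integrable_norm_iff) (auto simp: L2_iff)

section \<open>The semi-inner product of \<open>L2\<close> and its seminorm\<close>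

lemma l2_ip_commute: "l2_ip \<Omega> f g = l2_ip \<Omega> g f"
  by (simp add: l2_ip_def inner_commute)

lemma l2_ip_add_left:
  "\<lbrakk>L2 \<Omega> f; L2 \<Omega> g; L2 \<Omega> h\<rbrakk> \<Longrightarrow> l2_ip \<Omega> (\<lambda>x. f x + g x) h = l2_ip \<Omega> f h + l2_ip \<Omega> g h"
  by (simp add: l2_ip_eq inner_add_left integrable_L2_inner)

lemma l2_ip_scaleR_left: "l2_ip \<Omega> (\<lambda>x. t *\<^sub>R f x) h = t * l2_ip \<Omega> f h"
  by (simp add: l2_ip_eq)

lemma l2_ip_diff_left:
  "\<lbrakk>L2 \<Omega> f; L2 \<Omega> g; L2 \<Omega> h\<rbrakk> \<Longrightarrow> l2_ip \<Omega> (\<lambda>x. f x - g x) h = l2_ip \<Omega> f h - l2_ip \<Omega> g h"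
  by (simp add: l2_ip_eq inner_diff_left integrable_L2_inner)

lemma l2_ip_add_right:
  "\<lbrakk>L2 \<Omega> f; L2 \<Omega> g; L2 \<Omega> h\<rbrakk> \<Longrightarrow> l2_ip \<Omega> h (\<lambda>x. f x + g x) = l2_ip \<Omega> h f + l2_ip \<Omega> h g"
  by (simp add: l2_ip_eq inner_add_right integrable_L2_inner)

lemma l2_ip_diff_right:
  "\<lbrakk>L2 \<Omega> f; L2 \<Omega> g; L2 \<Omega> h\<rbrakk> \<Longrightarrow> l2_ip \<Omega> h (\<lambda>x. f x - g x) = l2_ip \<Omega> h f - l2_ip \<Omega> h g"
  by (simp add: l2_ip_eq inner_diff_right integrable_L2_inner)

lemma l2_ip_scaleR_right: "l2_ip \<Omega> h (\<lambda>x. t *\<^sub>R f x) = t * l2_ip \<Omega> h f"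
  by (simp add: l2_ip_eq)

lemma l2_ip_self_nonneg: "0 \<le> l2_ip \<Omega> f f"
  by (simp add: l2_ip_eq)

lemma l2_norm_nonneg [simp]: "0 \<le> l2_norm \<Omega> f"
  by (simp add: l2_norm_def l2_ip_self_nonneg)

lemma l2_norm_sq: "(l2_norm \<Omega> f)\<^sup>2 = l2_ip \<Omega> f f"
  by (simp add: l2_norm_def l2_ip_self_nonneg)

lemma l2_norm_scaleR: "l2_norm \<Omega> (\<lambda>x. t *\<^sub>R f x) = \<bar>t\<bar> * l2_norm \<Omega> f"
proof -
  have "l2_ip \<Omega> (\<lambda>x. t *\<^sub>R f x) (\<lambda>x. t *\<^sub>R f x) = t\<^sup>2 * l2_ip \<Omega> f f"
    by (simp add: l2_ip_scaleR_left l2_ip_scaleR_right power2_eq_square)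
  then show ?thesis by (simp add: l2_norm_def real_sqrt_mult)
qed

lemma l2_norm_minus_commute: "l2_norm \<Omega> (\<lambda>x. f x - g x) = l2_norm \<Omega> (\<lambda>x. g x - f x)"
  using l2_norm_scaleR[of "-1" "\<lambda>x. f x - g x"] by simp

lemma l2_ip_cong_AE:
  fixes f g f' g' :: "real^'n \<Rightarrow> 'b::euclidean_space"
  assumes "L2 \<Omega> f" "L2 \<Omega> g" "L2 \<Omega> f'" "L2 \<Omega> g'"
    "AE x in M. f x = f' x" "AE x in M. g x = g' x"
  shows "l2_ip \<Omega> f g = l2_ip \<Omega> f' g'"
  unfolding l2_ip_eq
proof (rule integral_cong_AE)
  have [measurable]: "f \<in> borel_measurable M" "g \<in> borel_measurable M"
    "f' \<in> borel_measurable M" "g' \<in> borel_measurable M"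
    using assms by (auto simp: L2_iff)
  show "(\<lambda>x. f x \<bullet> g x) \<in> borel_measurable M" "(\<lambda>x. f' x \<bullet> g' x) \<in> borel_measurable M"
    by measurable
  show "AE x in M. f x \<bullet> g x = f' x \<bullet> g' x"
    using assms(5,6) by eventually_elim simp
qed

lemma l2_norm_cong_AE:
  fixes f f' :: "real^'n \<Rightarrow> 'b::euclidean_space"
  assumes "L2 \<Omega> f" "L2 \<Omega> f'" "AE x in M. f x = f' x"
  shows "l2_norm \<Omega> f = l2_norm \<Omega> f'"
  unfolding l2_norm_def using l2_ip_cong_AE[OF assms(1,1,2,2,3,3)] by simp

lemma l2_norm_eq_0_iff:
  fixes f :: "real^'n \<Rightarrow> 'b::euclidean_space"
  assumes "L2 \<Omega> f"
  shows "l2_norm \<Omega> f = 0 \<longleftrightarrow> (AE x in M. f x = 0)"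
proof -
  have "l2_norm \<Omega> f = 0 \<longleftrightarrow> (\<integral>x. f x \<bullet> f x \<partial>M) = 0"
    by (simp add: l2_norm_def l2_ip_eq)
  also have "\<dots> \<longleftrightarrow> (AE x in M. f x \<bullet> f x = 0)"
    by (rule integral_nonneg_eq_0_iff_AE) (use integrable_L2_inner[OF assms assms] in auto)
  finally show ?thesis by simp
qed

text \<open>On functions \<open>l2_ip\<close> is only semidefinite, so \<open>g\<close> of norm
  zero, which means zero almost everywhere, is a case of its own. Otherwise the square of
  \<open>b f - p g\<close> is expanded, a multiple of the residual of projecting \<open>f\<close>
  onto \<open>g\<close> that avoids division.\<close>

lemma l2_Cauchy_Schwarz:
  fixes f g :: "real^'n \<Rightarrow> 'b::euclidean_space"
  assumes f: "L2 \<Omega> f" and g: "L2 \<Omega> g"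
  shows "\<bar>l2_ip \<Omega> f g\<bar> \<le> l2_norm \<Omega> f * l2_norm \<Omega> g"
proof (cases "l2_norm \<Omega> g = 0")
  case True
  have "l2_ip \<Omega> f g = l2_ip \<Omega> f (\<lambda>x. 0)"
    using True f g by (intro l2_ip_cong_AE) (auto simp: l2_norm_eq_0_iff intro: L2_bounded[where B=0])
  then show ?thesis using True by (simp add: l2_ip_eq)
next
  case False
  define a b p where "a = l2_ip \<Omega> f f" and "b = l2_ip \<Omega> g g" and "p = l2_ip \<Omega> f g"
  have b: "b > 0" using False l2_ip_self_nonneg[of g] by (simp add: b_def l2_norm_def less_le)
  have "0 \<le> l2_ip \<Omega> (\<lambda>x. b *\<^sub>R f x - p *\<^sub>R g x) (\<lambda>x. b *\<^sub>R f x - p *\<^sub>R g x)"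
    by (rule l2_ip_self_nonneg)
  also have "\<dots> = b * b * a - 2 * b * p * p + p * p * b"
    using f g l2_ip_commute[of f g]
    by (simp add: l2_ip_diff_left l2_ip_diff_right L2_scaleR L2_diff l2_ip_scaleR_left
        l2_ip_scaleR_right a_def b_def p_def algebra_simps)
  also have "\<dots> = b * (a * b - p\<^sup>2)" by (simp add: algebra_simps power2_eq_square)
  finally have "p\<^sup>2 \<le> a * b" using b by (simp add: zero_le_mult_iff)
  also have "\<dots> = (l2_norm \<Omega> f * l2_norm \<Omega> g)\<^sup>2"
    by (simp add: power_mult_distrib l2_norm_sq a_def b_def)
  finally show ?thesis unfolding p_def by (metis abs_le_square_iff abs_of_nonneg l2_norm_nonneg mult_nonneg_nonneg)
qed

lemma l2_norm_triangle:
  fixes f g :: "real^'n \<Rightarrow> 'b::euclidean_space"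
  assumes f: "L2 \<Omega> f" and g: "L2 \<Omega> g"
  shows "l2_norm \<Omega> (\<lambda>x. f x + g x) \<le> l2_norm \<Omega> f + l2_norm \<Omega> g"
proof (rule power2_le_imp_le)
  have "(l2_norm \<Omega> (\<lambda>x. f x + g x))\<^sup>2 = (l2_norm \<Omega> f)\<^sup>2 + 2 * l2_ip \<Omega> f g + (l2_norm \<Omega> g)\<^sup>2"
    using f g l2_ip_commute[of f g]
    by (simp add: l2_norm_sq l2_ip_add_left l2_ip_add_right L2_add)
  then show "(l2_norm \<Omega> (\<lambda>x. f x + g x))\<^sup>2 \<le> (l2_norm \<Omega> f + l2_norm \<Omega> g)\<^sup>2"
    using l2_Cauchy_Schwarz[OF f g] by (simp add: power2_sum)
qed simp

lemma l2_norm_triangle_diff: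
  fixes f g h :: "real^'n \<Rightarrow> 'b::euclidean_space"
  assumes "L2 \<Omega> f" "L2 \<Omega> g" "L2 \<Omega> h"
  shows "l2_norm \<Omega> (\<lambda>x. f x - h x) \<le> l2_norm \<Omega> (\<lambda>x. f x - g x) + l2_norm \<Omega> (\<lambda>x. g x - h x)"
  using l2_norm_triangle[OF L2_diff[OF assms(1,2)] L2_diff[OF assms(2,3)]] by simp

text \<open>Riesz-Fischer. On a finite measure an \<open>L2\<close> Cauchy sequence is Cauchy in
  \<open>L1\<close>, so a subsequence converges almost everywhere; Fatou's lemma carries the Cauchy
  bound over to its limit.\<close>

lemma L2_complete:
  fixes f :: "nat \<Rightarrow> real^'n \<Rightarrow> 'b::euclidean_space"
  assumes f: "\<And>k. L2 \<Omega> (f k)"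
    and cauchy: "\<And>e. e > 0 \<Longrightarrow> \<exists>N. \<forall>i\<ge>N. \<forall>j\<ge>N. l2_norm \<Omega> (\<lambda>x. f i x - f j x) < e"
  obtains g where "L2 \<Omega> g" "(\<lambda>k. l2_norm \<Omega> (\<lambda>x. f k x - g x)) \<longlonglongrightarrow> 0"
proof -
  have one: "L2 \<Omega> (\<lambda>x. 1::real)" by (rule L2_bounded[where B=1]) auto
  have fm [measurable]: "f k \<in> borel_measurable M" for k using f by (simp add: L2_iff)
  have L1: "(\<integral>x. norm (f i x - f j x) \<partial>M) \<le> l2_norm \<Omega> (\<lambda>x. f i x - f j x) * l2_norm \<Omega> (\<lambda>x. 1::real)" for i j
    using l2_Cauchy_Schwarz[OF L2_norm[OF L2_diff[OF f f]] one, of i j]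
    by (simp add: l2_ip_eq l2_norm_def power2_norm_eq_inner power2_eq_square[symmetric])
  have L1c: "\<exists>N. \<forall>i\<ge>N. \<forall>j\<ge>N. (\<integral>x. norm (f i x - f j x) \<partial>M) < e" if e: "e > 0" for e
  proof -
    \<comment> \<open>The added 1 keeps \<open>K\<close> positive even when the seminorm of the
      constant 1 vanishes.\<close>
    define K where "K = l2_norm \<Omega> (\<lambda>x. 1::real) + 1"
    have K: "K > 0" by (simp add: K_def add_nonneg_pos)
    obtain N where N: "\<And>i j. i \<ge> N \<Longrightarrow> j \<ge> N \<Longrightarrow> l2_norm \<Omega> (\<lambda>x. f i x - f j x) < e / K"
      using cauchy[OF divide_pos_pos[OF e K]] by auto
    have "(\<integral>x. norm (f i x - f j x) \<partial>M) < e" if "i \<ge> N" "j \<ge> N" for i j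
    proof -
      have "(\<integral>x. norm (f i x - f j x) \<partial>M) \<le> l2_norm \<Omega> (\<lambda>x. f i x - f j x) * K"
        by (rule order_trans[OF L1]) (simp add: K_def mult_left_mono)
      also have "\<dots> < e" using N[OF that] K by (simp add: pos_less_divide_eq)
      finally show ?thesis .
    qed
    then show ?thesis by (intro exI[of _ N]) simp
  qed
  obtain r where r: "strict_mono r" "AE x in M. Cauchy (\<lambda>i. f (r i) x)"
  proof (rule cauchy_L1_AE_cauchy_subseq)
    show "integrable M (f k)" for k by (rule integrable_L2[OF f])
    show "\<exists>N. \<forall>i\<ge>N. \<forall>j\<ge>N. (\<integral>x. norm (f i x - f j x) \<partial>M) < e" if "e > 0" for e
      by (rule L1c[OF that])
  qed
  define g where "g x = lim (\<lambda>i. f (r i) x)" for x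
  have gm [measurable]: "g \<in> borel_measurable M"
    unfolding g_def by (rule borel_measurable_lim_metric) measurable
  have glim: "AE x in M. (\<lambda>i. f (r i) x) \<longlonglongrightarrow> g x"
    using r(2) by eventually_elim (simp add: g_def Cauchy_convergent_iff convergent_LIMSEQ_iff)
  \<comment> \<open>Fatou along the subsequence, with \<open>k\<close> fixed. The bound is stated
    for the nonnegative integral because integrability of the limit is only deduced from it.\<close>
  have tail: "(\<integral>\<^sup>+x. ennreal ((norm (f k x - g x))\<^sup>2) \<partial>M) \<le> ennreal (e\<^sup>2)"
    if e: "e > 0" and N: "\<And>i j. i \<ge> N \<Longrightarrow> j \<ge> N \<Longrightarrow> l2_norm \<Omega> (\<lambda>x. f i x - f j x) < e" and k: "k \<ge> N" for k N e
  proof -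
    have "(\<integral>\<^sup>+x. ennreal ((norm (f k x - g x))\<^sup>2) \<partial>M) =
          (\<integral>\<^sup>+x. liminf (\<lambda>i. ennreal ((norm (f k x - f (r i) x))\<^sup>2)) \<partial>M)"
    proof (rule nn_integral_cong_AE, use glim in eventually_elim)
      fix x assume "(\<lambda>i. f (r i) x) \<longlonglongrightarrow> g x"
      then have "(\<lambda>i. ennreal ((norm (f k x - f (r i) x))\<^sup>2)) \<longlonglongrightarrow> ennreal ((norm (f k x - g x))\<^sup>2)"
        by (intro tendsto_ennrealI tendsto_intros)
      then show "ennreal ((norm (f k x - g x))\<^sup>2) = liminf (\<lambda>i. ennreal ((norm (f k x - f (r i) x))\<^sup>2))"
        by (intro lim_imp_Liminf[symmetric]) simp_all
    qed
    also have "\<dots> \<le> liminf (\<lambda>i. \<integral>\<^sup>+x. ennreal ((norm (f k x - f (r i) x))\<^sup>2) \<partial>M)"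
      by (rule nn_integral_liminf) measurable
    also have "\<dots> \<le> ennreal (e\<^sup>2)"
    proof (rule Liminf_le)
      have "(\<integral>\<^sup>+x. ennreal ((norm (f k x - f (r i) x))\<^sup>2) \<partial>M) \<le> ennreal (e\<^sup>2)" if "i \<ge> N" for i
      proof -
        have "r i \<ge> N" using that seq_suble[OF r(1), of i] by linarith
        then have "l2_norm \<Omega> (\<lambda>x. f k x - f (r i) x) \<le> e" using N[OF k] by (simp add: less_imp_le)
        then have "(l2_norm \<Omega> (\<lambda>x. f k x - f (r i) x))\<^sup>2 \<le> e\<^sup>2" by (intro power_mono) auto
        moreover have "(\<integral>\<^sup>+x. ennreal ((norm (f k x - f (r i) x))\<^sup>2) \<partial>M) =
            ennreal (\<integral>x. (norm (f k x - f (r i) x))\<^sup>2 \<partial>M)"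
          by (rule nn_integral_eq_integral) (use L2_diff[OF f f, of k "r i"] in \<open>auto simp: L2_iff\<close>)
        ultimately show ?thesis
          by (simp add: l2_norm_sq l2_ip_eq power2_norm_eq_inner ennreal_leI)
      qed
      then show "\<forall>\<^sub>F i in sequentially. (\<integral>\<^sup>+x. ennreal ((norm (f k x - f (r i) x))\<^sup>2) \<partial>M) \<le> ennreal (e\<^sup>2)"
        by (auto simp: eventually_sequentially)
    qed simp
    finally show ?thesis .
  qed
  have diffL2: "L2 \<Omega> (\<lambda>x. f k x - g x) \<and> l2_norm \<Omega> (\<lambda>x. f k x - g x) \<le> e"
    if e: "e > 0" and N: "\<And>i j. i \<ge> N \<Longrightarrow> j \<ge> N \<Longrightarrow> l2_norm \<Omega> (\<lambda>x. f i x - f j x) < e" and k: "k \<ge> N" for k N e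
  proof
    have i: "integrable M (\<lambda>x. (norm (f k x - g x))\<^sup>2)"
      using tail[OF that] by (intro integrableI_bounded) (auto simp: le_less_trans)
    then show "L2 \<Omega> (\<lambda>x. f k x - g x)" by (simp add: L2_iff)
    have "ennreal (\<integral>x. (norm (f k x - g x))\<^sup>2 \<partial>M) \<le> ennreal (e\<^sup>2)"
      using tail[OF that] nn_integral_eq_integral[OF i] by simp
    then have "(l2_norm \<Omega> (\<lambda>x. f k x - g x))\<^sup>2 \<le> e\<^sup>2"
      by (simp add: l2_norm_sq l2_ip_eq power2_norm_eq_inner)
    then show "l2_norm \<Omega> (\<lambda>x. f k x - g x) \<le> e"
      using e by (meson less_imp_le power2_le_imp_le)
  qed
  show ?thesis
  proof
    obtain N where N: "\<And>i j. i \<ge> N \<Longrightarrow> j \<ge> N \<Longrightarrow> l2_norm \<Omega> (\<lambda>x. f i x - f j x) < 1"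
      using cauchy[of 1] by auto
    have "L2 \<Omega> (\<lambda>x. f N x - (f N x - g x))"
      by (rule L2_diff[OF f]) (use diffL2[OF _ N, of N] in auto)
    then show "L2 \<Omega> g" by simp
    show "(\<lambda>k. l2_norm \<Omega> (\<lambda>x. f k x - g x)) \<longlonglongrightarrow> 0"
    proof (rule LIMSEQ_I)
      fix e :: real assume e: "e > 0"
      obtain N where N: "\<And>i j. i \<ge> N \<Longrightarrow> j \<ge> N \<Longrightarrow> l2_norm \<Omega> (\<lambda>x. f i x - f j x) < e/2"
        using cauchy[of "e/2"] e by auto
      have "l2_norm \<Omega> (\<lambda>x. f k x - g x) < e" if "k \<ge> N" for k
        using diffL2[OF _ N that] e by auto
      then show "\<exists>no. \<forall>n\<ge>no. norm (l2_norm \<Omega> (\<lambda>x. f n x - g x) - 0) < e"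
        by (intro exI[of _ N]) simp
    qed
  qed
qed

end

subsection \<open>Strongly convex densities with bounded Hessian\<close>

lemma frechet_derivative_eq_sum_pd:
  fixes f :: "real^'n \<Rightarrow> real"
  assumes "f differentiable (at x)"
  shows "frechet_derivative f (at x) d = (\<Sum>i\<in>UNIV. d $ i * pd f i x)"
proof -
  have lin: "linear (frechet_derivative f (at x))"
    by (rule linear_frechet_derivative[OF assms])
  have "frechet_derivative f (at x) d = frechet_derivative f (at x) (\<Sum>i\<in>UNIV. d $ i *\<^sub>R axis i 1)"
    using basis_expansion[of d] by (simp add: scalar_mult_eq_scaleR)
  also have "\<dots> = (\<Sum>i\<in>UNIV. d $ i * pd f i x)"
    by (simp add: linear_sum[OF lin] linear_scale[OF lin] pd_def)
  finally show ?thesis .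
qed

lemma has_real_derivative_along_line:
  fixes f :: "real^'n \<Rightarrow> real"
  assumes "f differentiable (at (b + t *\<^sub>R d))"
  shows "((\<lambda>s. f (b + s *\<^sub>R d)) has_real_derivative (\<Sum>i\<in>UNIV. d $ i * pd f i (b + t *\<^sub>R d))) (at t)"
proof -
  have f: "(f has_derivative frechet_derivative f (at (b + t *\<^sub>R d))) (at (b + t *\<^sub>R d))"
    using assms frechet_derivative_works by blast
  have "((\<lambda>s. b + s *\<^sub>R d) has_derivative (\<lambda>h. h *\<^sub>R d)) (at t)"
    by (auto intro!: derivative_eq_intros)
  from diff_chain_at[OF this, of f] f
  have "((\<lambda>s. f (b + s *\<^sub>R d)) has_derivative (\<lambda>h. frechet_derivative f (at (b + t *\<^sub>R d)) (h *\<^sub>R d))) (at t)"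
    by (simp add: o_def)
  moreover have "frechet_derivative f (at (b + t *\<^sub>R d)) (h *\<^sub>R d) = (\<Sum>i\<in>UNIV. d $ i * pd f i (b + t *\<^sub>R d)) * h" for h
    by (simp add: frechet_derivative_eq_sum_pd[OF assms] sum_distrib_left sum_distrib_right mult_ac)
  ultimately show ?thesis
    by (simp add: has_field_derivative_def mult_commute_abs)
qed

lemma Ck_2_differentiable:
  fixes f :: "real^'n \<Rightarrow> real"
  assumes "Ck 2 f"
  shows "f differentiable (at x)" "(\<lambda>y. grad f y $ i) differentiable (at x)"
  using assms by (auto simp: numeral_2_eq_2 grad_def pd_def)

text \<open>One-dimensional Taylor along the segment. The Hessian bounds will be uniform in the
  intermediate point, so its position does not matter and both quadratic models follow.\<close>

lemma Ck_2_Taylor: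
  fixes f :: "real^'n \<Rightarrow> real"
  assumes "Ck 2 f"
  obtains \<eta> where "f (b + d) = f b + grad f b \<bullet> d + ((hess f \<eta> *v d) \<bullet> d) / 2"
proof -
  define \<phi>0 \<phi>1 \<phi>2 where "\<phi>0 t = f (b + t *\<^sub>R d)"
    and "\<phi>1 t = grad f (b + t *\<^sub>R d) \<bullet> d"
    and "\<phi>2 t = (hess f (b + t *\<^sub>R d) *v d) \<bullet> d" for t :: real
  have d0: "(\<phi>0 has_real_derivative \<phi>1 t) (at t)" for t
    using has_real_derivative_along_line[OF Ck_2_differentiable(1)[OF assms], where b=b and t=t and d=d]
    unfolding \<phi>0_def \<phi>1_def by (simp add: inner_vec_def grad_def mult.commute)
  have d1: "(\<phi>1 has_real_derivative \<phi>2 t) (at t)" for t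
  proof -
    have "((\<lambda>s. \<Sum>i\<in>UNIV. grad f (b + s *\<^sub>R d) $ i * d $ i) has_real_derivative
      (\<Sum>i\<in>UNIV. (\<Sum>j\<in>UNIV. d $ j * pd (\<lambda>y. grad f y $ i) j (b + t *\<^sub>R d)) * d $ i)) (at t)"
      by (intro DERIV_sum DERIV_cmult_right
          has_real_derivative_along_line[OF Ck_2_differentiable(2)[OF assms]])
    then show ?thesis
      unfolding \<phi>1_def \<phi>2_def
      by (simp add: inner_vec_def hess_def matrix_vector_mult_def mult.commute)
  qed
  \<comment> \<open>\<open>Maclaurin\<close> expects a family indexed by all orders; derivatives are
    checked only below order two, so every index from two on may be \<open>\<phi>2\<close>.\<close>
  define diff where "diff m = (if m = 0 then \<phi>0 else if m = 1 then \<phi>1 else \<phi>2)" for m :: nat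
  have "\<exists>t>0. t < 1 \<and> \<phi>0 1 = (\<Sum>m<2. diff m 0 / fact m * 1 ^ m) + diff 2 t / fact 2 * 1 ^ 2"
    by (rule Maclaurin) (auto simp: diff_def d0 d1 less_2_cases_iff)
  then obtain t where "\<phi>0 1 = \<phi>0 0 + \<phi>1 0 + \<phi>2 t / 2"
    by (auto simp: diff_def numeral_2_eq_2)
  then show ?thesis
    using that[of "b + t *\<^sub>R d"] by (simp add: \<phi>0_def \<phi>1_def \<phi>2_def)
qed

text \<open>Minimise the upper model at \<open>z\<close> and compare with the tangent plane at \<open>y\<close>.\<close>

lemma quadratic_model_cocoercive:
  fixes g :: "'a::real_inner \<Rightarrow> 'a"
  assumes "L > 0"
    and lower: "\<And>y z. f y + g y \<bullet> (z - y) \<le> f z"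
    and upper: "\<And>y z. f z \<le> f y + g y \<bullet> (z - y) + L / 2 * (norm (z - y))\<^sup>2"
  shows "(norm (g z - g y))\<^sup>2 \<le> 2 * L * (f z - f y - g y \<bullet> (z - y))"
proof -
  define e where "e = g z - g y"
  define h where "h = z - (1 / L) *\<^sub>R e"
  have "f y + g y \<bullet> (h - y) \<le> f z + g z \<bullet> (h - z) + L / 2 * (norm (h - z))\<^sup>2"
    using lower[of y h] upper[of h z] by linarith
  moreover have "g y \<bullet> (h - y) = g y \<bullet> (z - y) - (g y \<bullet> e) / L"
    by (simp add: h_def inner_diff_right)
  moreover have "g z \<bullet> (h - z) = - (g z \<bullet> e) / L"
    by (simp add: h_def)
  moreover have "L / 2 * (norm (h - z))\<^sup>2 = (e \<bullet> e) / (2 * L)"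
    using \<open>L > 0\<close> by (simp add: h_def power_mult_distrib power2_norm_eq_inner[symmetric] field_simps power2_eq_square)
  moreover have "(g z \<bullet> e) / L - (g y \<bullet> e) / L = (e \<bullet> e) / L"
    by (simp add: e_def inner_diff_left inner_diff_right diff_divide_distrib)
  ultimately have "(e \<bullet> e) / (2 * L) \<le> f z - f y - g y \<bullet> (z - y)"
    by (simp add: field_simps)
  then show ?thesis
    using \<open>L > 0\<close> by (simp add: e_def power2_norm_eq_inner field_simps)
qed

text \<open>Adding the cocoercivity estimates for both orders of the two points cancels the function
  values; Cauchy-Schwarz and division by the norm of the gradient difference finish. It later bounds
  the growth of \<open>grad (w x)\<close> and the norm of the reluctivity matrices.\<close>

lemma quadratic_model_lipschitz:
  fixes g :: "'a::real_inner \<Rightarrow> 'a"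
  assumes "L > 0"
    and lower: "\<And>y z. f y + g y \<bullet> (z - y) \<le> f z"
    and upper: "\<And>y z. f z \<le> f y + g y \<bullet> (z - y) + L / 2 * (norm (z - y))\<^sup>2"
  shows "norm (g z - g y) \<le> L * norm (z - y)"
proof -
  note co = quadratic_model_cocoercive[of L f g, OF assms]
  have "(norm (g z - g y))\<^sup>2 \<le> L * ((g z - g y) \<bullet> (z - y))"
    using co[of z y] co[of y z]
    by (simp add: norm_minus_commute[of "g y"] inner_diff_left inner_diff_right algebra_simps)
  also have "\<dots> \<le> L * (norm (g z - g y) * norm (z - y))"
    using \<open>L > 0\<close> by (intro mult_left_mono norm_cauchy_schwarz) auto
  finally have "norm (g z - g y) * norm (g z - g y) \<le> norm (g z - g y) * (L * norm (z - y))"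
    by (simp add: power2_eq_square mult_ac)
  then show ?thesis
    using \<open>L > 0\<close> by (cases "g z = g y") (auto simp: mult_le_cancel_left)
qed

subsection \<open>Smooth bump functions\<close>

text \<open>\<open>Ck\<close> is phrased with \<open>frechet_derivative\<close>; by uniqueness of
  the derivative any explicit formula for it may be used in the inductions below.\<close>

lemma Ck_SucI:
  assumes "\<And>x. (f has_derivative f' x) (at x)" "\<And>v. Ck k (\<lambda>x. f' x v)"
  shows "Ck (Suc k) f"
proof -
  have "frechet_derivative f (at x) = f' x" for x
    using frechet_derivative_at[OF assms(1)] by simp
  moreover have "f differentiable (at x)" for x
    using assms(1) unfolding differentiable_def by blast
  ultimately show ?thesis using assms(2) by simp
qed

lemma Ck_has_derivative:
  "Ck (Suc k) f \<Longrightarrow> (f has_derivative frechet_derivative f (at x)) (at x)"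
  by (simp add: frechet_derivative_works)

lemma Ck_Suc_imp_Ck: "Ck (Suc k) f \<Longrightarrow> Ck k f"
proof (induction k arbitrary: f)
  case 0
  then show ?case
    by (auto intro!: differentiable_imp_continuous_on simp: differentiable_on_def)
next
  case (Suc k)
  show ?case
  proof (rule Ck_SucI)
    show "(f has_derivative frechet_derivative f (at x)) (at x)" for x
      by (rule Ck_has_derivative[OF Suc.prems])
    show "Ck k (\<lambda>x. frechet_derivative f (at x) v)" for v
      by (rule Suc.IH) (use Suc.prems in simp)
  qed
qed

lemma Ck_const: "Ck k (\<lambda>x. c)"
proof (induction k arbitrary: c)
  case (Suc k)
  show ?case by (rule Ck_SucI[of _ "\<lambda>x v. 0"]) (auto intro: Suc)
qed simp

lemma Ck_add: "Ck k f \<Longrightarrow> Ck k g \<Longrightarrow> Ck k (\<lambda>x. f x + g x)"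
proof (induction k arbitrary: f g)
  case 0
  then show ?case by (simp add: continuous_on_add)
next
  case (Suc k)
  show ?case
  proof (rule Ck_SucI)
    show "((\<lambda>x. f x + g x) has_derivative
        (\<lambda>v. frechet_derivative f (at x) v + frechet_derivative g (at x) v)) (at x)" for x
      using Suc.prems by (intro has_derivative_add Ck_has_derivative)
    show "Ck k (\<lambda>x. frechet_derivative f (at x) v + frechet_derivative g (at x) v)" for v
      by (rule Suc.IH) (use Suc.prems in simp_all)
  qed
qed

lemma Ck_bounded_linear:
  assumes "bounded_linear T"
  shows "Ck k f \<Longrightarrow> Ck k (\<lambda>x. T (f x))"
proof (induction k arbitrary: f)
  case 0
  then show ?case by (simp add: bounded_linear.continuous_on[OF assms])
next
  case (Suc k)
  show ?case
  proof (rule Ck_SucI)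
    show "((\<lambda>x. T (f x)) has_derivative (\<lambda>v. T (frechet_derivative f (at x) v))) (at x)" for x
      using Suc.prems by (intro bounded_linear.has_derivative[OF assms] Ck_has_derivative)
    show "Ck k (\<lambda>x. T (frechet_derivative f (at x) v))" for v
      by (rule Suc.IH) (use Suc.prems in simp)
  qed
qed

lemma Ck_mult:
  fixes f g :: "'a::euclidean_space \<Rightarrow> real"
  shows "Ck k f \<Longrightarrow> Ck k g \<Longrightarrow> Ck k (\<lambda>x. f x * g x)"
proof (induction k arbitrary: f g)
  case 0
  then show ?case by (simp add: continuous_on_mult)
next
  case (Suc k)
  show ?case
  proof (rule Ck_SucI)
    show "((\<lambda>x. f x * g x) has_derivative
        (\<lambda>v. f x * frechet_derivative g (at x) v + frechet_derivative f (at x) v * g x)) (at x)" for x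
      using Suc.prems by (intro has_derivative_mult Ck_has_derivative)
    \<comment> \<open>The undifferentiated factors are lowered from order \<open>Suc k\<close> to
      \<open>k\<close>, so that the induction hypothesis applies to both products.\<close>
    show "Ck k (\<lambda>x. f x * frechet_derivative g (at x) v + frechet_derivative f (at x) v * g x)" for v
      by (intro Ck_add Suc.IH) (use Suc.prems Ck_Suc_imp_Ck in auto)
  qed
qed

lemma Ck_prod:
  fixes f :: "'i \<Rightarrow> 'a::euclidean_space \<Rightarrow> real"
  shows "(\<And>i. i \<in> I \<Longrightarrow> Ck k (f i)) \<Longrightarrow> Ck k (\<lambda>x. \<Prod>i\<in>I. f i x)"
  by (induction I rule: infinite_finite_induct) (auto simp: Ck_const Ck_mult)

text \<open>Derivatives of members of this family are linear combinations of members.\<close>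

definition flat_exp :: "nat \<Rightarrow> real \<Rightarrow> real" where
  "flat_exp n t = (if t > 0 then exp (- (1 / t)) * (1 / t) ^ n else 0)"

text \<open>Away from 0 this is the chain rule. The delicate point is 0, where the exponential must
  beat every negative power of \<open>t\<close> for the one-sided difference quotients to
  vanish.\<close>

lemma flat_exp_has_derivative:
  "(flat_exp n has_real_derivative flat_exp (n + 2) t - real n * flat_exp (n + 1) t) (at t)"
proof -
  consider "t > 0" | "t < 0" | "t = 0" by linarith
  then show ?thesis
  proof cases
    case 1
    have *: "((\<lambda>t. exp (- inverse t) * inverse t ^ n) has_real_derivative
        exp (- (1 / t)) * (1 / t) ^ (n + 2) - real n * (exp (- (1 / t)) * (1 / t) ^ (n + 1))) (at t)"
    proof (cases n)
      \<comment> \<open>Treated apart because the power rule produces the exponent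
        \<open>n - 1\<close>.\<close>
      case 0
      then show ?thesis
        using 1 by (auto intro!: derivative_eq_intros simp: field_simps power2_eq_square)
    next
      case (Suc k)
      have "((\<lambda>t. inverse t ^ Suc k) has_real_derivative
          real (Suc k) * (inverse t ^ k * - (inverse t * inverse t))) (at t)"
        using 1 DERIV_power[OF DERIV_inverse[of t], of "Suc k"] by (simp add: power2_eq_square mult_ac)
      moreover have "((\<lambda>t. exp (- inverse t)) has_real_derivative
          exp (- inverse t) * (inverse t * inverse t)) (at t)"
        using 1 by (auto intro!: derivative_eq_intros simp: power2_eq_square)
      ultimately have "((\<lambda>t. exp (- inverse t) * inverse t ^ Suc k) has_real_derivative
          exp (- inverse t) * (inverse t * inverse t) * inverse t ^ Suc k +
          real (Suc k) * (inverse t ^ k * - (inverse t * inverse t)) * exp (- inverse t)) (at t)"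
        by (rule DERIV_mult[rotated])
      then show ?thesis
        by (simp add: Suc divide_inverse algebra_simps)
    qed
    have "(flat_exp n has_real_derivative
        exp (- (1 / t)) * (1 / t) ^ (n + 2) - real n * (exp (- (1 / t)) * (1 / t) ^ (n + 1))) (at t)"
      by (rule has_field_derivative_transform_within_open[OF *, of "{0<..}"])
         (use 1 in \<open>auto simp: flat_exp_def divide_inverse\<close>)
    then show ?thesis using 1 by (simp add: flat_exp_def)
  next
    case 2
    have "(flat_exp n has_real_derivative 0) (at t)"
      by (rule has_field_derivative_transform_within_open[of "\<lambda>_. 0" _ _ "{..<0}"])
         (use 2 in \<open>auto simp: flat_exp_def\<close>)
    then show ?thesis using 2 by (simp add: flat_exp_def)
  next
    case 3
    have "((\<lambda>h. flat_exp n h / h) \<longlongrightarrow> 0) (at_right 0)"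
    proof -
      \<comment> \<open>With u = 1 / h the difference quotient is u^(n+1) / exp u, and u tends to
        infinity.\<close>
      have "((\<lambda>h::real. inverse h ^ (n + 1) / exp (inverse h)) \<longlongrightarrow> 0) (at_right 0)"
        by (rule filterlim_compose[OF tendsto_power_div_exp_0 filterlim_inverse_at_top_right])
      moreover have "\<forall>\<^sub>F h in at_right 0. inverse h ^ (n + 1) / exp (inverse h) = flat_exp n h / h"
        by (rule eventually_at_right_less[THEN eventually_mono])
           (auto simp: flat_exp_def exp_minus field_simps)
      ultimately show ?thesis by (rule Lim_transform_eventually)
    qed
    moreover have "((\<lambda>h. flat_exp n h / h) \<longlongrightarrow> 0) (at_left 0)"
    proof (rule Lim_transform_eventually[OF tendsto_const])
      show "\<forall>\<^sub>F h in at_left 0. 0 = flat_exp n h / h"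
        by (auto simp: flat_exp_def eventually_at_filter)
    qed
    ultimately have "((\<lambda>h. flat_exp n h / h) \<longlongrightarrow> 0) (at 0)"
      by (rule filterlim_split_at[rotated])
    then show ?thesis
      unfolding 3 DERIV_def by (simp add: flat_exp_def)
  qed
qed

text \<open>The induction on \<open>k\<close> needs all \<open>n\<close> at once, since
  differentiation raises the exponent. The affine argument covers both faces of a box in each
  coordinate and reproduces itself under differentiation.\<close>

lemma Ck_flat_exp: "Ck k (\<lambda>x. flat_exp n (x \<bullet> e + c))"
proof (induction k arbitrary: n)
  case 0
  have "isCont (flat_exp n) t" for t by (rule DERIV_isCont[OF flat_exp_has_derivative])
  then have "continuous_on UNIV (flat_exp n)" by (simp add: continuous_on_eq_continuous_at)
  then show ?case
    unfolding Ck.simps by (rule continuous_on_compose2) (auto intro!: continuous_intros)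
next
  case (Suc k)
  show ?case
  proof (rule Ck_SucI)
    fix x :: 'a
    have 1: "((\<lambda>x. x \<bullet> e + c) has_derivative (\<lambda>v. v \<bullet> e)) (at x)"
      by (auto intro!: derivative_eq_intros)
    show "((\<lambda>x. flat_exp n (x \<bullet> e + c)) has_derivative
      (\<lambda>v. (v \<bullet> e) *\<^sub>R (flat_exp (n + 2) (x \<bullet> e + c) + (- real n) *\<^sub>R flat_exp (n + 1) (x \<bullet> e + c)))) (at x)"
      using DERIV_compose_FDERIV[OF flat_exp_has_derivative[of n "x \<bullet> e + c"] 1]
      by (simp add: mult.commute)
  next
    fix v :: 'a
    show "Ck k (\<lambda>x. (v \<bullet> e) *\<^sub>R (flat_exp (n + 2) (x \<bullet> e + c) + (- real n) *\<^sub>R flat_exp (n + 1) (x \<bullet> e + c)))"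
      by (intro Ck_bounded_linear[OF bounded_linear_scaleR_right] Ck_add Suc)
  qed
qed

text \<open>One factor per face of the box; \<open>m\<close> steepens the profile, so that the bumps
  tend to the indicator of the open box. Boxes are used because they are closed under intersection
  and generate the Borel sets.\<close>

definition box_bump :: "'a::euclidean_space \<Rightarrow> 'a \<Rightarrow> nat \<Rightarrow> 'a \<Rightarrow> real" where
  "box_bump a b m x = (\<Prod>i\<in>Basis. flat_exp 0 (real m * (x \<bullet> i - a \<bullet> i)) * flat_exp 0 (real m * (b \<bullet> i - x \<bullet> i)))"

lemma C_inf_box_bump: "C_inf (box_bump a b m)"
  unfolding C_inf_def box_bump_def
proof (intro allI Ck_prod Ck_mult)
  fix k and i :: 'a
  show "Ck k (\<lambda>x. flat_exp 0 (real m * (x \<bullet> i - a \<bullet> i)))"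
    using Ck_flat_exp[of k 0 "real m *\<^sub>R i" "- real m * (a \<bullet> i)"] by (simp add: algebra_simps)
  show "Ck k (\<lambda>x. flat_exp 0 (real m * (b \<bullet> i - x \<bullet> i)))"
    using Ck_flat_exp[of k 0 "- real m *\<^sub>R i" "real m * (b \<bullet> i)"] by (simp add: algebra_simps)
qed

lemma flat_exp_0_bounds: "0 \<le> flat_exp 0 t" "flat_exp 0 t \<le> 1"
  by (auto simp: flat_exp_def)

lemma box_bump_bounds: "0 \<le> box_bump a b m x" "box_bump a b m x \<le> 1"
  unfolding box_bump_def
  by (auto intro!: prod_nonneg prod_le_1 mult_nonneg_nonneg mult_le_one flat_exp_0_bounds)

lemma box_bump_outside:
  assumes "x \<notin> box a b"
  shows "box_bump a b m x = 0"
proof -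
  obtain i where i: "i \<in> Basis" "x \<bullet> i - a \<bullet> i \<le> 0 \<or> b \<bullet> i - x \<bullet> i \<le> 0"
    using assms by (auto simp: mem_box not_less)
  then have "real m * (x \<bullet> i - a \<bullet> i) \<le> 0 \<or> real m * (b \<bullet> i - x \<bullet> i) \<le> 0"
    by (auto intro: mult_nonneg_nonpos)
  then show ?thesis
    unfolding box_bump_def using i(1) by (intro prod_zero) (auto simp: flat_exp_def intro!: bexI[of _ i])
qed

lemma flat_exp_tendsto_1:
  assumes "s > 0"
  shows "(\<lambda>m. flat_exp 0 (real m * s)) \<longlonglongrightarrow> 1"
proof -
  have "(\<lambda>m. inverse (real m) * inverse s) \<longlonglongrightarrow> 0 * inverse s"
    by (intro tendsto_mult tendsto_const lim_inverse_n)
  then have "(\<lambda>m. exp (- (inverse (real m) * inverse s))) \<longlonglongrightarrow> exp (- 0)"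
    by (intro tendsto_exp tendsto_minus) simp
  \<comment> \<open>Only eventually: at \<open>m = 0\<close> the left side is 1, as
    \<open>inverse 0 = 0\<close>, while \<open>flat_exp 0 0 = 0\<close>.\<close>
  moreover have "\<forall>\<^sub>F m in sequentially. exp (- (inverse (real m) * inverse s)) = flat_exp 0 (real m * s)"
    using eventually_gt_at_top[of "0::nat"]
    by eventually_elim (use assms in \<open>simp add: flat_exp_def divide_inverse\<close>)
  ultimately show ?thesis by (simp add: Lim_transform_eventually)
qed

lemma box_bump_tendsto: "(\<lambda>m. box_bump a b m x) \<longlonglongrightarrow> indicator (box a b) x"
proof (cases "x \<in> box a b")
  case True
  have "(\<lambda>m. box_bump a b m x) \<longlonglongrightarrow> (\<Prod>i\<in>(Basis::'a set). 1 * 1)"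
    unfolding box_bump_def
    by (intro tendsto_prod tendsto_mult flat_exp_tendsto_1) (use True in \<open>auto simp: mem_box\<close>)
  then show ?thesis using True by simp
qed (simp add: box_bump_outside)

lemma test_fun_box_bump:
  fixes e :: "'b::euclidean_space"
  assumes "cbox a b \<subseteq> \<Omega>"
  shows "test_fun \<Omega> (\<lambda>x. box_bump a b m x *\<^sub>R e)"
  unfolding test_fun_def
proof (intro conjI exI[of _ "cbox a b"] allI impI)
  show "C_inf (\<lambda>x. box_bump a b m x *\<^sub>R e)"
    using C_inf_box_bump[of a b m] Ck_bounded_linear[OF bounded_linear_scaleR_left]
    unfolding C_inf_def by blast
  show "box_bump a b m x *\<^sub>R e = 0" if "x \<notin> cbox a b" for x
    using that box_subset_cbox[of a b] box_bump_outside[of x a b m] by auto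
qed (use assms in auto)

subsection \<open>The fundamental lemma of the calculus of variations\<close>

context finite_domain
begin

lemma integrable_indicator_L2:
  fixes c :: "real^'n \<Rightarrow> 'b::euclidean_space"
  assumes c: "L2 \<Omega> c" and [measurable]: "A \<in> sets M"
  shows "set_integrable M A c"
  unfolding set_integrable_def by (rule integrable_mult_indicator[OF _ integrable_L2[OF c]]) simp

text \<open>Testing with bumps times a basis vector and letting them steepen turns orthogonality
  into a vanishing integral, component by component; \<open>norm (c x)\<close> is the dominating
  function.\<close>

lemma integral_box_eq_0:
  fixes c :: "real^'n \<Rightarrow> 'b::euclidean_space"
  assumes c: "L2 \<Omega> c" and orth: "\<And>\<psi>. test_fun \<Omega> \<psi> \<Longrightarrow> l2_ip \<Omega> c \<psi> = 0" and ab: "cbox a b \<subseteq> \<Omega>"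
  shows "(LINT x:box a b|M. c x) = 0"
proof (rule euclidean_eqI)
  fix e :: 'b assume e: "e \<in> Basis"
  have [measurable]: "c \<in> borel_measurable M" using c by (simp add: L2_iff)
  have sets: "box a b \<in> sets M"
    using ab box_subset_cbox[of a b] by (auto simp: sets_restrict_space_iff)
  note [measurable] = sets
  have bump: "box_bump a b m \<in> borel_measurable M" for m
  proof -
    have "continuous_on UNIV (box_bump a b m)"
      using C_inf_box_bump[of a b m] by (simp add: C_inf_def flip: Ck.simps(1))
    then show ?thesis
      by (intro measurable_restrict_space1 measurable_completion borel_measurable_continuous_onI)
         (simp_all add: measurable_completion borel_measurable_continuous_onI)
  qed
  note [measurable] = bump
  have "(\<lambda>m. \<integral>x. box_bump a b m x * (c x \<bullet> e) \<partial>M) \<longlonglongrightarrow> (\<integral>x. indicator (box a b) x * (c x \<bullet> e) \<partial>M)"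
  proof (rule integral_dominated_convergence)
    show "integrable M (\<lambda>x. norm (c x))" by (rule integrable_L2_norm[OF c])
    show "AE x in M. (\<lambda>m. box_bump a b m x * (c x \<bullet> e)) \<longlonglongrightarrow> indicator (box a b) x * (c x \<bullet> e)"
      by (intro AE_I2 tendsto_mult box_bump_tendsto tendsto_const)
    show "AE x in M. norm (box_bump a b m x * (c x \<bullet> e)) \<le> norm (c x)" for m
    proof (rule AE_I2)
      fix x
      have "\<bar>box_bump a b m x\<bar> * \<bar>c x \<bullet> e\<bar> \<le> 1 * norm (c x)"
        using box_bump_bounds[of a b m x] Basis_le_norm[OF e, of "c x"]
        by (intro mult_mono) auto
      then show "norm (box_bump a b m x * (c x \<bullet> e)) \<le> norm (c x)" by (simp add: abs_mult)
    qed
  qed measurable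
  moreover have "(\<integral>x. box_bump a b m x * (c x \<bullet> e) \<partial>M) = 0" for m
    using orth[OF test_fun_box_bump[OF ab, of m e]] by (simp add: l2_ip_eq)
  ultimately have "(\<integral>x. indicator (box a b) x * (c x \<bullet> e) \<partial>M) = 0"
    by (simp add: LIMSEQ_const_iff)
  moreover have "(LINT x:box a b|M. c x) \<bullet> e = (\<integral>x. (indicator (box a b) x *\<^sub>R c x) \<bullet> e \<partial>M)"
    unfolding set_lebesgue_integral_def
    using integrable_indicator_L2[OF c sets] unfolding set_integrable_def
    by (intro integral_inner_left[symmetric]) auto
  ultimately show "(LINT x:box a b|M. c x) \<bullet> e = 0 \<bullet> e" by simp
qed

text \<open>Dynkin's argument starting from open boxes. The intersection with a fixed box keeps
  every set inside the domain, whose test functions are the only ones available.\<close>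

lemma integral_borel_eq_0:
  fixes c :: "real^'n \<Rightarrow> 'b::euclidean_space"
  assumes c: "L2 \<Omega> c" and orth: "\<And>\<psi>. test_fun \<Omega> \<psi> \<Longrightarrow> l2_ip \<Omega> c \<psi> = 0"
    and ab: "cbox a b \<subseteq> \<Omega>" and A: "A \<in> sets borel"
  shows "(LINT x:A \<inter> box a b|M. c x) = 0"
proof -
  have sets: "A \<inter> box a b \<in> sets M" if "A \<in> sets borel" for A
    using ab box_subset_cbox[of a b] that by (auto simp: sets_restrict_space_iff)
  have "Int_stable (range (\<lambda>(a, b). box a b :: (real^'n) set))"
    by (auto simp: Int_stable_def box_Int_box)
  moreover have "(range (\<lambda>(a, b). box a b)) \<subseteq> Pow (UNIV :: (real^'n) set)"
    by auto
  moreover have "A \<in> sigma_sets UNIV (range (\<lambda>(a, b). box a b))"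
    using A unfolding borel_eq_box by simp
  ultimately show ?thesis
  proof (induction rule: sigma_sets_induct_disjoint)
    case (basic A)
    then obtain a' b' where A: "A = box a' b'" by auto
    have "cbox a' b' \<inter> cbox a b \<subseteq> \<Omega>" using ab by auto
    then show ?case
      unfolding A box_Int_box Int_interval by (intro integral_box_eq_0[OF c orth])
  next
    case empty
    then show ?case by (simp add: set_lebesgue_integral_def)
  next
    case (compl A)
    then have "A \<in> sets borel" by (simp add: borel_eq_box)
    \<comment> \<open>Complements are taken relative to the fixed box, over which the integral is
      already known to vanish.\<close>
    then have "(LINT x:(A \<inter> box a b) \<union> ((UNIV - A) \<inter> box a b)|M. c x) =
        (LINT x:A \<inter> box a b|M. c x) + (LINT x:(UNIV - A) \<inter> box a b|M. c x)"
      by (intro set_integral_Un integrable_indicator_L2[OF c] sets) auto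
    moreover have "(A \<inter> box a b) \<union> ((UNIV - A) \<inter> box a b) = box a b" by auto
    ultimately show ?case
      using compl.IH integral_box_eq_0[OF c orth ab] by simp
  next
    case (union F)
    then have F: "\<And>i. F i \<in> sets borel" by (simp add: borel_eq_box subset_eq)
    have "(LINT x:(\<Union>i. F i \<inter> box a b)|M. c x) = (\<Sum>i. LINT x:F i \<inter> box a b|M. c x)"
    proof (rule lebesgue_integral_countable_add)
      show "F i \<inter> box a b \<in> sets M" for i by (rule sets[OF F])
      show "F i \<inter> box a b \<inter> (F j \<inter> box a b) = {}" if "i \<noteq> j" for i j
        using union(1) that by (auto simp: disjoint_family_on_def)
      show "set_integrable M (\<Union>i. F i \<inter> box a b) c"
        by (intro integrable_indicator_L2[OF c] sets.countable_UN) (auto intro: sets[OF F])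
    qed
    then show ?case using union.IH by simp
  qed
qed

text \<open>Test functions have their support inside the domain, so the argument is local: on a box
  with closure in the domain all set integrals of \<open>c\<close> vanish, hence \<open>c\<close>
  does almost everywhere.\<close>

theorem L2_orthogonal_test_fun_imp_0:
  fixes c :: "real^'n \<Rightarrow> 'b::euclidean_space"
  assumes "open \<Omega>" and c: "L2 \<Omega> c" and orth: "\<And>\<psi>. test_fun \<Omega> \<psi> \<Longrightarrow> l2_ip \<Omega> c \<psi> = 0"
  shows "AE x in M. c x = 0"
proof -
  have [measurable]: "c \<in> borel_measurable M" using c by (simp add: L2_iff)
  have on_box: "AE x in M. x \<in> box a b \<longrightarrow> c x = 0" if ab: "cbox a b \<subseteq> \<Omega>" for a b
  proof -
    have sets: "box a b \<in> sets M"
      using ab box_subset_cbox[of a b] by (auto simp: sets_restrict_space_iff)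
    note [measurable] = sets
    have "AE x in M. indicator (box a b) x *\<^sub>R c x = 0"
    proof (rule density_zero)
      show int: "integrable M (\<lambda>x. indicator (box a b) x *\<^sub>R c x)"
        using integrable_indicator_L2[OF c sets] by (simp add: set_integrable_def)
      fix A assume A: "A \<in> sets M"
      note [measurable] = A
      \<comment> \<open>Vanishing integrals are known for Borel sets; a Lebesgue measurable set
        differs from one by a null set.\<close>
      have "A \<in> sets (completion lborel)" using A by (auto simp: sets_restrict_space_iff)
      then obtain S N N' where S: "A = S \<union> N" "N \<subseteq> N'" "N' \<in> null_sets lborel" "S \<in> sets lborel"
        by (rule sets_completionE)
      have Sb: "S \<in> sets borel" using S(4) by simp
      have "AE x in lebesgue. x \<notin> N'"
        using S(3) by (intro AE_not_in null_sets_completionI)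
      then have N': "AE x in M. x \<notin> N'"
        by (subst AE_restrict_space_iff) auto
      have S': "S \<inter> box a b \<in> sets M"
        using S(4) ab box_subset_cbox[of a b] by (auto simp: sets_restrict_space_iff)
      note [measurable] = S'
      have "(LINT x:A|M. indicator (box a b) x *\<^sub>R c x) = (LINT x:S \<inter> box a b|M. c x)"
        unfolding set_lebesgue_integral_def
      proof (rule integral_cong_AE)
        show "AE x in M. indicator A x *\<^sub>R indicator (box a b) x *\<^sub>R c x = indicator (S \<inter> box a b) x *\<^sub>R c x"
          using N' by eventually_elim (use S in \<open>auto simp: indicator_def\<close>)
      qed measurable
      also have "\<dots> = 0" by (rule integral_borel_eq_0[OF c orth ab Sb])
      finally show "(LINT x:A|M. indicator (box a b) x *\<^sub>R c x) = 0" .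
    qed
    then show ?thesis by eventually_elim (auto simp: indicator_def)
  qed
  define \<F> where "\<F> = {box a b |a b. cbox a b \<subseteq> \<Omega>}"
  \<comment> \<open>Countably many boxes suffice, so the union of the exceptional sets stays
    null.\<close>
  obtain \<F>' where F': "\<F>' \<subseteq> \<F>" "countable \<F>'" "\<Union>\<F>' = \<Union>\<F>"
    by (rule Lindelof[of \<F>]) (auto simp: \<F>_def open_box)
  have cover: "\<Omega> \<subseteq> \<Union>\<F>"
  proof
    fix x assume "x \<in> \<Omega>"
    then obtain e where e: "e > 0" "ball x e \<subseteq> \<Omega>" using \<open>open \<Omega>\<close> by (meson openE)
    \<comment> \<open>Half the radius, so that the closed box still lies in the domain.\<close>
    obtain a b where ab: "x \<in> box a b" "box a b \<subseteq> ball x (e/2)"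
      using rational_boxes[of "e/2" x] e by auto
    have "cbox a b = closure (box a b)" using ab by (subst closure_box) auto
    also have "\<dots> \<subseteq> cball x (e/2)" using ab by (intro closure_minimal) auto
    also have "\<dots> \<subseteq> \<Omega>" using e by (auto simp: subset_eq)
    finally show "x \<in> \<Union>\<F>" using ab by (auto simp: \<F>_def)
  qed
  have "AE x in M. \<forall>B\<in>\<F>'. x \<in> B \<longrightarrow> c x = 0"
    using F'(1) on_box by (subst AE_ball_countable[OF F'(2)]) (auto simp: \<F>_def)
  moreover have "AE x in M. x \<in> \<Omega>" by (rule AE_I2) simp
  ultimately show ?thesis by eventually_elim (use cover F'(3) in blast)
qed

end

subsection \<open>Strongly convex energies on a space of potentials\<close>

text \<open>What the variational arguments need from either dimension; \<open>'b\<close> is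
  \<open>real\<close> in the plane and \<open>real^3\<close> in space. Linearity of
  \<open>crl\<close> holds only almost everywhere because a representative is chosen, and
  \<open>complete\<close> says that the curls form a closed set in \<open>L2\<close>.\<close>

locale curl_space = finite_domain \<Omega> for \<Omega> :: "(real^'n) set" +
  fixes V :: "(real^'n \<Rightarrow> 'b::euclidean_space) set"
    and crl :: "(real^'n \<Rightarrow> 'b) \<Rightarrow> real^'n \<Rightarrow> real^'n" and C :: real
  assumes V_add: "\<And>u v t. \<lbrakk>u \<in> V; v \<in> V\<rbrakk> \<Longrightarrow> (\<lambda>x. u x + t *\<^sub>R v x) \<in> V"
    and V_zero: "(\<lambda>x. 0) \<in> V"
    and crl_L2: "\<And>v. v \<in> V \<Longrightarrow> L2 \<Omega> (crl v)"
    and crl_add: "\<And>u v t. \<lbrakk>u \<in> V; v \<in> V\<rbrakk> \<Longrightarrow>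
      AE x in lebesgue_on \<Omega>. crl (\<lambda>x. u x + t *\<^sub>R v x) x = crl u x + t *\<^sub>R crl v x"
    and poincare: "\<And>v. v \<in> V \<Longrightarrow> l2_norm \<Omega> v \<le> C * l2_norm \<Omega> (crl v)"
    and complete: "\<And>v. \<lbrakk>\<And>k. v k \<in> V;
      \<And>e. e > 0 \<Longrightarrow> \<exists>N::nat. \<forall>i\<ge>N. \<forall>j\<ge>N. l2_norm \<Omega> (\<lambda>x. crl (v i) x - crl (v j) x) < e\<rbrakk>
      \<Longrightarrow> \<exists>u\<in>V. (\<lambda>k. l2_norm \<Omega> (\<lambda>x. crl (v k) x - crl u x)) \<longlonglongrightarrow> 0"
begin

lemma V_diff:
  assumes "u \<in> V" "v \<in> V"
  shows "(\<lambda>x. u x - v x) \<in> V"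
  using V_add[OF assms, of "-1"] by simp

lemma crl_diff:
  assumes "u \<in> V" "v \<in> V"
  shows "AE x in M. crl (\<lambda>x. u x - v x) x = crl u x - crl v x"
  using crl_add[OF assms, of "-1"] by simp

lemma l2_norm_crl_diff:
  assumes "u \<in> V" "v \<in> V"
  shows "l2_norm \<Omega> (crl (\<lambda>x. u x - v x)) = l2_norm \<Omega> (\<lambda>x. crl u x - crl v x)"
  using assms by (intro l2_norm_cong_AE crl_L2 L2_diff V_diff crl_diff)

lemma l2_norm_eq_0_if_crl:
  assumes "v \<in> V" "l2_norm \<Omega> (crl v) = 0"
  shows "l2_norm \<Omega> v = 0"
  using poincare[OF assms(1)] assms(2) l2_norm_nonneg[of v] by simp

end

text \<open>The density is given by its two quadratic models rather than by a Hessian, so that both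
  \<open>w\<close> and the quadratic density of the linear step are instances; \<open>h\<close> is
  the linear load.\<close>

locale convex_energy = finite_domain \<Omega> for \<Omega> :: "(real^'n) set" +
  fixes W :: "real^'n \<Rightarrow> real^'n \<Rightarrow> real" and DW :: "real^'n \<Rightarrow> real^'n \<Rightarrow> real^'n"
    and h :: "real^'n \<Rightarrow> real^'n" and c K :: real
  assumes c_pos: "0 < c" and K_pos: "0 < K"
    and W_lower: "\<And>x y z. x \<in> \<Omega> \<Longrightarrow> c / 2 * (norm (z - y))\<^sup>2 \<le> W x z - W x y - DW x y \<bullet> (z - y)"
    and W_upper: "\<And>x y z. x \<in> \<Omega> \<Longrightarrow> W x z - W x y - DW x y \<bullet> (z - y) \<le> K / 2 * (norm (z - y))\<^sup>2"
    and W_integrable: "\<And>f. L2 \<Omega> f \<Longrightarrow> integrable (lebesgue_on \<Omega>) (\<lambda>x. W x (f x))"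
    and DW_L2: "\<And>f. L2 \<Omega> f \<Longrightarrow> L2 \<Omega> (\<lambda>x. DW x (f x))"
    and h_L2: "L2 \<Omega> h"
begin

lemma residual_L2: "L2 \<Omega> f \<Longrightarrow> L2 \<Omega> (\<lambda>x. DW x (f x) - h x)"
  by (intro L2_diff DW_L2 h_L2)

text \<open>The load is linear and cancels in the remainder of first order, which is therefore the
  integral of the pointwise remainder of \<open>W\<close>; the pointwise models are then
  integrated.\<close>

lemma Phi_bounds:
  assumes f: "L2 \<Omega> f" and g: "L2 \<Omega> g"
  shows "c / 2 * (l2_norm \<Omega> (\<lambda>x. g x - f x))\<^sup>2 \<le>
           Phi \<Omega> W h g - Phi \<Omega> W h f - l2_ip \<Omega> (\<lambda>x. DW x (f x) - h x) (\<lambda>x. g x - f x)" (is ?lower)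
    and "Phi \<Omega> W h g - Phi \<Omega> W h f - l2_ip \<Omega> (\<lambda>x. DW x (f x) - h x) (\<lambda>x. g x - f x) \<le>
           K / 2 * (l2_norm \<Omega> (\<lambda>x. g x - f x))\<^sup>2" (is ?upper)
proof -
  let ?R = "\<lambda>x. W x (g x) - W x (f x) - DW x (f x) \<bullet> (g x - f x)"
  have gf: "L2 \<Omega> (\<lambda>x. g x - f x)" by (rule L2_diff[OF g f])
  have ints: "integrable M (\<lambda>x. W x (g x))" "integrable M (\<lambda>x. W x (f x))"
    "integrable M (\<lambda>x. h x \<bullet> g x)" "integrable M (\<lambda>x. h x \<bullet> f x)"
    "integrable M (\<lambda>x. DW x (f x) \<bullet> (g x - f x))" "integrable M (\<lambda>x. h x \<bullet> (g x - f x))"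
    using f g gf by (auto intro: W_integrable integrable_L2_inner h_L2 DW_L2)
  have R: "integrable M ?R" using ints by auto
  have sq: "integrable M (\<lambda>x. (norm (g x - f x))\<^sup>2)" using gf by (simp add: L2_iff)
  have nrm: "(l2_norm \<Omega> (\<lambda>x. g x - f x))\<^sup>2 = (\<integral>x. (norm (g x - f x))\<^sup>2 \<partial>M)"
    by (simp add: l2_norm_sq l2_ip_eq power2_norm_eq_inner)
  have "(\<integral>x. ?R x \<partial>M) = (\<integral>x. W x (g x) \<partial>M) - (\<integral>x. W x (f x) \<partial>M) - (\<integral>x. DW x (f x) \<bullet> (g x - f x) \<partial>M)"
    using ints by simp
  moreover have "Phi \<Omega> W h g = (\<integral>x. W x (g x) \<partial>M) - (\<integral>x. h x \<bullet> g x \<partial>M)"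
    "Phi \<Omega> W h f = (\<integral>x. W x (f x) \<partial>M) - (\<integral>x. h x \<bullet> f x \<partial>M)"
    using ints by (simp_all add: Phi_def set_integral_eq)
  moreover have "l2_ip \<Omega> (\<lambda>x. DW x (f x) - h x) (\<lambda>x. g x - f x) =
      (\<integral>x. DW x (f x) \<bullet> (g x - f x) \<partial>M) - (\<integral>x. h x \<bullet> (g x - f x) \<partial>M)"
    unfolding l2_ip_eq inner_diff_left[of "DW _ _"] using ints by (intro Bochner_Integration.integral_diff)
  moreover have "(\<integral>x. h x \<bullet> (g x - f x) \<partial>M) = (\<integral>x. h x \<bullet> g x \<partial>M) - (\<integral>x. h x \<bullet> f x \<partial>M)"
    using ints by (simp add: inner_diff_right)
  ultimately have eq: "Phi \<Omega> W h g - Phi \<Omega> W h f - l2_ip \<Omega> (\<lambda>x. DW x (f x) - h x) (\<lambda>x. g x - f x) = (\<integral>x. ?R x \<partial>M)"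
    by simp
  have "(\<integral>x. c / 2 * (norm (g x - f x))\<^sup>2 \<partial>M) \<le> (\<integral>x. ?R x \<partial>M)"
    by (rule integral_mono) (use sq R W_lower in auto)
  then show ?lower unfolding eq nrm using sq by simp
  have "(\<integral>x. ?R x \<partial>M) \<le> (\<integral>x. K / 2 * (norm (g x - f x))\<^sup>2 \<partial>M)"
    by (rule integral_mono) (use sq R W_upper in auto)
  then show ?upper unfolding eq nrm using sq by simp
qed

end

locale variational_problem =
  curl_space \<Omega> V crl C + convex_energy \<Omega> W DW h c K
  for \<Omega> :: "(real^'n) set" and V :: "(real^'n \<Rightarrow> 'b::euclidean_space) set" and crl C W DW h c K
begin

definition F :: "(real^'n \<Rightarrow> 'b) \<Rightarrow> real" where
  "F v = Phi \<Omega> W h (crl v)"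

text \<open>The directional derivative of \<open>F\<close> at \<open>a\<close>, in the sense of
  \<open>F_bounds\<close>: the remainder is quadratic in the step.\<close>

definition G :: "(real^'n \<Rightarrow> 'b) \<Rightarrow> (real^'n \<Rightarrow> 'b) \<Rightarrow> real" where
  "G a v = l2_ip \<Omega> (\<lambda>x. DW x (crl a x) - h x) (crl v)"

text \<open>The step \<open>t\<close> stays explicit: 1 compares two potentials, 1/2 and -1/2 give
  the midpoint estimate, and general \<open>t\<close> serves the Euler-Lagrange equation and the
  line search.\<close>

lemma F_bounds:
  assumes a: "a \<in> V" and v: "v \<in> V"
  shows "c / 2 * t\<^sup>2 * (l2_norm \<Omega> (crl v))\<^sup>2 \<le> F (\<lambda>x. a x + t *\<^sub>R v x) - F a - t * G a v"
    and "F (\<lambda>x. a x + t *\<^sub>R v x) - F a - t * G a v \<le> K / 2 * t\<^sup>2 * (l2_norm \<Omega> (crl v))\<^sup>2"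
proof -
  let ?b = "\<lambda>x. a x + t *\<^sub>R v x"
  have b: "?b \<in> V" by (rule V_add[OF a v])
  have L: "L2 \<Omega> (crl a)" "L2 \<Omega> (crl v)" "L2 \<Omega> (crl ?b)" "L2 \<Omega> (\<lambda>x. crl ?b x - crl a x)"
    "L2 \<Omega> (\<lambda>x. t *\<^sub>R crl v x)"
    using a v b by (auto intro: crl_L2 L2_diff L2_scaleR)
  have ae: "AE x in M. crl ?b x - crl a x = t *\<^sub>R crl v x"
    using crl_add[OF a v, of t] by eventually_elim simp
  have "l2_norm \<Omega> (\<lambda>x. crl ?b x - crl a x) = \<bar>t\<bar> * l2_norm \<Omega> (crl v)"
    using l2_norm_cong_AE[OF L(4,5) ae] by (simp add: l2_norm_scaleR)
  moreover have "l2_ip \<Omega> (\<lambda>x. DW x (crl a x) - h x) (\<lambda>x. crl ?b x - crl a x) = t * G a v"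
    using l2_ip_cong_AE[OF residual_L2[OF L(1)] L(4) residual_L2[OF L(1)] L(5) _ ae]
    by (simp add: l2_ip_scaleR_right G_def)
  ultimately show "c / 2 * t\<^sup>2 * (l2_norm \<Omega> (crl v))\<^sup>2 \<le> F ?b - F a - t * G a v"
    and "F ?b - F a - t * G a v \<le> K / 2 * t\<^sup>2 * (l2_norm \<Omega> (crl v))\<^sup>2"
    using Phi_bounds[OF L(1) L(3)] by (simp_all add: F_def power_mult_distrib)
qed

lemma F_diff_bounds:
  assumes a: "a \<in> V" and b: "b \<in> V"
  shows "c / 2 * (l2_norm \<Omega> (crl (\<lambda>x. b x - a x)))\<^sup>2 \<le> F b - F a - G a (\<lambda>x. b x - a x)"
    and "F b - F a - G a (\<lambda>x. b x - a x) \<le> K / 2 * (l2_norm \<Omega> (crl (\<lambda>x. b x - a x)))\<^sup>2"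
  using F_bounds[OF a V_diff[OF b a], of 1] by simp_all

lemma G_bound:
  assumes "a \<in> V" "v \<in> V"
  shows "\<bar>G a v\<bar> \<le> l2_norm \<Omega> (\<lambda>x. DW x (crl a x) - h x) * l2_norm \<Omega> (crl v)"
  unfolding G_def using assms by (intro l2_Cauchy_Schwarz residual_L2 crl_L2)

lemma G_diff_swap:
  assumes "a \<in> V" "u \<in> V" "v \<in> V"
  shows "G a (\<lambda>x. u x - v x) = - G a (\<lambda>x. v x - u x)"
proof -
  have "AE x in M. crl (\<lambda>x. u x - v x) x = (- 1) *\<^sub>R crl (\<lambda>x. v x - u x) x"
    using crl_diff[OF assms(2,3)] crl_diff[OF assms(3,2)] by eventually_elim simp
  then have "G a (\<lambda>x. u x - v x) = l2_ip \<Omega> (\<lambda>x. DW x (crl a x) - h x) (\<lambda>x. (- 1) *\<^sub>R crl (\<lambda>x. v x - u x) x)"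
    unfolding G_def using assms
    by (intro l2_ip_cong_AE residual_L2 crl_L2 V_diff L2_scaleR) auto
  then show ?thesis by (simp only: G_def l2_ip_scaleR_right)
qed

text \<open>The lower model at the zero potential, with the derivative bounded by Cauchy-Schwarz, is
  c N^2 / 2 - B N; its minimum, at N = B / c, is -B^2 / (2 c).\<close>

lemma F_bounded_below:
  obtains m where "\<And>v. v \<in> V \<Longrightarrow> m \<le> F v"
proof -
  let ?z = "\<lambda>x. 0 :: 'b"
  define B where "B = l2_norm \<Omega> (\<lambda>x. DW x (crl ?z x) - h x)"
  have "F ?z - B\<^sup>2 / (2 * c) \<le> F v" if v: "v \<in> V" for v
  proof -
    define N where "N = l2_norm \<Omega> (crl v)"
    have "c / 2 * N\<^sup>2 \<le> F v - F ?z - G ?z v"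
      using F_diff_bounds(1)[OF V_zero v] by (simp add: N_def)
    moreover have "- (B * N) \<le> G ?z v"
      using G_bound[OF V_zero v] by (simp add: B_def N_def)
    moreover have "0 \<le> c / 2 * (N - B / c)\<^sup>2" using c_pos by simp
    moreover have "c / 2 * (N - B / c)\<^sup>2 = c / 2 * N\<^sup>2 - B * N + B\<^sup>2 / (2 * c)"
      using c_pos by (simp add: power2_eq_square field_simps)
    ultimately show ?thesis by linarith
  qed
  then show ?thesis using that by blast
qed

text \<open>Strong convexity makes the curls of a minimizing sequence converge in norm, so a limit
  potential comes from \<open>complete\<close>, and continuity of the derivative term at that limit
  suffices to pass to the infimum.\<close>

theorem minimizer_exists: "\<exists>u\<in>V. \<forall>v\<in>V. F u \<le> F v"
proof -
  define m where "m = Inf (F ` V)"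
  have bdd: "bdd_below (F ` V)" using F_bounded_below by (metis bdd_belowI2)
  have m: "m \<le> F v" if "v \<in> V" for v
    unfolding m_def using bdd that by (intro cInf_lower) auto
  have "\<exists>v\<in>V. F v < m + 1 / real (Suc k)" for k
  proof -
    have "Inf (F ` V) < m + 1 / real (Suc k)" by (simp add: m_def)
    then show ?thesis using V_zero bdd by (subst (asm) cInf_less_iff) auto
  qed
  then obtain v where v: "\<And>k. v k \<in> V" "\<And>k. F (v k) < m + 1 / real (Suc k)" by metis
  \<comment> \<open>The lower model at the midpoint in the two opposite directions: the derivative
    terms cancel, and twice c/2 * (1/2)^2 gives c/4.\<close>
  have close: "c / 4 * (l2_norm \<Omega> (\<lambda>x. crl (v i) x - crl (v j) x))\<^sup>2 \<le> 1 / real (Suc i) + 1 / real (Suc j)" for i j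
  proof -
    let ?d = "\<lambda>x. v i x - v j x"
    let ?m = "\<lambda>x. v j x + (1/2) *\<^sub>R ?d x"
    have d: "?d \<in> V" using v by (intro V_diff)
    then have md: "?m \<in> V" using v by (intro V_add)
    have i: "(\<lambda>x. ?m x + (1/2) *\<^sub>R ?d x) = v i"
      by (rule ext) (simp flip: scaleR_left.add add: add.assoc)
    have j: "(\<lambda>x. ?m x + (-1/2) *\<^sub>R ?d x) = v j"
      by (rule ext) simp
    have "c / 2 * (1/2)\<^sup>2 * (l2_norm \<Omega> (crl ?d))\<^sup>2 \<le> F (v i) - F ?m - 1/2 * G ?m ?d"
      using F_bounds(1)[OF md d, of "1/2"] unfolding i .
    moreover have "c / 2 * (-1/2)\<^sup>2 * (l2_norm \<Omega> (crl ?d))\<^sup>2 \<le> F (v j) - F ?m - (-1/2) * G ?m ?d"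
      using F_bounds(1)[OF md d, of "-1/2"] unfolding j .
    moreover have "m \<le> F ?m" by (rule m[OF md])
    ultimately show ?thesis
      using v(2)[of i] v(2)[of j] unfolding l2_norm_crl_diff[OF v(1) v(1)]
      by (simp add: power2_eq_square)
  qed
  have "\<exists>u\<in>V. (\<lambda>k. l2_norm \<Omega> (\<lambda>x. crl (v k) x - crl u x)) \<longlonglongrightarrow> 0"
  proof (rule complete[OF v(1)])
    fix e :: real assume e: "e > 0"
    \<comment> \<open>Two terms of this size stay below c/4 * e^2, as \<open>close\<close>
      requires.\<close>
    obtain N where N: "inverse (real (Suc N)) < c / 8 * e\<^sup>2"
      using reals_Archimedean[of "c / 8 * e\<^sup>2"] c_pos e by auto
    have "l2_norm \<Omega> (\<lambda>x. crl (v i) x - crl (v j) x) < e" if "i \<ge> N" "j \<ge> N" for i j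
    proof -
      have "1 / real (Suc i) \<le> inverse (real (Suc N))" "1 / real (Suc j) \<le> inverse (real (Suc N))"
        using that by (auto simp: field_simps)
      then have "c / 4 * (l2_norm \<Omega> (\<lambda>x. crl (v i) x - crl (v j) x))\<^sup>2 < c / 4 * e\<^sup>2"
        using close[of i j] N by linarith
      then have "(l2_norm \<Omega> (\<lambda>x. crl (v i) x - crl (v j) x))\<^sup>2 < e\<^sup>2"
        using c_pos by simp
      then show ?thesis using e by (meson less_imp_le power2_less_imp_less)
    qed
    then show "\<exists>N. \<forall>i\<ge>N. \<forall>j\<ge>N. l2_norm \<Omega> (\<lambda>x. crl (v i) x - crl (v j) x) < e"
      by (intro exI[of _ N]) simp
  qed
  then obtain u where u: "u \<in> V" "(\<lambda>k. l2_norm \<Omega> (\<lambda>x. crl (v k) x - crl u x)) \<longlonglongrightarrow> 0" by blast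
  define B where "B = l2_norm \<Omega> (\<lambda>x. DW x (crl u x) - h x)"
  \<comment> \<open>The lower model at \<open>u\<close>, without its square, bounds
    \<open>F u\<close> by \<open>F (v k)\<close> minus a derivative term that is at most
    \<open>B\<close> times the curl distance.\<close>
  have "F u \<le> m + 1 / real (Suc k) + B * l2_norm \<Omega> (\<lambda>x. crl (v k) x - crl u x)" for k
  proof -
    let ?d = "\<lambda>x. v k x - u x"
    have "0 \<le> c / 2 * (l2_norm \<Omega> (crl ?d))\<^sup>2" using c_pos by simp
    also have "\<dots> \<le> F (v k) - F u - G u ?d"
      by (rule F_diff_bounds(1)[OF u(1) v(1)])
    finally have "F u \<le> F (v k) - G u ?d" by simp
    moreover have "\<bar>G u ?d\<bar> \<le> B * l2_norm \<Omega> (\<lambda>x. crl (v k) x - crl u x)"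
      using G_bound[OF u(1) V_diff[OF v(1) u(1)]] l2_norm_crl_diff[OF v(1) u(1)] by (simp add: B_def)
    ultimately show ?thesis using v(2)[of k] by linarith
  qed
  moreover have "(\<lambda>k. m + 1 / real (Suc k) + B * l2_norm \<Omega> (\<lambda>x. crl (v k) x - crl u x)) \<longlonglongrightarrow> m + 0 + B * 0"
    by (intro tendsto_intros u(2)) (use LIMSEQ_inverse_real_of_nat in \<open>simp add: inverse_eq_divide\<close>)
  ultimately have "F u \<le> m" by (metis (no_types, lifting) LIMSEQ_le_const add.right_neutral mult_zero_right)
  then show ?thesis using m u(1) by (meson order_trans)
qed

text \<open>Necessity follows from the upper model along a line, sufficiency from the lower model,
  which then has no linear term.\<close>

theorem minimizer_iff:
  assumes b: "b \<in> V"
  shows "(\<forall>v\<in>V. F b \<le> F v) \<longleftrightarrow> (\<forall>v\<in>V. G b v = 0)"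
proof safe
  fix v assume min: "\<forall>v\<in>V. F b \<le> F v" and v: "v \<in> V"
  define N where "N = K * (l2_norm \<Omega> (crl v))\<^sup>2"
  define g where "g = G b v"
  \<comment> \<open>The upper model is at most t g + t^2 N / 2, minimal at t = -g / N. The
    denominator N + 1 avoids division by zero when the curl of \<open>v\<close> vanishes and still
    gives a negative value unless g = 0.\<close>
  define r where "r = g / (N + 1)"
  define t where "t = - r"
  have N: "N \<ge> 0" using K_pos by (simp add: N_def)
  then have g: "g = r * (N + 1)" by (simp add: r_def)
  have "F b \<le> F (\<lambda>x. b x + t *\<^sub>R v x)" using min V_add[OF b v] by blast
  then have "0 \<le> t * g + t\<^sup>2 * N / 2"
    using F_bounds(2)[OF b v, of t] by (simp add: g_def N_def mult_ac)
  also have "\<dots> = - (r\<^sup>2 * (N / 2 + 1))"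
    by (simp add: t_def g algebra_simps power2_eq_square)
  finally have "r = 0"
    using N by (simp add: mult_le_0_iff)
  then show "G b v = 0" using g by (simp add: g_def)
next
  fix v assume EL: "\<forall>v\<in>V. G b v = 0" and v: "v \<in> V"
  have "0 \<le> c / 2 * (l2_norm \<Omega> (crl (\<lambda>x. v x - b x)))\<^sup>2" using c_pos by simp
  then show "F b \<le> F v"
    using F_diff_bounds(1)[OF b v] EL V_diff[OF v b] by simp
qed

text \<open>The lower model at one critical point forces equal curls; the Poincare inequality then
  identifies the potentials up to norm zero.\<close>

lemma minimizer_unique:
  assumes a: "a \<in> V" "\<forall>v\<in>V. G a v = 0" and b: "b \<in> V" "\<forall>v\<in>V. G b v = 0"
  shows "l2_norm \<Omega> (\<lambda>x. b x - a x) = 0"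
proof -
  have "F b \<le> F a" using minimizer_iff[OF b(1)] b(2) a(1) by blast
  then have "c / 2 * (l2_norm \<Omega> (crl (\<lambda>x. b x - a x)))\<^sup>2 \<le> 0"
    using F_diff_bounds(1)[OF a(1) b(1)] a(2) V_diff[OF b(1) a(1)] by simp
  then have "l2_norm \<Omega> (crl (\<lambda>x. b x - a x)) = 0"
    using c_pos by (simp add: mult_le_0_iff)
  then show ?thesis by (intro l2_norm_eq_0_if_crl V_diff a b)
qed

end

subsection \<open>The damped iteration\<close>

lemma symmetric_matrix_inner:
  fixes A :: "real^'n^'n"
  assumes "transpose A = A"
  shows "(A *v x) \<bullet> y = (A *v y) \<bullet> x"
  using dot_lmul_matrix[of x A y] assms vector_transpose_matrix[of x A] by (simp add: inner_commute)

text \<open>For a quadratic density the remainder of first order is exactly half the form at the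
  difference, so ellipticity and boundedness are its two models.\<close>

lemma quadratic_form_expansion:
  fixes A :: "real^'n^'n"
  assumes "transpose A = A"
  shows "(1/2) * ((A *v z) \<bullet> z) - (1/2) * ((A *v y) \<bullet> y) - (A *v y) \<bullet> (z - y) = (1/2) * ((A *v (z - y)) \<bullet> (z - y))"
  using symmetric_matrix_inner[OF assms, of y z]
  by (simp add: matrix_vector_mult_diff_distrib inner_diff_left inner_diff_right algebra_simps)

text \<open>Cocoercivity of the gradient of half the quadratic form, taken between \<xi> and 0. This
  is the operator inequality A^2 <= \<beta> A, obtained without diagonalizing.\<close>

lemma elliptic_matrix_bounds:
  fixes A :: "real^'n^'n"
  assumes "\<beta> > 0" "transpose A = A" "\<And>\<xi>. 0 \<le> (A *v \<xi>) \<bullet> \<xi>" "\<And>\<xi>. (A *v \<xi>) \<bullet> \<xi> \<le> \<beta> * (norm \<xi>)\<^sup>2"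
  shows "(norm (A *v \<xi>))\<^sup>2 \<le> \<beta> * ((A *v \<xi>) \<bullet> \<xi>)" "norm (A *v \<xi>) \<le> \<beta> * norm \<xi>"
proof -
  let ?f = "\<lambda>\<xi>. (1/2) * ((A *v \<xi>) \<bullet> \<xi>)"
  have lower: "?f y + (A *v y) \<bullet> (z - y) \<le> ?f z" for y z
    using quadratic_form_expansion[OF assms(2), of z y] assms(3)[of "z - y"] by linarith
  have upper: "?f z \<le> ?f y + (A *v y) \<bullet> (z - y) + \<beta> / 2 * (norm (z - y))\<^sup>2" for y z
    using quadratic_form_expansion[OF assms(2), of z y] assms(4)[of "z - y"] by linarith
  show "(norm (A *v \<xi>))\<^sup>2 \<le> \<beta> * ((A *v \<xi>) \<bullet> \<xi>)"
    using quadratic_model_cocoercive[of \<beta> ?f "\<lambda>\<xi>. A *v \<xi>", OF assms(1) lower upper, of \<xi> 0] by simp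
  show "norm (A *v \<xi>) \<le> \<beta> * norm \<xi>"
    using quadratic_model_lipschitz[of \<beta> ?f "\<lambda>\<xi>. A *v \<xi>", OF assms(1) lower upper, of \<xi> 0] by simp
qed

locale armijo_iteration =
  variational_problem \<Omega> V crl C w "\<lambda>x. grad (w x)" hs \<gamma> L
  for \<Omega> :: "(real^'n) set" and V :: "(real^'n \<Rightarrow> 'b::euclidean_space) set" and crl C w hs \<gamma> L +
  fixes \<nu> :: "nat \<Rightarrow> real^'n \<Rightarrow> real^'n \<Rightarrow> real^'n^'n" and \<alpha> \<beta> \<rho> \<sigma> :: real
  assumes nonempty: "\<Omega> \<noteq> {}" and \<gamma>_le_L: "\<gamma> \<le> L"
    and \<alpha>: "0 < \<alpha>" and \<beta>: "0 < \<beta>" and \<rho>: "0 < \<rho>" "\<rho> < 1" and \<sigma>: "0 < \<sigma>" "\<sigma> < 1/2"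
    and \<nu>: "reluctivities \<Omega> \<nu> \<alpha> \<beta>"
begin

section \<open>Reluctivity fields\<close>

lemma \<nu>_sym: "x \<in> \<Omega> \<Longrightarrow> transpose (\<nu> n x \<eta>) = \<nu> n x \<eta>"
  and \<nu>_lower: "x \<in> \<Omega> \<Longrightarrow> \<alpha> * (norm \<xi>)\<^sup>2 \<le> (\<nu> n x \<eta> *v \<xi>) \<bullet> \<xi>"
  and \<nu>_upper: "x \<in> \<Omega> \<Longrightarrow> (\<nu> n x \<eta> *v \<xi>) \<bullet> \<xi> \<le> \<beta> * (norm \<xi>)\<^sup>2"
  using \<nu> unfolding reluctivities_def by auto

lemma \<nu>_nonneg: "x \<in> \<Omega> \<Longrightarrow> 0 \<le> (\<nu> n x \<eta> *v \<xi>) \<bullet> \<xi>"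
  using \<nu>_lower[of x \<xi> n \<eta>] \<alpha> by (meson less_imp_le mult_nonneg_nonneg order_trans zero_le_power2)

text \<open>Both bounds are evaluated at a unit vector at some point of the domain; this order
  enters the proof that \<open>q\<close> is nonnegative.\<close>

lemma \<alpha>_le_\<beta>: "\<alpha> \<le> \<beta>"
proof -
  obtain x where "x \<in> \<Omega>" using nonempty by blast
  then have "\<alpha> * (norm (axis undefined 1 :: real^'n))\<^sup>2 \<le> \<beta> * (norm (axis undefined 1 :: real^'n))\<^sup>2"
    using \<nu>_lower \<nu>_upper order_trans by blast
  then show ?thesis by simp
qed

lemma \<nu>_borel:
  assumes f: "f \<in> borel_measurable M"
  shows "(\<lambda>x. \<nu> n x (f x)) \<in> borel_measurable M"
proof -
  \<comment> \<open>The measurability hypothesis on \<nu> concerns fields on the whole space, so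
    \<open>f\<close> is extended by zero; values outside the domain are cut off again.\<close>
  have "(\<lambda>x. indicator \<Omega> x *\<^sub>R f x) \<in> borel_measurable lebesgue"
    using f by (simp add: borel_measurable_restrict_space_iff)
  then have "(\<lambda>x. indicator \<Omega> x *\<^sub>R \<nu> n x (indicator \<Omega> x *\<^sub>R f x)) \<in> borel_measurable lebesgue"
    using \<nu> unfolding reluctivities_def by blast
  moreover have "(\<lambda>x. indicator \<Omega> x *\<^sub>R \<nu> n x (indicator \<Omega> x *\<^sub>R f x)) = (\<lambda>x. indicator \<Omega> x *\<^sub>R \<nu> n x (f x))"
    by (auto simp: indicator_def)
  ultimately show ?thesis by (simp add: borel_measurable_restrict_space_iff)
qed

lemma \<nu>_L2:
  assumes f: "f \<in> borel_measurable M" and g: "L2 \<Omega> g"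
  shows "L2 \<Omega> (\<lambda>x. \<nu> n x (f x) *v g x)"
proof (rule L2_dominated)
  have gm: "g \<in> borel_measurable M" using g by (simp add: L2_iff)
  show "(\<lambda>x. \<nu> n x (f x) *v g x) \<in> borel_measurable M"
    by (rule borel_measurable_bilinear[OF _ \<nu>_borel[OF f] gm])
       (simp_all add: bilinear_def linear_iff matrix_vector_mult_add_rdistrib
         matrix_vector_right_distrib scaleR_matrix_vector_assoc matrix_vector_mult_scaleR)
  show "integrable M (\<lambda>x. \<beta>\<^sup>2 * (norm (g x))\<^sup>2)" using g by (simp add: L2_iff)
  show "AE x in M. (norm (\<nu> n x (f x) *v g x))\<^sup>2 \<le> \<beta>\<^sup>2 * (norm (g x))\<^sup>2"
  proof (rule AE_I2)
    fix x assume "x \<in> space M"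
    then have "norm (\<nu> n x (f x) *v g x) \<le> \<beta> * norm (g x)"
      by (intro elliptic_matrix_bounds \<beta> \<nu>_sym \<nu>_upper \<nu>_nonneg) auto
    then have "(norm (\<nu> n x (f x) *v g x))\<^sup>2 \<le> (\<beta> * norm (g x))\<^sup>2" by (intro power_mono) auto
    then show "(norm (\<nu> n x (f x) *v g x))\<^sup>2 \<le> \<beta>\<^sup>2 * (norm (g x))\<^sup>2" by (simp add: power_mult_distrib)
  qed
qed

text \<open>The tensor is frozen at the curl of the current iterate and the load is the negative
  residual; the Euler-Lagrange equation of this energy is then the equation of the step.\<close>

lemma linear_problem:
  assumes a: "a \<in> V"
  shows "variational_problem \<Omega> V crl C
    (\<lambda>x \<xi>. (1/2) * ((\<nu> n x (crl a x) *v \<xi>) \<bullet> \<xi>)) (\<lambda>x \<xi>. \<nu> n x (crl a x) *v \<xi>)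
    (\<lambda>x. hs x - grad (w x) (crl a x)) \<alpha> \<beta>"
proof -
  have am: "crl a \<in> borel_measurable M" using crl_L2[OF a] by (simp add: L2_iff)
  show ?thesis
  proof unfold_locales
    fix x y z :: "real^'n" assume x: "x \<in> \<Omega>"
    show "\<alpha> / 2 * (norm (z - y))\<^sup>2 \<le> (1/2) * ((\<nu> n x (crl a x) *v z) \<bullet> z)
        - (1/2) * ((\<nu> n x (crl a x) *v y) \<bullet> y) - (\<nu> n x (crl a x) *v y) \<bullet> (z - y)"
      unfolding quadratic_form_expansion[OF \<nu>_sym[OF x]] using \<nu>_lower[OF x, of "z - y"] by simp
    show "(1/2) * ((\<nu> n x (crl a x) *v z) \<bullet> z)
        - (1/2) * ((\<nu> n x (crl a x) *v y) \<bullet> y) - (\<nu> n x (crl a x) *v y) \<bullet> (z - y) \<le> \<beta> / 2 * (norm (z - y))\<^sup>2"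
      unfolding quadratic_form_expansion[OF \<nu>_sym[OF x]] using \<nu>_upper[OF x, of _ _ "z - y"] by simp
  next
    fix f :: "real^'n \<Rightarrow> real^'n" assume f: "L2 \<Omega> f"
    show "L2 \<Omega> (\<lambda>x. \<nu> n x (crl a x) *v f x)" by (rule \<nu>_L2[OF am f])
    then show "integrable M (\<lambda>x. (1/2) * ((\<nu> n x (crl a x) *v f x) \<bullet> f x))"
      using integrable_L2_inner[OF _ f] by simp
  next
    show "L2 \<Omega> (\<lambda>x. hs x - grad (w x) (crl a x))"
      by (intro L2_diff h_L2 DW_L2 crl_L2 a)
  qed (use \<alpha> \<beta> in auto)
qed

section \<open>Solvability and descent of the linear step\<close>

lemma lin_step_iff:
  assumes a: "a \<in> V"
  shows "lin_step \<Omega> V crl w hs (\<nu> n) a \<delta> \<longleftrightarrow> \<delta> \<in> V \<and>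
    (\<forall>v\<in>V. l2_ip \<Omega> (\<lambda>x. \<nu> n x (crl a x) *v crl \<delta> x - (hs x - grad (w x) (crl a x))) (crl v) = 0)"
proof -
  have "L2 \<Omega> (\<lambda>x. \<nu> n x (crl a x) *v crl \<delta> x)" if "\<delta> \<in> V"
    using crl_L2[OF a] crl_L2[OF that] by (intro \<nu>_L2) (auto simp: L2_iff)
  moreover have "L2 \<Omega> (\<lambda>x. hs x - grad (w x) (crl a x))"
    by (intro L2_diff h_L2 DW_L2 crl_L2 a)
  ultimately show ?thesis
    unfolding lin_step_def by (auto simp: l2_ip_diff_left crl_L2)
qed

lemma lin_step_exists:
  assumes a: "a \<in> V"
  shows "\<exists>\<delta>. lin_step \<Omega> V crl w hs (\<nu> n) a \<delta>"
proof -
  interpret lp: variational_problem \<Omega> V crl C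
    "\<lambda>x \<xi>. (1/2) * ((\<nu> n x (crl a x) *v \<xi>) \<bullet> \<xi>)" "\<lambda>x \<xi>. \<nu> n x (crl a x) *v \<xi>"
    "\<lambda>x. hs x - grad (w x) (crl a x)" \<alpha> \<beta>
    by (rule linear_problem[OF a])
  obtain \<delta> where "\<delta> \<in> V" "\<forall>v\<in>V. lp.F \<delta> \<le> lp.F v" using lp.minimizer_exists by blast
  then show ?thesis
    using lp.minimizer_iff unfolding lin_step_iff[OF a] lp.G_def by blast
qed

lemma lin_step_unique:
  assumes a: "a \<in> V" and "lin_step \<Omega> V crl w hs (\<nu> n) a \<delta>1" "lin_step \<Omega> V crl w hs (\<nu> n) a \<delta>2"
  shows "l2_norm \<Omega> (\<lambda>x. \<delta>1 x - \<delta>2 x) = 0"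
proof -
  interpret lp: variational_problem \<Omega> V crl C
    "\<lambda>x \<xi>. (1/2) * ((\<nu> n x (crl a x) *v \<xi>) \<bullet> \<xi>)" "\<lambda>x \<xi>. \<nu> n x (crl a x) *v \<xi>"
    "\<lambda>x. hs x - grad (w x) (crl a x)" \<alpha> \<beta>
    by (rule linear_problem[OF a])
  show ?thesis
    using assms(2,3) unfolding lin_step_iff[OF a]
    by (intro lp.minimizer_unique) (auto simp: lp.G_def)
qed

lemma lin_step_G:
  assumes a: "a \<in> V" and st: "lin_step \<Omega> V crl w hs (\<nu> n) a \<delta>" and v: "v \<in> V"
  shows "G a v = - l2_ip \<Omega> (\<lambda>x. \<nu> n x (crl a x) *v crl \<delta> x) (crl v)"
proof -
  have "G a v = - l2_ip \<Omega> (\<lambda>x. hs x - grad (w x) (crl a x)) (crl v)"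
    using a v by (simp add: G_def l2_ip_diff_left h_L2 DW_L2 crl_L2)
  then show ?thesis using st v by (simp add: lin_step_def)
qed

text \<open>Test the step equation with \<delta> itself and integrate pointwise matrix bounds. The
  first estimate controls the line search, the second compares the slope with the error.\<close>

lemma lin_step_descent:
  assumes a: "a \<in> V" and st: "lin_step \<Omega> V crl w hs (\<nu> n) a \<delta>"
  shows "\<alpha> * (l2_norm \<Omega> (crl \<delta>))\<^sup>2 \<le> - G a \<delta>"
    and "(l2_norm \<Omega> (\<lambda>x. \<nu> n x (crl a x) *v crl \<delta> x))\<^sup>2 \<le> \<beta> * (- G a \<delta>)"
proof -
  let ?N = "\<lambda>x. \<nu> n x (crl a x) *v crl \<delta> x"
  have d: "\<delta> \<in> V" using st by (simp add: lin_step_def)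
  have N: "L2 \<Omega> ?N" using crl_L2[OF a] crl_L2[OF d] by (intro \<nu>_L2) (auto simp: L2_iff)
  have s: "- G a \<delta> = (\<integral>x. ?N x \<bullet> crl \<delta> x \<partial>M)"
    using lin_step_G[OF a st d] by (simp add: l2_ip_eq)
  have int: "integrable M (\<lambda>x. ?N x \<bullet> crl \<delta> x)" by (rule integrable_L2_inner[OF N crl_L2[OF d]])
  have sq: "(l2_norm \<Omega> f)\<^sup>2 = (\<integral>x. (norm (f x))\<^sup>2 \<partial>M)" for f :: "real^'n \<Rightarrow> real^'n"
    by (simp add: l2_norm_sq l2_ip_eq power2_norm_eq_inner)
  have "(\<integral>x. \<alpha> * (norm (crl \<delta> x))\<^sup>2 \<partial>M) \<le> (\<integral>x. ?N x \<bullet> crl \<delta> x \<partial>M)"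
    using crl_L2[OF d] int \<nu>_lower by (intro integral_mono) (auto simp: L2_iff)
  then show "\<alpha> * (l2_norm \<Omega> (crl \<delta>))\<^sup>2 \<le> - G a \<delta>" unfolding s sq by simp
  have "(\<integral>x. (norm (?N x))\<^sup>2 \<partial>M) \<le> (\<integral>x. \<beta> * (?N x \<bullet> crl \<delta> x) \<partial>M)"
  proof (rule integral_mono)
    show "integrable M (\<lambda>x. (norm (?N x))\<^sup>2)" using N by (simp add: L2_iff)
    show "(norm (?N x))\<^sup>2 \<le> \<beta> * (?N x \<bullet> crl \<delta> x)" if "x \<in> space M" for x
      using that by (intro elliptic_matrix_bounds \<beta> \<nu>_sym \<nu>_upper \<nu>_nonneg) auto
  qed (use int in simp)
  then show "(l2_norm \<Omega> ?N)\<^sup>2 \<le> \<beta> * (- G a \<delta>)" unfolding s sq by simp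
qed

section \<open>Armijo backtracking\<close>

lemma armijo_set_iff:
  "t \<in> armijo_set \<Omega> crl w hs \<rho> \<sigma> a \<delta> \<longleftrightarrow>
    (\<exists>k::nat. t = \<rho> ^ k \<and> F (\<lambda>x. a x + t *\<^sub>R \<delta> x) \<le> F a + \<sigma> * t * G a \<delta>)"
  unfolding armijo_set_def F_def G_def by simp

text \<open>In the upper model the quadratic term is L t^2 D / 2, and \<alpha> D is at most the
  slope s = -G a \<delta>; up to the threshold it consumes at most the share 1 - \<sigma> of the
  predicted decrease t s.\<close>

lemma small_step_admissible:
  assumes a: "a \<in> V" and st: "lin_step \<Omega> V crl w hs (\<nu> n) a \<delta>"
    and t: "0 \<le> t" "t \<le> 2 * (1 - \<sigma>) * \<alpha> / L"
  shows "F (\<lambda>x. a x + t *\<^sub>R \<delta> x) \<le> F a + \<sigma> * t * G a \<delta>"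
proof -
  define D where "D = (l2_norm \<Omega> (crl \<delta>))\<^sup>2"
  have d: "\<delta> \<in> V" using st by (simp add: lin_step_def)
  have "t * L \<le> 2 * (1 - \<sigma>) * \<alpha>" using t(2) K_pos by (simp add: pos_le_divide_eq)
  then have "t * D / 2 * (t * L) \<le> t * D / 2 * (2 * (1 - \<sigma>) * \<alpha>)"
    using t(1) by (intro mult_left_mono) (auto simp: D_def)
  also have "\<dots> = t * (1 - \<sigma>) * (\<alpha> * D)" by simp
  also have "\<dots> \<le> t * (1 - \<sigma>) * (- G a \<delta>)"
    using lin_step_descent(1)[OF a st] t(1) \<sigma> by (intro mult_left_mono) (auto simp: D_def)
  finally have "L / 2 * t\<^sup>2 * D \<le> t * (1 - \<sigma>) * (- G a \<delta>)"
    by (simp add: power2_eq_square mult_ac)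
  then show ?thesis
    using F_bounds(2)[OF a d, of t] by (simp add: D_def algebra_simps)
qed

text \<open>Powers of \<rho> eventually pass below the threshold, and the least accepted exponent
  gives the largest accepted step.\<close>

lemma armijo_max_exists:
  assumes a: "a \<in> V" and st: "lin_step \<Omega> V crl w hs (\<nu> n) a \<delta>"
  shows "\<exists>\<tau>\<in>armijo_set \<Omega> crl w hs \<rho> \<sigma> a \<delta>. \<forall>t\<in>armijo_set \<Omega> crl w hs \<rho> \<sigma> a \<delta>. t \<le> \<tau>"
proof -
  let ?P = "\<lambda>k. F (\<lambda>x. a x + \<rho> ^ k *\<^sub>R \<delta> x) \<le> F a + \<sigma> * \<rho> ^ k * G a \<delta>"
  have "0 < 2 * (1 - \<sigma>) * \<alpha> / L" using \<sigma> \<alpha> K_pos by simp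
  then obtain k where "\<rho> ^ k < 2 * (1 - \<sigma>) * \<alpha> / L" using real_arch_pow_inv \<rho>(2) by blast
  then have "?P k" using \<rho> by (intro small_step_admissible[OF a st]) auto
  then have "?P (LEAST k. ?P k)" by (rule LeastI)
  moreover have "\<rho> ^ j \<le> \<rho> ^ (LEAST k. ?P k)" if "?P j" for j
    using \<rho> Least_le[of ?P, OF that] by (intro power_decreasing) auto
  ultimately show ?thesis
    by (intro bexI[of _ "\<rho> ^ (LEAST k. ?P k)"] ballI) (auto simp: armijo_set_iff)
qed

text \<open>Either the full step 1 is taken, or the step before it, larger by the factor 1/\<rho>,
  was rejected and hence exceeds the threshold.\<close>

lemma armijo_max_lower_bound:
  assumes a: "a \<in> V" and st: "lin_step \<Omega> V crl w hs (\<nu> n) a \<delta>"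
    and \<tau>: "\<tau> \<in> armijo_set \<Omega> crl w hs \<rho> \<sigma> a \<delta>" "\<forall>t\<in>armijo_set \<Omega> crl w hs \<rho> \<sigma> a \<delta>. t \<le> \<tau>"
  shows "\<rho> * min (2 * (1 - \<sigma>) * \<alpha> / L) 1 \<le> \<tau>"
proof -
  obtain k where k: "\<tau> = \<rho> ^ k" using \<tau>(1) by (auto simp: armijo_set_iff)
  show ?thesis
  proof (cases k)
    case 0
    have "\<rho> * min (2 * (1 - \<sigma>) * \<alpha> / L) 1 \<le> 1 * 1"
      using \<rho> \<sigma> \<alpha> K_pos by (intro mult_mono) auto
    then show ?thesis using k 0 by simp
  next
    case (Suc j)
    have "\<not> \<rho> ^ j \<le> 2 * (1 - \<sigma>) * \<alpha> / L"
    proof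
      assume "\<rho> ^ j \<le> 2 * (1 - \<sigma>) * \<alpha> / L"
      then have "F (\<lambda>x. a x + \<rho> ^ j *\<^sub>R \<delta> x) \<le> F a + \<sigma> * \<rho> ^ j * G a \<delta>"
        using \<rho> by (intro small_step_admissible[OF a st]) auto
      then have "\<rho> ^ j \<in> armijo_set \<Omega> crl w hs \<rho> \<sigma> a \<delta>" by (auto simp: armijo_set_iff)
      then have "\<rho> ^ j \<le> \<rho> ^ Suc j" using \<tau>(2) k Suc by blast
      then show False using \<rho> by simp
    qed
    then have "\<rho> * min (2 * (1 - \<sigma>) * \<alpha> / L) 1 \<le> \<rho> * \<rho> ^ j"
      using \<rho> by (intro mult_left_mono) auto
    then show ?thesis using k Suc by simp
  qed
qed

section \<open>The contraction factor and the energy gap\<close>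

definition q :: real where
  "q = 1 - \<rho> * min (2 * (1 - \<sigma>) * \<alpha> / L) 1 * \<sigma> * (2 * \<gamma>\<^sup>2 / (L * \<beta>))"

text \<open>Needed to iterate the contraction, which multiplies inequalities by \<open>q\<close>.
  The subtracted term is at most 4 \<sigma> (1 - \<sigma>) (\<alpha> / \<beta>) (\<gamma> / L)^2,
  and each of these factors is at most 1.\<close>

lemma q_nonneg: "0 \<le> q"
proof -
  have "\<rho> * min (2 * (1 - \<sigma>) * \<alpha> / L) 1 * \<sigma> * (2 * \<gamma>\<^sup>2 / (L * \<beta>)) \<le>
      1 * (2 * (1 - \<sigma>) * \<alpha> / L) * \<sigma> * (2 * \<gamma>\<^sup>2 / (L * \<beta>))"
    using \<rho> \<sigma> \<alpha> \<beta> K_pos by (intro mult_right_mono mult_mono) auto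
  also have "\<dots> = (4 * \<sigma> * (1 - \<sigma>)) * (\<alpha> / \<beta>) * (\<gamma> / L)\<^sup>2"
    using K_pos \<beta> by (simp add: power2_eq_square field_simps)
  also have "\<dots> \<le> 1 * 1 * 1"
  proof (intro mult_mono)
    show "4 * \<sigma> * (1 - \<sigma>) \<le> 1"
      using zero_le_power2[of "2 * \<sigma> - 1"] by (simp add: power2_eq_square algebra_simps)
    show "\<alpha> / \<beta> \<le> 1" using \<alpha>_le_\<beta> \<beta> by simp
    have "(\<gamma> / L)\<^sup>2 \<le> 1\<^sup>2" using \<gamma>_le_L c_pos K_pos by (intro power_mono) auto
    then show "(\<gamma> / L)\<^sup>2 \<le> 1" by simp
  qed (use \<sigma> \<alpha> \<beta> in auto)
  finally show ?thesis by (simp add: q_def)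
qed

lemma q_less_1: "q < 1"
  using \<rho> \<sigma> \<alpha> \<beta> K_pos c_pos by (simp add: q_def)

lemma energy_contraction:
  assumes a: "a \<in> V" and st: "lin_step \<Omega> V crl w hs (\<nu> n) a \<delta>"
    and \<tau>: "\<tau> \<in> armijo_set \<Omega> crl w hs \<rho> \<sigma> a \<delta>" "\<forall>t\<in>armijo_set \<Omega> crl w hs \<rho> \<sigma> a \<delta>. t \<le> \<tau>"
    and m: "m \<in> V" "\<forall>v\<in>V. G m v = 0"
  shows "F (\<lambda>x. a x + \<tau> *\<^sub>R \<delta> x) - F m \<le> q * (F a - F m)"
proof -
  let ?e = "\<lambda>x. a x - m x"
  define E where "E = l2_norm \<Omega> (crl ?e)"
  define N where "N = l2_norm \<Omega> (\<lambda>x. \<nu> n x (crl a x) *v crl \<delta> x)"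
  define s where "s = - G a \<delta>"
  define \<mu> where "\<mu> = min (2 * (1 - \<sigma>) * \<alpha> / L) 1"
  have d: "\<delta> \<in> V" using st by (simp add: lin_step_def)
  have e: "?e \<in> V" by (rule V_diff[OF a m(1)])
  have E: "0 \<le> E" and N: "0 \<le> N" by (simp_all add: E_def N_def)
  have "\<alpha> * (l2_norm \<Omega> (crl \<delta>))\<^sup>2 \<le> s" using lin_step_descent(1)[OF a st] by (simp add: s_def)
  then have s: "0 \<le> s" using \<alpha> by (meson less_imp_le mult_nonneg_nonneg order_trans zero_le_power2)
  \<comment> \<open>The derivative at \<open>m\<close> vanishes, so both models at \<open>m\<close>
    are pure squares.\<close>
  have gap: "\<gamma> / 2 * E\<^sup>2 \<le> F a - F m" "F a - F m \<le> L / 2 * E\<^sup>2"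
    using F_diff_bounds[OF m(1) a] m(2) e by (simp_all add: E_def)
  have gap_nonneg: "0 \<le> F a - F m"
    using minimizer_iff[OF m(1)] m(2) a by auto
  \<comment> \<open>The lower model at \<open>a\<close>, evaluated at \<open>m\<close>. Added to the
    one at \<open>m\<close>, it cancels the energies and yields strong monotonicity, \<gamma> E^2 <=
    G a (a - m).\<close>
  have "\<gamma> / 2 * (l2_norm \<Omega> (crl (\<lambda>x. m x - a x)))\<^sup>2 \<le> F m - F a + G a ?e"
    using F_diff_bounds(1)[OF a m(1)] G_diff_swap[OF a m(1) a] by simp
  moreover have "l2_norm \<Omega> (crl (\<lambda>x. m x - a x)) = E"
    unfolding E_def l2_norm_crl_diff[OF a m(1)] l2_norm_crl_diff[OF m(1) a] by (rule l2_norm_minus_commute)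
  ultimately have "\<gamma> * E\<^sup>2 \<le> G a ?e" using gap(1) by simp
  also have "\<dots> \<le> N * E"
  proof -
    have "L2 \<Omega> (\<lambda>x. \<nu> n x (crl a x) *v crl \<delta> x)"
      using crl_L2[OF a] crl_L2[OF d] by (intro \<nu>_L2) (auto simp: L2_iff)
    from l2_Cauchy_Schwarz[OF this crl_L2[OF e]] show ?thesis
      unfolding lin_step_G[OF a st e] by (simp add: N_def E_def)
  qed
  \<comment> \<open>Division of \<gamma> E^2 <= N E by E; for E = 0 the claim is just 0 <=
    N.\<close>
  finally have "\<gamma> * E \<le> N"
    using E N by (cases "E = 0") (auto simp: power2_eq_square)
  then have "(\<gamma> * E)\<^sup>2 \<le> N\<^sup>2" using E c_pos by (intro power_mono) auto
  also have "\<dots> \<le> \<beta> * s" using lin_step_descent(2)[OF a st] by (simp add: N_def s_def)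
  finally have "\<gamma>\<^sup>2 * E\<^sup>2 / \<beta> \<le> s" using \<beta> by (simp add: power_mult_distrib pos_divide_le_eq mult.commute)
  moreover have "2 * \<gamma>\<^sup>2 / (L * \<beta>) * (F a - F m) \<le> 2 * \<gamma>\<^sup>2 / (L * \<beta>) * (L / 2 * E\<^sup>2)"
    using gap(2) K_pos \<beta> by (intro mult_left_mono) auto
  moreover have "2 * \<gamma>\<^sup>2 / (L * \<beta>) * (L / 2 * E\<^sup>2) = \<gamma>\<^sup>2 * E\<^sup>2 / \<beta>" using K_pos by simp
  ultimately have key: "2 * \<gamma>\<^sup>2 / (L * \<beta>) * (F a - F m) \<le> s" by linarith
  have "\<rho> * \<mu> \<le> \<tau>" unfolding \<mu>_def by (rule armijo_max_lower_bound[OF a st \<tau>])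
  moreover have \<mu>: "0 \<le> \<mu>" using \<sigma> \<alpha> K_pos by (simp add: \<mu>_def)
  ultimately have "\<rho> * \<mu> * \<sigma> * (2 * \<gamma>\<^sup>2 / (L * \<beta>) * (F a - F m)) \<le> \<tau> * \<sigma> * s"
    using key \<rho> \<sigma> s K_pos \<beta> gap_nonneg by (intro mult_mono mult_nonneg_nonneg) (auto intro: order_trans[rotated])
  moreover have "F (\<lambda>x. a x + \<tau> *\<^sub>R \<delta> x) \<le> F a - \<sigma> * \<tau> * s"
    using \<tau>(1) by (auto simp: armijo_set_iff s_def)
  ultimately show ?thesis
    unfolding q_def \<mu>_def[symmetric] by (simp add: algebra_simps)
qed

text \<open>A relation instead of a recursion: the linear step fixes \<open>D n\<close> only up to
  norm zero, so convergence is claimed for every sequence of admissible choices.\<close>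

definition iterates :: "(nat \<Rightarrow> real^'n \<Rightarrow> 'b) \<Rightarrow> (nat \<Rightarrow> real^'n \<Rightarrow> 'b) \<Rightarrow> (nat \<Rightarrow> real) \<Rightarrow> bool" where
  "iterates A D T \<longleftrightarrow> (\<forall>n. lin_step \<Omega> V crl w hs (\<nu> n) (A n) (D n) \<and>
     T n \<in> armijo_set \<Omega> crl w hs \<rho> \<sigma> (A n) (D n) \<and>
     (\<forall>t\<in>armijo_set \<Omega> crl w hs \<rho> \<sigma> (A n) (D n). t \<le> T n) \<and>
     A (Suc n) = (\<lambda>x. A n x + T n *\<^sub>R D n x))"

lemma iterates_exist:
  assumes a0: "a0 \<in> V"
  shows "\<exists>A D T. A 0 = a0 \<and> iterates A D T"
proof -
  define good where "good n a \<delta> \<tau> \<longleftrightarrow> lin_step \<Omega> V crl w hs (\<nu> n) a \<delta> \<and>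
     \<tau> \<in> armijo_set \<Omega> crl w hs \<rho> \<sigma> a \<delta> \<and> (\<forall>t\<in>armijo_set \<Omega> crl w hs \<rho> \<sigma> a \<delta>. t \<le> \<tau>)" for n a \<delta> \<tau>
  have good: "\<exists>\<delta> \<tau>. good n a \<delta> \<tau>" if "a \<in> V" for n a
    unfolding good_def using lin_step_exists[OF that] armijo_max_exists[OF that] by blast
  \<comment> \<open>Dependent choice on triples of iterate, direction and stepsize. Membership in
    \<open>V\<close> is carried along because it makes the next step solvable; the clause for
    \<open>n = 0\<close> pins the start.\<close>
  have "\<exists>f. \<forall>n. (fst (f n) \<in> V \<and> (n = 0 \<longrightarrow> fst (f n) = a0) \<and> good n (fst (f n)) (fst (snd (f n))) (snd (snd (f n)))) \<and>
      fst (f (Suc n)) = (\<lambda>x. fst (f n) x + snd (snd (f n)) *\<^sub>R fst (snd (f n)) x)"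
  proof (rule dependent_nat_choice)
    show "\<exists>y. fst y \<in> V \<and> (0 = 0 \<longrightarrow> fst y = a0) \<and> good 0 (fst y) (fst (snd y)) (snd (snd y))"
      using a0 good[OF a0, of 0] by auto
  next
    fix y n assume y: "fst y \<in> V \<and> (n = 0 \<longrightarrow> fst y = a0) \<and> good n (fst y) (fst (snd y)) (snd (snd y))"
    let ?b = "\<lambda>x. fst y x + snd (snd y) *\<^sub>R fst (snd y) x"
    have b: "?b \<in> V" using y by (intro V_add) (auto simp: good_def lin_step_def)
    then show "\<exists>z. (fst z \<in> V \<and> (Suc n = 0 \<longrightarrow> fst z = a0) \<and> good (Suc n) (fst z) (fst (snd z)) (snd (snd z))) \<and> fst z = ?b"
      using good[OF b, of "Suc n"] by auto
  qed
  then obtain f where f: "\<And>n. (fst (f n) \<in> V \<and> (n = 0 \<longrightarrow> fst (f n) = a0) \<and> good n (fst (f n)) (fst (snd (f n))) (snd (snd (f n)))) \<and>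
      fst (f (Suc n)) = (\<lambda>x. fst (f n) x + snd (snd (f n)) *\<^sub>R fst (snd (f n)) x)" by blast
  then have "iterates (\<lambda>n. fst (f n)) (\<lambda>n. fst (snd (f n))) (\<lambda>n. snd (snd (f n)))"
    by (simp add: iterates_def good_def)
  moreover have "fst (f 0) = a0" using f[of 0] by simp
  ultimately show ?thesis
    by (intro exI[of _ "\<lambda>n. fst (f n)"] exI[of _ "\<lambda>n. fst (snd (f n))"] exI[of _ "\<lambda>n. snd (snd (f n))"] conjI)
qed

lemma iterates_in_V:
  assumes "A 0 \<in> V" "iterates A D T"
  shows "A n \<in> V"
proof (induction n)
  case (Suc n)
  have "D n \<in> V" "A (Suc n) = (\<lambda>x. A n x + T n *\<^sub>R D n x)"
    using assms(2) by (auto simp: iterates_def lin_step_def)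
  then show ?case using V_add[OF Suc] by simp
qed (use assms in simp)

theorem iterates_converge:
  assumes A0: "A 0 \<in> V" and it: "iterates A D T" and m: "m \<in> V" "\<forall>v\<in>V. G m v = 0"
  shows "(l2_norm \<Omega> (crl (\<lambda>x. A n x - m x)))\<^sup>2 \<le> (L / \<gamma>) * q ^ n * (l2_norm \<Omega> (crl (\<lambda>x. A 0 x - m x)))\<^sup>2"
    and "(\<lambda>n. l2_norm \<Omega> (crl (\<lambda>x. A n x - m x))) \<longlonglongrightarrow> 0"
    and "(\<lambda>n. l2_norm \<Omega> (\<lambda>x. A n x - m x)) \<longlonglongrightarrow> 0"
proof -
  note AV = iterates_in_V[OF A0 it]
  define E where "E n = l2_norm \<Omega> (crl (\<lambda>x. A n x - m x))" for n
  have gap: "\<gamma> / 2 * (E n)\<^sup>2 \<le> F (A n) - F m" "F (A n) - F m \<le> L / 2 * (E n)\<^sup>2" for n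
    using F_diff_bounds[OF m(1) AV[of n]] m(2) V_diff[OF AV m(1)] by (simp_all add: E_def)
  have energy: "F (A n) - F m \<le> q ^ n * (F (A 0) - F m)" for n
  proof (induction n)
    case (Suc n)
    have "F (A (Suc n)) - F m \<le> q * (F (A n) - F m)"
      using it energy_contraction[OF AV _ _ _ m, of n n "D n" "T n"] by (simp add: iterates_def)
    also have "\<dots> \<le> q * (q ^ n * (F (A 0) - F m))" by (rule mult_left_mono[OF Suc q_nonneg])
    finally show ?case by (simp add: mult_ac)
  qed simp
  have rate: "(E n)\<^sup>2 \<le> (L / \<gamma>) * q ^ n * (E 0)\<^sup>2" for n
  proof -
    have "\<gamma> / 2 * (E n)\<^sup>2 \<le> q ^ n * (F (A 0) - F m)"
      using gap(1)[of n] energy[of n] by linarith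
    also have "\<dots> \<le> q ^ n * (L / 2 * (E 0)\<^sup>2)"
      by (rule mult_left_mono[OF gap(2)]) (simp add: q_nonneg)
    finally show ?thesis using c_pos by (simp add: field_simps)
  qed
  then show "(l2_norm \<Omega> (crl (\<lambda>x. A n x - m x)))\<^sup>2 \<le> (L / \<gamma>) * q ^ n * (l2_norm \<Omega> (crl (\<lambda>x. A 0 x - m x)))\<^sup>2"
    by (simp add: E_def)
  have "(\<lambda>n. (L / \<gamma>) * q ^ n * (E 0)\<^sup>2) \<longlonglongrightarrow> (L / \<gamma>) * 0 * (E 0)\<^sup>2"
    using q_nonneg q_less_1 by (intro tendsto_intros LIMSEQ_power_zero) simp
  then have "(\<lambda>n. (L / \<gamma>) * q ^ n * (E 0)\<^sup>2) \<longlonglongrightarrow> 0" by simp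
  then have "(\<lambda>n. (E n)\<^sup>2) \<longlonglongrightarrow> 0"
  proof (rule tendsto_sandwich[OF _ _ tendsto_const, rotated 2])
    show "\<forall>\<^sub>F n in sequentially. (E n)\<^sup>2 \<le> (L / \<gamma>) * q ^ n * (E 0)\<^sup>2"
      by (intro always_eventually allI rate)
  qed simp
  then have E0: "E \<longlonglongrightarrow> 0"
    using tendsto_real_sqrt[of "\<lambda>n. (E n)\<^sup>2" 0] by (simp add: E_def[abs_def])
  then show "(\<lambda>n. l2_norm \<Omega> (crl (\<lambda>x. A n x - m x))) \<longlonglongrightarrow> 0" by (simp add: E_def[abs_def])
  \<comment> \<open>The Poincare inequality passes convergence from the curls to the
    potentials.\<close>
  have "(\<lambda>n. C * E n) \<longlonglongrightarrow> 0" using tendsto_mult[OF tendsto_const E0, of C] by simp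
  then show "(\<lambda>n. l2_norm \<Omega> (\<lambda>x. A n x - m x)) \<longlonglongrightarrow> 0"
  proof (rule tendsto_sandwich[OF _ _ tendsto_const, rotated 2])
    show "\<forall>\<^sub>F n in sequentially. l2_norm \<Omega> (\<lambda>x. A n x - m x) \<le> C * E n"
      unfolding E_def by (intro always_eventually allI poincare V_diff AV m(1))
  qed (auto intro: always_eventually)
qed

lemma minimizer_iff_weak_equation:
  assumes b: "b \<in> V"
  shows "(\<forall>v\<in>V. F b \<le> F v) \<longleftrightarrow>
    (\<forall>v\<in>V. l2_ip \<Omega> (\<lambda>x. grad (w x) (crl b x)) (crl v) = l2_ip \<Omega> hs (crl v))"
  unfolding minimizer_iff[OF b] G_def using b
  by (intro ball_cong) (auto simp: l2_ip_diff_left h_L2 DW_L2 crl_L2)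

text \<open>Written in the shape of the final claim, so that each dimension is an instance after
  unfolding \<open>F\<close> and \<open>iterates\<close>. One minimizer is fixed before the
  iterations are quantified, hence all of them share the limit.\<close>

theorem armijo_convergence:
  "(\<forall>n. \<forall>a\<in>V. (\<exists>\<delta>. lin_step \<Omega> V crl w hs (\<nu> n) a \<delta>) \<and>
      (\<forall>\<delta>1 \<delta>2. lin_step \<Omega> V crl w hs (\<nu> n) a \<delta>1 \<and> lin_step \<Omega> V crl w hs (\<nu> n) a \<delta>2 \<longrightarrow>
          l2_norm \<Omega> (\<lambda>x. \<delta>1 x - \<delta>2 x) = 0) \<and>
      (\<forall>\<delta>. lin_step \<Omega> V crl w hs (\<nu> n) a \<delta> \<longrightarrow>
          (\<exists>\<tau>\<in>armijo_set \<Omega> crl w hs \<rho> \<sigma> a \<delta>. \<forall>t\<in>armijo_set \<Omega> crl w hs \<rho> \<sigma> a \<delta>. t \<le> \<tau>))) \<and>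
   (\<forall>a0\<in>V. \<exists>A D T. A 0 = a0 \<and> iterates A D T) \<and>
   (\<exists>a\<in>V. (\<forall>v\<in>V. F a \<le> F v) \<and>
      (\<forall>b\<in>V. (\<forall>v\<in>V. F b \<le> F v) \<longrightarrow> l2_norm \<Omega> (\<lambda>x. b x - a x) = 0) \<and>
      (\<forall>b\<in>V. (\<forall>v\<in>V. F b \<le> F v) \<longleftrightarrow>
          (\<forall>v\<in>V. l2_ip \<Omega> (\<lambda>x. grad (w x) (crl b x)) (crl v) = l2_ip \<Omega> hs (crl v))) \<and>
      (\<forall>A D T. A 0 \<in> V \<and> iterates A D T \<longrightarrow>
          (\<forall>n. (l2_norm \<Omega> (crl (\<lambda>x. A n x - a x)))\<^sup>2 \<le>
                (L / \<gamma>) * q ^ n * (l2_norm \<Omega> (crl (\<lambda>x. A 0 x - a x)))\<^sup>2) \<and>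
          (\<lambda>n. l2_norm \<Omega> (\<lambda>x. A n x - a x)) \<longlonglongrightarrow> 0 \<and>
          (\<lambda>n. l2_norm \<Omega> (crl (\<lambda>x. A n x - a x))) \<longlonglongrightarrow> 0))"
proof -
  obtain a where a: "a \<in> V" "\<forall>v\<in>V. F a \<le> F v" using minimizer_exists by blast
  then have Ga: "\<forall>v\<in>V. G a v = 0" using minimizer_iff by blast
  have uniq: "l2_norm \<Omega> (\<lambda>x. b x - a x) = 0" if "b \<in> V" "\<forall>v\<in>V. F b \<le> F v" for b
    using minimizer_unique[OF a(1) Ga that(1)] minimizer_iff[OF that(1)] that(2) by blast
  show ?thesis
  proof (intro conjI bexI[OF _ a(1)])
    show "\<forall>n. \<forall>a\<in>V. (\<exists>\<delta>. lin_step \<Omega> V crl w hs (\<nu> n) a \<delta>) \<and>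
      (\<forall>\<delta>1 \<delta>2. lin_step \<Omega> V crl w hs (\<nu> n) a \<delta>1 \<and> lin_step \<Omega> V crl w hs (\<nu> n) a \<delta>2 \<longrightarrow>
          l2_norm \<Omega> (\<lambda>x. \<delta>1 x - \<delta>2 x) = 0) \<and>
      (\<forall>\<delta>. lin_step \<Omega> V crl w hs (\<nu> n) a \<delta> \<longrightarrow>
          (\<exists>\<tau>\<in>armijo_set \<Omega> crl w hs \<rho> \<sigma> a \<delta>. \<forall>t\<in>armijo_set \<Omega> crl w hs \<rho> \<sigma> a \<delta>. t \<le> \<tau>))"
      by (intro allI ballI conjI impI lin_step_exists)
         (auto intro: lin_step_unique armijo_max_exists)
    show "\<forall>a0\<in>V. \<exists>A D T. A 0 = a0 \<and> iterates A D T" by (intro ballI iterates_exist)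
    show "\<forall>v\<in>V. F a \<le> F v" by (rule a(2))
    show "\<forall>b\<in>V. (\<forall>v\<in>V. F b \<le> F v) \<longrightarrow> l2_norm \<Omega> (\<lambda>x. b x - a x) = 0"
      using uniq by blast
    show "\<forall>b\<in>V. (\<forall>v\<in>V. F b \<le> F v) \<longleftrightarrow>
          (\<forall>v\<in>V. l2_ip \<Omega> (\<lambda>x. grad (w x) (crl b x)) (crl v) = l2_ip \<Omega> hs (crl v))"
      by (intro ballI minimizer_iff_weak_equation)
    show "\<forall>A D T. A 0 \<in> V \<and> iterates A D T \<longrightarrow>
          (\<forall>n. (l2_norm \<Omega> (crl (\<lambda>x. A n x - a x)))\<^sup>2 \<le>
                (L / \<gamma>) * q ^ n * (l2_norm \<Omega> (crl (\<lambda>x. A 0 x - a x)))\<^sup>2) \<and>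
          (\<lambda>n. l2_norm \<Omega> (\<lambda>x. A n x - a x)) \<longlonglongrightarrow> 0 \<and>
          (\<lambda>n. l2_norm \<Omega> (crl (\<lambda>x. A n x - a x))) \<longlonglongrightarrow> 0"
    proof (intro allI impI, elim conjE)
      fix A D T assume it: "A 0 \<in> V" "iterates A D T"
      note conv = iterates_converge[OF it a(1) Ga]
      show "(\<forall>n. (l2_norm \<Omega> (crl (\<lambda>x. A n x - a x)))\<^sup>2 \<le>
                (L / \<gamma>) * q ^ n * (l2_norm \<Omega> (crl (\<lambda>x. A 0 x - a x)))\<^sup>2) \<and>
          (\<lambda>n. l2_norm \<Omega> (\<lambda>x. A n x - a x)) \<longlonglongrightarrow> 0 \<and>
          (\<lambda>n. l2_norm \<Omega> (crl (\<lambda>x. A n x - a x))) \<longlonglongrightarrow> 0"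
        by (intro conjI allI conv)
    qed
  qed
qed

end

subsection \<open>Energy densities induce convex energies\<close>

context finite_domain
begin

text \<open>Approximate \<open>f\<close> by finitely valued functions: for these the composition is
  glued from finitely many measurable pieces, and continuity in the second argument passes to the
  limit.\<close>

lemma borel_measurable_Caratheodory:
  fixes u :: "real^'n \<Rightarrow> 'c::euclidean_space \<Rightarrow> real"
  assumes u: "\<And>b. (\<lambda>x. u x b) \<in> borel_measurable M"
    and cont: "\<And>x. x \<in> \<Omega> \<Longrightarrow> continuous_on UNIV (u x)"
    and f: "f \<in> borel_measurable M"
  shows "(\<lambda>x. u x (f x)) \<in> borel_measurable M"
proof -
  obtain g where g: "\<And>n. g n \<in> borel_measurable M" "\<And>n. finite (range (g n))" "\<And>x. (\<lambda>n. g n x) \<longlonglongrightarrow> f x"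
    using borel_measurable_simple_function_limit[THEN iffD1, OF f] by blast
  have "(\<lambda>x. u x (g n x)) \<in> borel_measurable M" for n
  proof (rule measurable_compose_countable'[where f="\<lambda>b x. u x b" and I="range (g n)"])
    show "countable (range (g n))" using g(2) by (rule countable_finite)
    then show "g n \<in> measurable M (count_space (range (g n)))"
      using measurable_sets[OF g(1)[of n], of "{_}"] by (simp add: measurable_count_space_eq_countable)
  qed (rule u)
  then show ?thesis
  proof (rule borel_measurable_LIMSEQ_metric)
    fix x assume "x \<in> space M"
    then have "isCont (u x) (f x)" using cont by (simp add: continuous_on_eq_continuous_at)
    then show "(\<lambda>n. u x (g n x)) \<longlonglongrightarrow> u x (f x)" by (rule isCont_tendsto_compose[OF _ g(3)])
  qed
qed

text \<open>On each piece the function agrees with a continuous one; the rest of the domain is a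
  null set, harmless because Lebesgue measure is complete.\<close>

lemma borel_measurable_piecewise_smooth:
  assumes "piecewise_smooth_fst \<Omega> w"
  shows "(\<lambda>x. w x b) \<in> borel_measurable M"
proof -
  obtain P where P: "finite P" "\<And>S. S \<in> P \<Longrightarrow> open S \<and> S \<subseteq> \<Omega>" "\<Omega> - \<Union>P \<in> null_sets lebesgue"
    "\<And>S b. S \<in> P \<Longrightarrow> \<exists>g::real^'n \<Rightarrow> real. C_inf g \<and> (\<forall>x\<in>S. g x = w x b)"
    using assms unfolding piecewise_smooth_fst_def by metis
  have "(\<lambda>x. w x b) \<in> borel_measurable (lebesgue_on (\<Union>P))"
  proof (rule measurable_piecewise_restrict[of P])
    show "countable P" using P(1) by (rule countable_finite)
    fix S assume S: "S \<in> P"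
    have "S \<in> sets lebesgue" using P(2)[OF S] by auto
    then show "S \<inter> space (lebesgue_on (\<Union>P)) \<in> sets (lebesgue_on (\<Union>P))"
      by (auto simp: sets_restrict_space)
    obtain g :: "real^'n \<Rightarrow> real" where g: "C_inf g" "\<forall>x\<in>S. g x = w x b" using P(4)[OF S] by blast
    then have "continuous_on UNIV g" by (simp add: C_inf_def flip: Ck.simps(1))
    then have "g \<in> borel_measurable (restrict_space (lebesgue_on (\<Union>P)) S)"
      by (intro measurable_restrict_space1 measurable_completion) (simp add: borel_measurable_continuous_onI)
    then show "(\<lambda>x. w x b) \<in> borel_measurable (restrict_space (lebesgue_on (\<Union>P)) S)"
      using g(2) by (subst measurable_cong[of _ _ g]) (auto simp: space_restrict_space)
  qed auto
  moreover have "\<Union>P = \<Omega> - (\<Omega> - \<Union>P)" using P(2) by blast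
  moreover have "\<Omega> - \<Union>P \<in> null_sets (lebesgue_on \<Omega>)"
    using P(3) by (subst null_sets_restrict_space) auto
  ultimately show ?thesis using borel_measurable_diff_null[of "\<Omega> - \<Union>P" \<Omega> "\<lambda>x. w x b"] by simp
qed

text \<open>Each smooth representative lives on the whole space, hence is bounded on the compact
  closure of the domain, and there are finitely many pieces. This yields integrability of
  \<open>w x 0\<close>.\<close>

lemma piecewise_smooth_bounded:
  assumes "piecewise_smooth_fst \<Omega> w" "bounded \<Omega>"
  obtains B where "AE x in M. \<bar>w x b\<bar> \<le> B"
proof -
  obtain P where P: "finite P" "\<And>S. S \<in> P \<Longrightarrow> open S \<and> S \<subseteq> \<Omega>" "\<Omega> - \<Union>P \<in> null_sets lebesgue"
    "\<And>S b. S \<in> P \<Longrightarrow> \<exists>g::real^'n \<Rightarrow> real. C_inf g \<and> (\<forall>x\<in>S. g x = w x b)"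
    using assms unfolding piecewise_smooth_fst_def by metis
  have "\<exists>B. \<forall>x\<in>S. \<bar>w x b\<bar> \<le> B" if S: "S \<in> P" for S
  proof -
    obtain g :: "real^'n \<Rightarrow> real" where g: "C_inf g" "\<forall>x\<in>S. g x = w x b" using P(4)[OF S] by blast
    then have "continuous_on UNIV g" by (simp add: C_inf_def flip: Ck.simps(1))
    then have "continuous_on (closure \<Omega>) g" using continuous_on_subset by blast
    then have "bounded (g ` closure \<Omega>)"
      by (intro compact_imp_bounded compact_continuous_image) (simp_all add: assms(2))
    then obtain B where B: "\<forall>y\<in>g ` closure \<Omega>. norm y \<le> B"
      unfolding bounded_iff by blast
    have "\<bar>w x b\<bar> \<le> B" if "x \<in> S" for x
    proof -
      have "x \<in> closure \<Omega>" using that P(2)[OF S] closure_subset[of \<Omega>] by blast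
      then have "norm (g x) \<le> B" using B by simp
      then show ?thesis using g(2) that by simp
    qed
    then show ?thesis by (intro exI[of _ B]) simp
  qed
  then obtain B where B: "\<And>S x. S \<in> P \<Longrightarrow> x \<in> S \<Longrightarrow> \<bar>w x b\<bar> \<le> B S" by metis
  have "AE x in lebesgue. x \<notin> \<Omega> - \<Union>P" by (rule AE_not_in[OF P(3)])
  then have "AE x in M. x \<notin> \<Omega> - \<Union>P" by (subst AE_restrict_space_iff) auto
  moreover have "AE x in M. x \<in> \<Omega>" by (rule AE_I2) simp
  ultimately have "AE x in M. \<bar>w x b\<bar> \<le> (\<Sum>S\<in>P. \<bar>B S\<bar>)"
  proof eventually_elim
    fix x assume "x \<notin> \<Omega> - \<Union>P" "x \<in> \<Omega>"
    then obtain S where S: "S \<in> P" "x \<in> S" by blast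
    have "\<bar>w x b\<bar> \<le> \<bar>B S\<bar>" using B[OF S] by linarith
    also have "\<dots> \<le> (\<Sum>S\<in>P. \<bar>B S\<bar>)" using P(1) S by (intro member_le_sum) auto
    finally show "\<bar>w x b\<bar> \<le> (\<Sum>S\<in>P. \<bar>B S\<bar>)" .
  qed
  then show ?thesis by (rule that)
qed

text \<open>Taylor's formula turns the Hessian bounds into the two models; growth and measurability
  of \<open>w\<close> and its gradient supply the integrability assumptions.\<close>

lemma energy_density_convex_energy:
  assumes "0 < \<gamma>" "0 < L" and w: "energy_density \<Omega> w \<gamma> L" and "bounded \<Omega>" and hs: "L2 \<Omega> hs"
  shows "convex_energy \<Omega> w (\<lambda>x. grad (w x)) hs \<gamma> L"
proof -
  have ps: "piecewise_smooth_fst \<Omega> w" and Ck2: "\<And>x. x \<in> \<Omega> \<Longrightarrow> Ck 2 (w x)"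
    and hess: "\<And>x \<xi> \<eta>. x \<in> \<Omega> \<Longrightarrow> \<gamma> * (norm \<xi>)\<^sup>2 \<le> (hess (w x) \<eta> *v \<xi>) \<bullet> \<xi> \<and>
                      (hess (w x) \<eta> *v \<xi>) \<bullet> \<xi> \<le> L * (norm \<xi>)\<^sup>2"
    using w unfolding energy_density_def by auto
  obtain C0 where C0: "\<And>x. x \<in> \<Omega> \<Longrightarrow> norm (grad (w x) 0) \<le> C0"
    using w unfolding energy_density_def by blast
  obtain B where B: "AE x in M. \<bar>w x 0\<bar> \<le> B"
    using piecewise_smooth_bounded[OF ps \<open>bounded \<Omega>\<close>] by blast
  have lower: "\<gamma> / 2 * (norm (z - y))\<^sup>2 \<le> w x z - w x y - grad (w x) y \<bullet> (z - y)"
    and upper: "w x z - w x y - grad (w x) y \<bullet> (z - y) \<le> L / 2 * (norm (z - y))\<^sup>2"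
    if x: "x \<in> \<Omega>" for x y z
  proof -
    obtain \<eta> where "w x (y + (z - y)) = w x y + grad (w x) y \<bullet> (z - y) + ((hess (w x) \<eta> *v (z - y)) \<bullet> (z - y)) / 2"
      by (rule Ck_2_Taylor[OF Ck2[OF x]])
    then show "\<gamma> / 2 * (norm (z - y))\<^sup>2 \<le> w x z - w x y - grad (w x) y \<bullet> (z - y)"
      and "w x z - w x y - grad (w x) y \<bullet> (z - y) \<le> L / 2 * (norm (z - y))\<^sup>2"
      using hess[OF x, of "z - y" \<eta>] by simp_all
  qed
  \<comment> \<open>Bounded at 0 and Lipschitz with constant \<open>L\<close>: linear growth, which
    maps \<open>L2\<close> fields to \<open>L2\<close> fields.\<close>
  have growth: "norm (grad (w x) y) \<le> C0 + L * norm y" if x: "x \<in> \<Omega>" for x y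
  proof -
    have "norm (grad (w x) y - grad (w x) 0) \<le> L * norm (y - 0)"
    proof (rule quadratic_model_lipschitz[OF \<open>0 < L\<close>, of "w x"])
      fix y z :: "real^'n"
      have "0 \<le> \<gamma> / 2 * (norm (z - y))\<^sup>2" using \<open>0 < \<gamma>\<close> by simp
      then show "w x y + grad (w x) y \<bullet> (z - y) \<le> w x z" using lower[OF x, of z y] by linarith
      show "w x z \<le> w x y + grad (w x) y \<bullet> (z - y) + L / 2 * (norm (z - y))\<^sup>2"
        using upper[OF x, of z y] by linarith
    qed
    then show ?thesis using C0[OF x] norm_triangle_sub[of "grad (w x) y" "grad (w x) 0"] by simp
  qed
  have wm: "(\<lambda>x. w x (f x)) \<in> borel_measurable M" if "f \<in> borel_measurable M" for f
  proof (rule borel_measurable_Caratheodory[OF borel_measurable_piecewise_smooth[OF ps] _ that])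
    show "continuous_on UNIV (w x)" if "x \<in> \<Omega>" for x
      using Ck_2_differentiable(1)[OF Ck2[OF that]]
      by (intro differentiable_imp_continuous_on) (auto simp: differentiable_on_def)
  qed
  \<comment> \<open>Each component of the gradient is a limit of difference quotients of
    \<open>w\<close> with steps 1 / (n + 1), and those are measurable by \<open>wm\<close>.\<close>
  have gm: "(\<lambda>x. grad (w x) (f x)) \<in> borel_measurable M" if f: "f \<in> borel_measurable M" for f
  proof (subst borel_measurable_euclidean_space, rule ballI)
    fix d :: "real^'n"
    show "(\<lambda>x. grad (w x) (f x) \<bullet> d) \<in> borel_measurable M"
    proof (rule borel_measurable_LIMSEQ_real)
      show "(\<lambda>x. (w x (f x + inverse (real (Suc n)) *\<^sub>R d) - w x (f x)) / inverse (real (Suc n))) \<in> borel_measurable M" for n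
        using f by (intro borel_measurable_divide borel_measurable_diff wm borel_measurable_add) auto
      fix x assume "x \<in> space M"
      then have x: "x \<in> \<Omega>" by simp
      have "((\<lambda>s. w x (f x + s *\<^sub>R d)) has_real_derivative (\<Sum>i\<in>UNIV. d $ i * pd (w x) i (f x + 0 *\<^sub>R d))) (at 0)"
        by (rule has_real_derivative_along_line[OF Ck_2_differentiable(1)[OF Ck2[OF x]]])
      then have "(\<lambda>s. (w x (f x + s *\<^sub>R d) - w x (f x)) / s) \<midarrow>0\<rightarrow> grad (w x) (f x) \<bullet> d"
        by (simp add: DERIV_def inner_vec_def grad_def mult.commute)
      moreover have "filterlim (\<lambda>n. inverse (real (Suc n))) (at 0) sequentially"
        using LIMSEQ_inverse_real_of_nat by (auto simp: filterlim_at)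
      ultimately show "(\<lambda>n. (w x (f x + inverse (real (Suc n)) *\<^sub>R d) - w x (f x)) / inverse (real (Suc n))) \<longlonglongrightarrow> grad (w x) (f x) \<bullet> d"
        by (rule filterlim_compose)
    qed
  qed
  show ?thesis
  proof unfold_locales
    fix f :: "real^'n \<Rightarrow> real^'n" assume f: "L2 \<Omega> f"
    have fm: "f \<in> borel_measurable M" and f2: "integrable M (\<lambda>x. (norm (f x))\<^sup>2)"
      using f by (auto simp: L2_iff)
    show "integrable M (\<lambda>x. w x (f x))"
    proof (rule Bochner_Integration.integrable_bound)
      \<comment> \<open>The majorant is the upper model at 0: a bound for \<open>w x 0\<close>, one
        for the linear term, and the quadratic remainder, which the lower model shows to be
        nonnegative.\<close>
      show "integrable M (\<lambda>x. B + C0 * norm (f x) + L / 2 * (norm (f x))\<^sup>2)"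
        using f2 integrable_L2_norm[OF f] by auto
      show "AE x in M. norm (w x (f x)) \<le> norm (B + C0 * norm (f x) + L / 2 * (norm (f x))\<^sup>2)"
        using B AE_space
      proof eventually_elim
        fix x assume B: "\<bar>w x 0\<bar> \<le> B" and "x \<in> space M"
        then have x: "x \<in> \<Omega>" by simp
        have "\<bar>grad (w x) 0 \<bullet> f x\<bar> \<le> norm (grad (w x) 0) * norm (f x)" by (rule Cauchy_Schwarz_ineq2)
        also have "\<dots> \<le> C0 * norm (f x)" by (intro mult_right_mono C0 x) simp
        finally have "\<bar>grad (w x) 0 \<bullet> f x\<bar> \<le> C0 * norm (f x)" .
        moreover have "0 \<le> \<gamma> / 2 * (norm (f x))\<^sup>2" using \<open>0 < \<gamma>\<close> by simp
        ultimately show "norm (w x (f x)) \<le> norm (B + C0 * norm (f x) + L / 2 * (norm (f x))\<^sup>2)"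
          using lower[OF x, of "f x" 0] upper[OF x, of "f x" 0] B by simp
      qed
    qed (rule wm[OF fm])
    show "L2 \<Omega> (\<lambda>x. grad (w x) (f x))"
    proof (rule L2_dominated[OF gm[OF fm]])
      show "integrable M (\<lambda>x. 2 * C0\<^sup>2 + 2 * L\<^sup>2 * (norm (f x))\<^sup>2)" using f2 by auto
      show "AE x in M. (norm (grad (w x) (f x)))\<^sup>2 \<le> 2 * C0\<^sup>2 + 2 * L\<^sup>2 * (norm (f x))\<^sup>2"
      proof (rule AE_I2)
        fix x assume "x \<in> space M"
        then have "(norm (grad (w x) (f x)))\<^sup>2 \<le> (C0 + L * norm (f x))\<^sup>2"
          by (intro power_mono growth) auto
        also have "\<dots> \<le> 2 * C0\<^sup>2 + 2 * (L * norm (f x))\<^sup>2"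
          using sum_squares_bound[of C0 "L * norm (f x)"] by (simp add: power2_sum)
        finally show "(norm (grad (w x) (f x)))\<^sup>2 \<le> 2 * C0\<^sup>2 + 2 * L\<^sup>2 * (norm (f x))\<^sup>2"
          by (simp add: power_mult_distrib)
      qed
    qed
  qed (use assms lower upper in auto)
qed

end

subsection \<open>Weak curls\<close>

lemma test_fun_continuous: "test_fun \<Omega> \<psi> \<Longrightarrow> continuous_on UNIV \<psi>"
  unfolding test_fun_def C_inf_def by (simp flip: Ck.simps(1))

lemma test_fun_differentiable: "test_fun \<Omega> \<psi> \<Longrightarrow> \<psi> differentiable (at x)"
  unfolding test_fun_def C_inf_def by (metis Ck.simps(2))

lemma test_fun_pd_continuous: "test_fun \<Omega> \<psi> \<Longrightarrow> continuous_on UNIV (pd \<psi> j)"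
  unfolding test_fun_def C_inf_def pd_def[abs_def] by (metis Ck.simps)

lemma test_fun_add:
  fixes \<phi> \<psi> :: "real^'n \<Rightarrow> 'b::real_normed_vector"
  assumes "test_fun \<Omega> \<phi>" "test_fun \<Omega> \<psi>"
  shows "test_fun \<Omega> (\<lambda>x. \<phi> x + t *\<^sub>R \<psi> x)"
proof -
  obtain K1 K2 where "compact K1" "K1 \<subseteq> \<Omega>" "\<forall>x. x \<notin> K1 \<longrightarrow> \<phi> x = 0"
    "compact K2" "K2 \<subseteq> \<Omega>" "\<forall>x. x \<notin> K2 \<longrightarrow> \<psi> x = 0"
    using assms unfolding test_fun_def by blast
  then have "\<exists>K. compact K \<and> K \<subseteq> \<Omega> \<and> (\<forall>x. x \<notin> K \<longrightarrow> \<phi> x + t *\<^sub>R \<psi> x = 0)"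
    by (intro exI[of _ "K1 \<union> K2"]) auto
  moreover have "C_inf (\<lambda>x. \<phi> x + t *\<^sub>R \<psi> x)"
    using assms unfolding test_fun_def C_inf_def
    by (intro allI Ck_add Ck_bounded_linear[OF bounded_linear_scaleR_right]) auto
  ultimately show ?thesis by (simp add: test_fun_def)
qed

lemma test_fun_zero: "test_fun \<Omega> (\<lambda>x. 0)"
  unfolding test_fun_def C_inf_def by (auto intro: Ck_const)

lemma pd_add:
  assumes "test_fun \<Omega> \<phi>" "test_fun \<Omega> \<psi>"
  shows "pd (\<lambda>x. \<phi> x + t *\<^sub>R \<psi> x) j x = pd \<phi> j x + t *\<^sub>R pd \<psi> j x"
proof -
  have "((\<lambda>x. \<phi> x + t *\<^sub>R \<psi> x) has_derivative
      (\<lambda>v. frechet_derivative \<phi> (at x) v + t *\<^sub>R frechet_derivative \<psi> (at x) v)) (at x)"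
    using assms test_fun_differentiable frechet_derivative_works
    by (intro has_derivative_add has_derivative_scaleR_right) blast+
  from frechet_derivative_at[OF this] show ?thesis unfolding pd_def by metis
qed

lemma (in finite_domain) L2_continuous:
  fixes f :: "real^'n \<Rightarrow> 'b::euclidean_space"
  assumes f: "continuous_on UNIV f" and "bounded \<Omega>"
  shows "L2 \<Omega> f"
proof -
  have "continuous_on (closure \<Omega>) f" using f continuous_on_subset by blast
  then have "bounded (f ` closure \<Omega>)"
    by (intro compact_imp_bounded compact_continuous_image) (simp_all add: assms(2))
  then obtain B where "\<forall>y\<in>f ` closure \<Omega>. norm y \<le> B"
    unfolding bounded_iff by blast
  then have B: "norm (f x) \<le> B" if "x \<in> \<Omega>" for x using that closure_subset[of \<Omega>] by blast
  show ?thesis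
  proof (rule L2_bounded)
    show "f \<in> borel_measurable M"
      using f by (intro measurable_restrict_space1 measurable_completion) (simp add: borel_measurable_continuous_onI)
    show "AE x in M. norm (f x) \<le> B" by (rule AE_I2) (simp add: B)
  qed
qed

lemma (in finite_domain) l2_ip_tendsto_left:
  fixes f :: "nat \<Rightarrow> real^'n \<Rightarrow> 'b::euclidean_space"
  assumes "\<And>k. L2 \<Omega> (f k)" "L2 \<Omega> g" "L2 \<Omega> h" "(\<lambda>k. l2_norm \<Omega> (\<lambda>x. f k x - g x)) \<longlonglongrightarrow> 0"
  shows "(\<lambda>k. l2_ip \<Omega> (f k) h) \<longlonglongrightarrow> l2_ip \<Omega> g h"
proof (rule LIM_zero_cancel, rule Lim_null_comparison)
  show "\<forall>\<^sub>F k in sequentially. norm (l2_ip \<Omega> (f k) h - l2_ip \<Omega> g h) \<le> l2_norm \<Omega> (\<lambda>x. f k x - g x) * l2_norm \<Omega> h"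
    using assms l2_Cauchy_Schwarz[OF L2_diff[OF assms(1,2)] assms(3)]
    by (intro always_eventually allI) (simp add: l2_ip_diff_left)
  show "(\<lambda>k. l2_norm \<Omega> (\<lambda>x. f k x - g x) * l2_norm \<Omega> h) \<longlonglongrightarrow> 0"
    using tendsto_mult_right[OF assms(4)] by simp
qed

text \<open>One setting for both dimensions: \<open>cs\<close> is the classical curl of smooth potentials and
  \<open>adj\<close> its formal adjoint on test fields.\<close>

locale weak_curl = finite_domain \<Omega> for \<Omega> :: "(real^'n) set" +
  fixes cs :: "(real^'n \<Rightarrow> 'b::euclidean_space) \<Rightarrow> real^'n \<Rightarrow> real^'n"
    and adj :: "(real^'n \<Rightarrow> real^'n) \<Rightarrow> real^'n \<Rightarrow> 'b"
  assumes open_domain: "open \<Omega>" and bounded_domain: "bounded \<Omega>"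
    and cs_continuous: "\<And>\<phi>. test_fun \<Omega> \<phi> \<Longrightarrow> continuous_on UNIV (cs \<phi>)"
    and adj_continuous: "\<And>\<psi>. test_fun \<Omega> \<psi> \<Longrightarrow> continuous_on UNIV (adj \<psi>)"
    and cs_add: "\<And>\<phi> \<psi> t x. \<lbrakk>test_fun \<Omega> \<phi>; test_fun \<Omega> \<psi>\<rbrakk> \<Longrightarrow>
      cs (\<lambda>x. \<phi> x + t *\<^sub>R \<psi> x) x = cs \<phi> x + t *\<^sub>R cs \<psi> x"
begin

text \<open>\<open>weak\<close>, \<open>crl\<close> and \<open>H0\<close> copy the concrete
  definitions with \<open>cs\<close> and \<open>adj\<close> as parameters. Their instances therefore
  equal the concrete curls as functions, and no two Hilbert choices have to be compared.\<close>

definition weak :: "(real^'n \<Rightarrow> 'b) \<Rightarrow> (real^'n \<Rightarrow> real^'n) \<Rightarrow> bool" where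
  "weak u c \<longleftrightarrow> L2 \<Omega> u \<and> L2 \<Omega> c \<and> (\<forall>\<psi>. test_fun \<Omega> \<psi> \<longrightarrow> l2_ip \<Omega> c \<psi> = l2_ip \<Omega> u (adj \<psi>))"

definition crl :: "(real^'n \<Rightarrow> 'b) \<Rightarrow> real^'n \<Rightarrow> real^'n" where
  "crl u = (SOME c. weak u c)"

definition H0 :: "(real^'n \<Rightarrow> 'b) set" where
  "H0 = {u. (\<exists>c. weak u c) \<and> (\<exists>\<psi>. (\<forall>k::nat. test_fun \<Omega> (\<psi> k)) \<and>
      (\<lambda>k. l2_norm \<Omega> (\<lambda>x. u x - \<psi> k x)) \<longlonglongrightarrow> 0 \<and>
      (\<lambda>k. l2_norm \<Omega> (\<lambda>x. crl u x - cs (\<psi> k) x)) \<longlonglongrightarrow> 0)}"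

section \<open>Weak curls and the space with zero boundary values\<close>

lemma L2_test:
  assumes "test_fun \<Omega> \<phi>"
  shows "L2 \<Omega> (\<phi> :: real^'n \<Rightarrow> 'c::euclidean_space)"
  using assms by (intro L2_continuous test_fun_continuous bounded_domain)

lemma L2_cs: "test_fun \<Omega> \<phi> \<Longrightarrow> L2 \<Omega> (cs \<phi>)"
  by (intro L2_continuous cs_continuous bounded_domain)

lemma L2_adj: "test_fun \<Omega> \<phi> \<Longrightarrow> L2 \<Omega> (adj \<phi>)"
  by (intro L2_continuous adj_continuous bounded_domain)

lemma weak_crl: "weak u c \<Longrightarrow> weak u (crl u)"
  unfolding crl_def by (rule someI[of "weak u"])

text \<open>The fundamental lemma applied to the difference. Through it any weak curl may replace
  the chosen one inside norms and scalar products.\<close>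

lemma weak_unique:
  assumes "weak u c" "weak u c'"
  shows "AE x in M. c x = c' x"
proof -
  have "AE x in M. c x - c' x = 0"
    by (rule L2_orthogonal_test_fun_imp_0[OF open_domain])
       (use assms in \<open>auto simp: weak_def L2_diff l2_ip_diff_left L2_test\<close>)
  then show ?thesis by simp
qed

lemma weak_add:
  assumes "weak u c" "weak v d"
  shows "weak (\<lambda>x. u x + t *\<^sub>R v x) (\<lambda>x. c x + t *\<^sub>R d x)"
  using assms by (auto simp: weak_def L2_add L2_scaleR l2_ip_add_left L2_test L2_adj l2_ip_scaleR_left)

lemma weak_0: "weak (\<lambda>x. 0) (\<lambda>x. 0)"
  unfolding weak_def by (intro conjI L2_test test_fun_zero) (simp add: l2_ip_eq)

lemma H0_weak: "u \<in> H0 \<Longrightarrow> weak u (crl u)"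
  unfolding H0_def using weak_crl by blast

lemma H0_L2: "u \<in> H0 \<Longrightarrow> L2 \<Omega> u" and H0_crl_L2: "u \<in> H0 \<Longrightarrow> L2 \<Omega> (crl u)"
  using H0_weak by (auto simp: weak_def)

lemma crl_add:
  assumes "u \<in> H0" "v \<in> H0"
  shows "AE x in M. crl (\<lambda>x. u x + t *\<^sub>R v x) x = crl u x + t *\<^sub>R crl v x"
proof -
  have "weak (\<lambda>x. u x + t *\<^sub>R v x) (\<lambda>x. crl u x + t *\<^sub>R crl v x)"
    by (rule weak_add[OF assms[THEN H0_weak]])
  then show ?thesis by (intro weak_unique[OF weak_crl])
qed

lemma H0_approx:
  assumes "u \<in> H0" "e > 0"
  obtains \<psi> where "test_fun \<Omega> \<psi>" "l2_norm \<Omega> (\<lambda>x. u x - \<psi> x) < e" "l2_norm \<Omega> (\<lambda>x. crl u x - cs \<psi> x) < e"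
proof -
  obtain \<psi> where \<psi>: "\<And>k::nat. test_fun \<Omega> (\<psi> k)" "(\<lambda>k. l2_norm \<Omega> (\<lambda>x. u x - \<psi> k x)) \<longlonglongrightarrow> 0"
    "(\<lambda>k. l2_norm \<Omega> (\<lambda>x. crl u x - cs (\<psi> k) x)) \<longlonglongrightarrow> 0"
    using assms(1) unfolding H0_def by blast
  have "\<forall>\<^sub>F k in sequentially. l2_norm \<Omega> (\<lambda>x. u x - \<psi> k x) < e \<and> l2_norm \<Omega> (\<lambda>x. crl u x - cs (\<psi> k) x) < e"
    using order_tendstoD(2)[OF \<psi>(2) assms(2)] order_tendstoD(2)[OF \<psi>(3) assms(2)]
    by eventually_elim simp
  then obtain k where "l2_norm \<Omega> (\<lambda>x. u x - \<psi> k x) < e" "l2_norm \<Omega> (\<lambda>x. crl u x - cs (\<psi> k) x) < e"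
    unfolding eventually_sequentially by blast
  then show ?thesis using that \<psi>(1) by blast
qed

text \<open>\<open>H0\<close> refers to the chosen curl and to a sequence; here any weak curl and
  approximation up to each \<open>e\<close> suffice.\<close>

lemma H0_I:
  assumes wk: "weak u c"
    and ap: "\<And>e. e > 0 \<Longrightarrow> \<exists>\<psi>. test_fun \<Omega> \<psi> \<and> l2_norm \<Omega> (\<lambda>x. u x - \<psi> x) < e \<and> l2_norm \<Omega> (\<lambda>x. c x - cs \<psi> x) < e"
  shows "u \<in> H0"
proof -
  have L: "L2 \<Omega> c" "L2 \<Omega> (crl u)" using wk weak_crl[OF wk] by (auto simp: weak_def)
  have ae: "AE x in M. c x = crl u x" by (rule weak_unique[OF wk weak_crl[OF wk]])
  have eq: "l2_norm \<Omega> (\<lambda>x. c x - cs \<psi> x) = l2_norm \<Omega> (\<lambda>x. crl u x - cs \<psi> x)" if "test_fun \<Omega> \<psi>" for \<psi>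
    using ae by (intro l2_norm_cong_AE L2_diff L L2_cs that) (auto elim: eventually_mono)
  have "\<forall>k. \<exists>\<psi>. test_fun \<Omega> \<psi> \<and> l2_norm \<Omega> (\<lambda>x. u x - \<psi> x) < inverse (real (Suc k)) \<and>
      l2_norm \<Omega> (\<lambda>x. crl u x - cs \<psi> x) < inverse (real (Suc k))"
    using ap eq by (metis inverse_positive_iff_positive of_nat_0_less_iff zero_less_Suc)
  then obtain \<psi> where \<psi>: "\<And>k. test_fun \<Omega> (\<psi> k)" "\<And>k. l2_norm \<Omega> (\<lambda>x. u x - \<psi> k x) < inverse (real (Suc k))"
    "\<And>k. l2_norm \<Omega> (\<lambda>x. crl u x - cs (\<psi> k) x) < inverse (real (Suc k))" by metis
  have "(\<lambda>k. l2_norm \<Omega> (\<lambda>x. u x - \<psi> k x)) \<longlonglongrightarrow> 0"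
    by (rule tendsto_sandwich[OF _ _ tendsto_const LIMSEQ_inverse_real_of_nat])
       (use \<psi>(2) in \<open>auto intro!: always_eventually less_imp_le\<close>)
  moreover have "(\<lambda>k. l2_norm \<Omega> (\<lambda>x. crl u x - cs (\<psi> k) x)) \<longlonglongrightarrow> 0"
    by (rule tendsto_sandwich[OF _ _ tendsto_const LIMSEQ_inverse_real_of_nat])
       (use \<psi>(3) in \<open>auto intro!: always_eventually less_imp_le\<close>)
  ultimately show ?thesis unfolding H0_def using wk \<psi>(1) by blast
qed

lemma H0_add:
  assumes u: "u \<in> H0" and v: "v \<in> H0"
  shows "(\<lambda>x. u x + t *\<^sub>R v x) \<in> H0"
proof (rule H0_I[OF weak_add[OF H0_weak[OF u] H0_weak[OF v]]])
  fix e :: real assume e: "e > 0"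
  \<comment> \<open>Chosen so that an error \<open>d\<close> in \<open>u\<close> plus an error
    \<open>d\<close> in \<open>v\<close>, weighted by the modulus of \<open>t\<close>, add up to
    \<open>e\<close>.\<close>
  define d where "d = e / (1 + \<bar>t\<bar>)"
  have d: "d > 0" using e by (simp add: d_def add_pos_nonneg)
  have sum_d: "d + \<bar>t\<bar> * d = e"
  proof -
    have "(1 + \<bar>t\<bar>) * d = e" unfolding d_def by simp
    then show ?thesis by (simp add: distrib_right)
  qed
  obtain \<phi> where \<phi>: "test_fun \<Omega> \<phi>" "l2_norm \<Omega> (\<lambda>x. u x - \<phi> x) < d" "l2_norm \<Omega> (\<lambda>x. crl u x - cs \<phi> x) < d"
    by (rule H0_approx[OF u d])
  obtain \<psi> where \<psi>: "test_fun \<Omega> \<psi>" "l2_norm \<Omega> (\<lambda>x. v x - \<psi> x) < d" "l2_norm \<Omega> (\<lambda>x. crl v x - cs \<psi> x) < d"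
    by (rule H0_approx[OF v d])
  have comb: "l2_norm \<Omega> (\<lambda>x. (f x + t *\<^sub>R g x) - (f' x + t *\<^sub>R g' x)) < e"
    if "L2 \<Omega> f" "L2 \<Omega> g" "L2 \<Omega> f'" "L2 \<Omega> g'" "l2_norm \<Omega> (\<lambda>x. f x - f' x) < d" "l2_norm \<Omega> (\<lambda>x. g x - g' x) < d"
    for f g f' g' :: "real^'n \<Rightarrow> 'c::euclidean_space"
  proof -
    have "l2_norm \<Omega> (\<lambda>x. (f x - f' x) + t *\<^sub>R (g x - g' x)) \<le>
        l2_norm \<Omega> (\<lambda>x. f x - f' x) + \<bar>t\<bar> * l2_norm \<Omega> (\<lambda>x. g x - g' x)"
      using l2_norm_triangle[OF L2_diff[OF that(1,3)] L2_scaleR[OF L2_diff[OF that(2,4)]], of t]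
      by (simp only: l2_norm_scaleR)
    also have "\<dots> < d + \<bar>t\<bar> * d"
      using that(5,6) by (intro add_less_le_mono mult_left_mono) auto
    finally show ?thesis using sum_d by (simp add: algebra_simps)
  qed
  have "l2_norm \<Omega> (\<lambda>x. (u x + t *\<^sub>R v x) - (\<phi> x + t *\<^sub>R \<psi> x)) < e"
    using \<phi> \<psi> u v by (intro comb H0_L2 L2_test)
  moreover have "l2_norm \<Omega> (\<lambda>x. (crl u x + t *\<^sub>R crl v x) - cs (\<lambda>x. \<phi> x + t *\<^sub>R \<psi> x) x) < e"
    unfolding cs_add[OF \<phi>(1) \<psi>(1)] using \<phi> \<psi> u v by (intro comb H0_crl_L2 L2_cs)
  ultimately show "\<exists>\<psi>. test_fun \<Omega> \<psi> \<and> l2_norm \<Omega> (\<lambda>x. u x + t *\<^sub>R v x - \<psi> x) < e \<and>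
      l2_norm \<Omega> (\<lambda>x. crl u x + t *\<^sub>R crl v x - cs \<psi> x) < e"
    using test_fun_add[OF \<phi>(1) \<psi>(1), of t] by blast
qed

lemma H0_zero: "(\<lambda>x. 0) \<in> H0"
proof (rule H0_I[OF weak_0])
  \<comment> \<open>\<open>cs\<close> of the zero function vanishes because additivity with
    \<open>t = -1\<close> gives cs 0 = cs 0 - cs 0.\<close>
  have "cs (\<lambda>x. 0 + (- 1) *\<^sub>R (0::'b)) x = cs (\<lambda>x. 0) x + (- 1) *\<^sub>R cs (\<lambda>x. 0) x" for x
    by (rule cs_add[OF test_fun_zero test_fun_zero])
  then have "cs (\<lambda>x. 0) = (\<lambda>x. 0)" by auto
  then show "\<exists>\<psi>. test_fun \<Omega> \<psi> \<and> l2_norm \<Omega> (\<lambda>x. 0 - \<psi> x) < e \<and> l2_norm \<Omega> (\<lambda>x. 0 - cs \<psi> x) < e" if "e > 0" for e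
    using that test_fun_zero by (intro exI[of _ "\<lambda>x. 0"]) (simp add: l2_norm_def l2_ip_eq)
qed

text \<open>Closedness of the weak curl: potentials and curls converge separately in
  \<open>L2\<close>, and the defining identity passes to the limit for each fixed test field.
  Approximability of the limit is inherited from a late \<open>v k\<close>.\<close>

lemma H0_complete:
  assumes v: "\<And>k::nat. v k \<in> H0"
    and c1: "\<And>e. e > 0 \<Longrightarrow> \<exists>N. \<forall>i\<ge>N. \<forall>j\<ge>N. l2_norm \<Omega> (\<lambda>x. v i x - v j x) < e"
    and c2: "\<And>e. e > 0 \<Longrightarrow> \<exists>N. \<forall>i\<ge>N. \<forall>j\<ge>N. l2_norm \<Omega> (\<lambda>x. crl (v i) x - crl (v j) x) < e"
  obtains u where "u \<in> H0" "(\<lambda>k. l2_norm \<Omega> (\<lambda>x. v k x - u x)) \<longlonglongrightarrow> 0"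
    "(\<lambda>k. l2_norm \<Omega> (\<lambda>x. crl (v k) x - crl u x)) \<longlonglongrightarrow> 0"
proof -
  obtain u where u: "L2 \<Omega> u" "(\<lambda>k. l2_norm \<Omega> (\<lambda>x. v k x - u x)) \<longlonglongrightarrow> 0"
    using L2_complete[of v, OF H0_L2[OF v] c1] by blast
  obtain c where c: "L2 \<Omega> c" "(\<lambda>k. l2_norm \<Omega> (\<lambda>x. crl (v k) x - c x)) \<longlonglongrightarrow> 0"
    using L2_complete[of "\<lambda>k. crl (v k)", OF H0_crl_L2[OF v] c2] by blast
  have wk: "weak u c"
    unfolding weak_def
  proof (intro conjI allI impI u c)
    fix \<psi> :: "real^'n \<Rightarrow> real^'n" assume \<psi>: "test_fun \<Omega> \<psi>"
    have "(\<lambda>k. l2_ip \<Omega> (crl (v k)) \<psi>) \<longlonglongrightarrow> l2_ip \<Omega> c \<psi>"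
      by (intro l2_ip_tendsto_left H0_crl_L2 v c L2_test \<psi>)
    moreover have "(\<lambda>k. l2_ip \<Omega> (v k) (adj \<psi>)) \<longlonglongrightarrow> l2_ip \<Omega> u (adj \<psi>)"
      by (intro l2_ip_tendsto_left H0_L2 v u L2_adj \<psi>)
    moreover have "l2_ip \<Omega> (crl (v k)) \<psi> = l2_ip \<Omega> (v k) (adj \<psi>)" for k
      using H0_weak[OF v] \<psi> by (simp add: weak_def)
    ultimately show "l2_ip \<Omega> c \<psi> = l2_ip \<Omega> u (adj \<psi>)" by (simp add: LIMSEQ_unique)
  qed
  have uH: "u \<in> H0"
  proof (rule H0_I[OF wk])
    fix e :: real assume e: "e > 0"
    have "\<forall>\<^sub>F k in sequentially. l2_norm \<Omega> (\<lambda>x. v k x - u x) < e / 2 \<and> l2_norm \<Omega> (\<lambda>x. crl (v k) x - c x) < e / 2"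
      using order_tendstoD(2)[OF u(2), of "e/2"] order_tendstoD(2)[OF c(2), of "e/2"] e by (auto intro: eventually_conj)
    then obtain k where k: "l2_norm \<Omega> (\<lambda>x. u x - v k x) < e / 2" "l2_norm \<Omega> (\<lambda>x. c x - crl (v k) x) < e / 2"
      unfolding eventually_sequentially
      using l2_norm_minus_commute[of u "v _"] l2_norm_minus_commute[of c "crl (v _)"] by auto
    obtain \<psi> where \<psi>: "test_fun \<Omega> \<psi>" "l2_norm \<Omega> (\<lambda>x. v k x - \<psi> x) < e/2" "l2_norm \<Omega> (\<lambda>x. crl (v k) x - cs \<psi> x) < e/2"
      by (rule H0_approx[OF v, of "e/2" k]) (use e in auto)
    have "l2_norm \<Omega> (\<lambda>x. u x - \<psi> x) < e"
      using l2_norm_triangle_diff[OF u(1) H0_L2[OF v] L2_test[OF \<psi>(1)], of k] k \<psi> by linarith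
    moreover have "l2_norm \<Omega> (\<lambda>x. c x - cs \<psi> x) < e"
      using l2_norm_triangle_diff[OF c(1) H0_crl_L2[OF v] L2_cs[OF \<psi>(1)], of k] k \<psi> by linarith
    ultimately show "\<exists>\<psi>. test_fun \<Omega> \<psi> \<and> l2_norm \<Omega> (\<lambda>x. u x - \<psi> x) < e \<and> l2_norm \<Omega> (\<lambda>x. c x - cs \<psi> x) < e"
      using \<psi>(1) by blast
  qed
  have ae: "AE x in M. c x = crl u x" by (rule weak_unique[OF wk weak_crl[OF wk]])
  have "l2_norm \<Omega> (\<lambda>x. crl (v k) x - c x) = l2_norm \<Omega> (\<lambda>x. crl (v k) x - crl u x)" for k
    using ae by (intro l2_norm_cong_AE L2_diff H0_crl_L2 v uH c) (auto elim: eventually_mono)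
  then show ?thesis using that[OF uH u(2)] c(2) by simp
qed

text \<open>The Poincare inequality makes the potentials Cauchy as soon as their curls are, so the
  limit in \<open>H0\<close> exists and closedness returns it to \<open>V\<close>.\<close>

lemma curl_space_closed_subspace:
  assumes sub: "V \<subseteq> H0" and add: "\<And>u v t. \<lbrakk>u \<in> V; v \<in> V\<rbrakk> \<Longrightarrow> (\<lambda>x. u x + t *\<^sub>R v x) \<in> V"
    and zero: "(\<lambda>x. 0) \<in> V"
    and poincare: "\<And>v. v \<in> V \<Longrightarrow> l2_norm \<Omega> v \<le> C * l2_norm \<Omega> (crl v)"
    and closed: "\<And>v u. \<lbrakk>\<And>k::nat. v k \<in> V; u \<in> H0; (\<lambda>k. l2_norm \<Omega> (\<lambda>x. v k x - u x)) \<longlonglongrightarrow> 0;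
        (\<lambda>k. l2_norm \<Omega> (crl (\<lambda>x. v k x - u x))) \<longlonglongrightarrow> 0\<rbrakk> \<Longrightarrow> u \<in> V"
  shows "curl_space \<Omega> V crl C"
proof unfold_locales
  fix v assume v: "\<And>k::nat. v k \<in> V"
    and cauchy: "\<And>e. e > 0 \<Longrightarrow> \<exists>N. \<forall>i\<ge>N. \<forall>j\<ge>N. l2_norm \<Omega> (\<lambda>x. crl (v i) x - crl (v j) x) < e"
  have diff: "l2_norm \<Omega> (crl (\<lambda>x. a x - b x)) = l2_norm \<Omega> (\<lambda>x. crl a x - crl b x)" if "a \<in> H0" "b \<in> H0" for a b
  proof (rule l2_norm_cong_AE)
    show "L2 \<Omega> (crl (\<lambda>x. a x - b x))" using H0_add[OF that, of "-1"] by (intro H0_crl_L2) simp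
    show "L2 \<Omega> (\<lambda>x. crl a x - crl b x)" using that by (intro L2_diff H0_crl_L2)
    show "AE x in M. crl (\<lambda>x. a x - b x) x = crl a x - crl b x" using crl_add[OF that, of "-1"] by simp
  qed
  have vH: "v k \<in> H0" for k using v sub by blast
  have c1: "\<exists>N. \<forall>i\<ge>N. \<forall>j\<ge>N. l2_norm \<Omega> (\<lambda>x. v i x - v j x) < e" if e: "e > 0" for e
  proof -
    \<comment> \<open>\<open>C\<close> carries no sign assumption, so a positive majorant takes its
      place.\<close>
    have K: "\<bar>C\<bar> + 1 > 0" by linarith
    obtain N where N: "\<And>i j. i \<ge> N \<Longrightarrow> j \<ge> N \<Longrightarrow> l2_norm \<Omega> (\<lambda>x. crl (v i) x - crl (v j) x) < e / (\<bar>C\<bar> + 1)"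
      using cauchy[OF divide_pos_pos[OF e K]] by auto
    have "l2_norm \<Omega> (\<lambda>x. v i x - v j x) < e" if "i \<ge> N" "j \<ge> N" for i j
    proof -
      have "l2_norm \<Omega> (\<lambda>x. v i x - v j x) \<le> C * l2_norm \<Omega> (crl (\<lambda>x. v i x - v j x))"
        using poincare[OF add[OF v v, of i "-1" j]] by simp
      also have "\<dots> \<le> (\<bar>C\<bar> + 1) * l2_norm \<Omega> (\<lambda>x. crl (v i) x - crl (v j) x)"
        unfolding diff[OF vH vH] by (intro mult_right_mono) auto
      also have "\<dots> < e" using N[OF that] K by (simp add: pos_less_divide_eq mult.commute)
      finally show ?thesis .
    qed
    then show ?thesis by (intro exI[of _ N]) simp
  qed
  obtain u where u: "u \<in> H0" "(\<lambda>k. l2_norm \<Omega> (\<lambda>x. v k x - u x)) \<longlonglongrightarrow> 0"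
    "(\<lambda>k. l2_norm \<Omega> (\<lambda>x. crl (v k) x - crl u x)) \<longlonglongrightarrow> 0"
    by (rule H0_complete[OF vH c1 cauchy])
  have "u \<in> V" using closed[OF v u(1,2)] u(3) diff[OF vH u(1)] by simp
  then show "\<exists>u\<in>V. (\<lambda>k. l2_norm \<Omega> (\<lambda>x. crl (v k) x - crl u x)) \<longlonglongrightarrow> 0" using u(3) by blast
qed (use sub add zero poincare crl_add H0_crl_L2 in blast)+

end

section \<open>The instances in three and two dimensions\<close>

lemma curl3s_axis:
  "curl3s \<psi> x = (pd \<psi> 2 x $ 3 - pd \<psi> 3 x $ 2) *\<^sub>R axis 1 1 +
    (pd \<psi> 3 x $ 1 - pd \<psi> 1 x $ 3) *\<^sub>R axis 2 1 + (pd \<psi> 1 x $ 2 - pd \<psi> 2 x $ 1) *\<^sub>R axis 3 1"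
  by (simp add: vec_eq_iff forall_3 curl3s_def axis_def)

lemma curl2s_axis: "curl2s \<phi> x = pd \<phi> 2 x *\<^sub>R axis 1 1 - pd \<phi> 1 x *\<^sub>R axis 2 1"
  by (simp add: vec_eq_iff forall_2 curl2s_def axis_def)

text \<open>The spatial curl is formally self-adjoint, so it serves both as \<open>cs\<close> and as
  \<open>adj\<close>.\<close>

lemma weak_curl_3D:
  assumes "open \<Omega>" "bounded \<Omega>"
  shows "weak_curl \<Omega> curl3s curl3s"
proof unfold_locales
  show "\<Omega> \<in> lmeasurable" using assms by (rule lmeasurable_open[rotated])
  show "continuous_on UNIV (curl3s \<psi>)" if "test_fun \<Omega> \<psi>" for \<psi>
    unfolding curl3s_axis[abs_def] by (intro continuous_intros test_fun_pd_continuous[OF that])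
  show "curl3s (\<lambda>x. \<phi> x + t *\<^sub>R \<psi> x) x = curl3s \<phi> x + t *\<^sub>R curl3s \<psi> x"
    if "test_fun \<Omega> \<phi>" "test_fun \<Omega> \<psi>" for \<phi> \<psi> t x
    by (simp add: curl3s_axis pd_add[OF that] algebra_simps)
qed (use assms in auto)

text \<open>Integration by parts against a vector test field turns the vector curl of a scalar into
  the scalar rotation of the field.\<close>

lemma weak_curl_2D:
  assumes "open \<Omega>" "bounded \<Omega>"
  shows "weak_curl \<Omega> curl2s rot2s"
proof unfold_locales
  show "\<Omega> \<in> lmeasurable" using assms by (rule lmeasurable_open[rotated])
  show "continuous_on UNIV (curl2s \<psi>)" if "test_fun \<Omega> \<psi>" for \<psi>
    unfolding curl2s_axis[abs_def] by (intro continuous_intros test_fun_pd_continuous[OF that])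
  show "continuous_on UNIV (rot2s \<psi>)" if "test_fun \<Omega> \<psi>" for \<psi>
    unfolding rot2s_def[abs_def] by (intro continuous_intros test_fun_pd_continuous[OF that])
  show "curl2s (\<lambda>x. \<phi> x + t *\<^sub>R \<psi> x) x = curl2s \<phi> x + t *\<^sub>R curl2s \<psi> x"
    if "test_fun \<Omega> \<phi>" "test_fun \<Omega> \<psi>" for \<phi> \<psi> t x
    unfolding curl2s_axis pd_add[OF that] by (simp add: algebra_simps)
qed (use assms in auto)

lemma curl_space_2D:
  assumes "open \<Omega>" "bounded \<Omega>"
    and "\<And>v. v \<in> H0curl2 \<Omega> \<Longrightarrow> l2_norm \<Omega> v \<le> C * l2_norm \<Omega> (curl2 \<Omega> v)"
  shows "curl_space \<Omega> (H0curl2 \<Omega>) (curl2 \<Omega>) C"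
proof -
  interpret wc: weak_curl \<Omega> curl2s rot2s by (rule weak_curl_2D[OF assms(1,2)])
  have weak: "wc.weak = weak_curl2 \<Omega>" by (intro ext) (simp add: wc.weak_def weak_curl2_def)
  have crl: "wc.crl = curl2 \<Omega>" by (intro ext) (simp add: wc.crl_def curl2_def weak)
  have H0: "wc.H0 = H0curl2 \<Omega>" by (simp add: wc.H0_def H0curl2_def weak crl)
  show ?thesis
    using wc.curl_space_closed_subspace[OF subset_refl wc.H0_add wc.H0_zero, of C] assms(3)
    unfolding crl H0 by blast
qed

lemma curl_space_3D:
  assumes "open \<Omega>" "bounded \<Omega>" and V0: "stable_splitting_space \<Omega> V0"
    and poincare: "\<And>v. v \<in> V0 \<Longrightarrow> l2_norm \<Omega> v \<le> C * l2_norm \<Omega> (curl3 \<Omega> v)"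
  shows "curl_space \<Omega> V0 (curl3 \<Omega>) C"
proof -
  interpret wc: weak_curl \<Omega> curl3s curl3s by (rule weak_curl_3D[OF assms(1,2)])
  have weak: "wc.weak = weak_curl3 \<Omega>" by (intro ext) (simp add: wc.weak_def weak_curl3_def)
  have crl: "wc.crl = curl3 \<Omega>" by (intro ext) (simp add: wc.crl_def curl3_def weak)
  have H0: "wc.H0 = H0curl3 \<Omega>" by (simp add: wc.H0_def H0curl3_def Hcurl3_def weak crl)
  have sub: "V0 \<subseteq> H0curl3 \<Omega>" and zero: "(\<lambda>x. 0) \<in> V0"
    and add: "\<And>u v t. \<lbrakk>u \<in> V0; v \<in> V0\<rbrakk> \<Longrightarrow> (\<lambda>x. u x + t *\<^sub>R v x) \<in> V0"
    and closed: "\<And>v u. \<lbrakk>\<forall>k. v k \<in> V0; u \<in> H0curl3 \<Omega>;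
        (\<lambda>k. hcurl3_norm \<Omega> (\<lambda>x. v k x - u x)) \<longlonglongrightarrow> 0\<rbrakk> \<Longrightarrow> u \<in> V0"
    using V0 unfolding stable_splitting_space_def by blast+
  show ?thesis
    unfolding crl[symmetric]
  proof (rule wc.curl_space_closed_subspace)
    show "V0 \<subseteq> wc.H0" using sub by (simp add: H0)
    show "(\<lambda>x. 0) \<in> V0" by (rule zero)
    show "(\<lambda>x. u x + t *\<^sub>R v x) \<in> V0" if "u \<in> V0" "v \<in> V0" for u v t by (rule add[OF that])
    show "l2_norm \<Omega> v \<le> C * l2_norm \<Omega> (wc.crl v)" if "v \<in> V0" for v
      using poincare[OF that] by (simp add: crl)
    fix v u assume v: "\<And>k::nat. v k \<in> V0" and u: "u \<in> wc.H0"
      and lim: "(\<lambda>k. l2_norm \<Omega> (\<lambda>x. v k x - u x)) \<longlonglongrightarrow> 0"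
        "(\<lambda>k. l2_norm \<Omega> (wc.crl (\<lambda>x. v k x - u x))) \<longlonglongrightarrow> 0"
    \<comment> \<open>\<open>V0\<close> is closed in the graph norm; the limits of its two parts
      combine under the root.\<close>
    have "(\<lambda>k. sqrt ((l2_norm \<Omega> (\<lambda>x. v k x - u x))\<^sup>2 + (l2_norm \<Omega> (wc.crl (\<lambda>x. v k x - u x)))\<^sup>2)) \<longlonglongrightarrow> sqrt (0\<^sup>2 + 0\<^sup>2)"
      by (intro tendsto_intros lim)
    then have "(\<lambda>k. hcurl3_norm \<Omega> (\<lambda>x. v k x - u x)) \<longlonglongrightarrow> 0"
      by (simp add: hcurl3_norm_def crl)
    then show "u \<in> V0" using closed v u unfolding H0 by blast
  qed
qed

lemma armijo_iterationI:
  assumes cs: "curl_space \<Omega> V crl C" and \<Omega>: "lipschitz_domain \<Omega>" and w: "energy_density \<Omega> w \<gamma> L"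
    and hs: "L2 \<Omega> hs" and \<nu>: "reluctivities \<Omega> \<nu> \<alpha> \<beta>"
    and pos: "0 < \<rho>" "\<rho> < 1" "0 < \<sigma>" "\<sigma> < 1/2" "0 < \<gamma>" "\<gamma> \<le> L" "0 < \<alpha>" "0 < \<beta>"
  shows "armijo_iteration \<Omega> V crl C w hs \<gamma> L \<nu> \<alpha> \<beta> \<rho> \<sigma>"
proof -
  interpret curl_space \<Omega> V crl C by (rule cs)
  have "convex_energy \<Omega> w (\<lambda>x. grad (w x)) hs \<gamma> L"
    using pos \<Omega> by (intro energy_density_convex_energy w hs) (auto simp: lipschitz_domain_def)
  then have "variational_problem \<Omega> V crl C w (\<lambda>x. grad (w x)) hs \<gamma> L"
    by (intro variational_problem.intro cs)
  then show ?thesis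
    using pos \<nu> \<Omega> by (intro armijo_iteration.intro armijo_iteration_axioms.intro) (auto simp: lipschitz_domain_def)
qed

theorem theorem1:
  fixes \<rho> \<sigma> \<alpha> \<beta> \<gamma> L q :: real
  assumes "0 < \<rho>" "\<rho> < 1" "0 < \<sigma>" "\<sigma> < 1/2"
    and "0 < \<gamma>" "\<gamma> \<le> L" "0 < \<alpha>" "0 < \<beta>"
    and q_def: "q = 1 - \<rho> * min (2 * (1 - \<sigma>) * \<alpha> / L) 1 * \<sigma> * (2 * \<gamma>\<^sup>2 / (L * \<beta>))"
  shows
   "(\<forall>(\<Omega>::(real^2) set) w hs \<nu> C\<^sub>\<Omega>.
      lipschitz_domain \<Omega> \<and> simply_connected \<Omega> \<and> energy_density \<Omega> w \<gamma> L \<and>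
      hs \<in> Hcurl2 \<Omega> \<and>
      (\<forall>v\<in>H0curl2 \<Omega>. l2_norm \<Omega> v \<le> C\<^sub>\<Omega> * l2_norm \<Omega> (curl2 \<Omega> v)) \<and>
      reluctivities \<Omega> \<nu> \<alpha> \<beta> \<longrightarrow>
      ((\<forall>n. \<forall>a\<in>(H0curl2 \<Omega>). (\<exists>\<delta>. lin_step \<Omega> (H0curl2 \<Omega>) (curl2 \<Omega>) w hs (\<nu> n) a \<delta>) \<and>
          (\<forall>\<delta>1 \<delta>2. lin_step \<Omega> (H0curl2 \<Omega>) (curl2 \<Omega>) w hs (\<nu> n) a \<delta>1 \<and> lin_step \<Omega> (H0curl2 \<Omega>) (curl2 \<Omega>) w hs (\<nu> n) a \<delta>2 \<longrightarrow>
              l2_norm \<Omega> (\<lambda>x. \<delta>1 x - \<delta>2 x) = 0) \<and>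
          (\<forall>\<delta>. lin_step \<Omega> (H0curl2 \<Omega>) (curl2 \<Omega>) w hs (\<nu> n) a \<delta> \<longrightarrow>
              (\<exists>\<tau>\<in>armijo_set \<Omega> (curl2 \<Omega>) w hs \<rho> \<sigma> a \<delta>. \<forall>t\<in>armijo_set \<Omega> (curl2 \<Omega>) w hs \<rho> \<sigma> a \<delta>. t \<le> \<tau>))) \<and>
       (\<forall>a0\<in>(H0curl2 \<Omega>). \<exists>A D T. A 0 = a0 \<and> (\<forall>n. lin_step \<Omega> (H0curl2 \<Omega>) (curl2 \<Omega>) w hs (\<nu> n) (A n) (D n) \<and>
                 T n \<in> armijo_set \<Omega> (curl2 \<Omega>) w hs \<rho> \<sigma> (A n) (D n) \<and>
                 (\<forall>t\<in>armijo_set \<Omega> (curl2 \<Omega>) w hs \<rho> \<sigma> (A n) (D n). t \<le> T n) \<and>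
                 A (Suc n) = (\<lambda>x. A n x + T n *\<^sub>R D n x))) \<and>
       (\<exists>a\<in>(H0curl2 \<Omega>). (\<forall>v\<in>(H0curl2 \<Omega>). Phi \<Omega> w hs (curl2 \<Omega> a) \<le> Phi \<Omega> w hs (curl2 \<Omega> v)) \<and>
          (\<forall>b\<in>(H0curl2 \<Omega>). (\<forall>v\<in>(H0curl2 \<Omega>). Phi \<Omega> w hs (curl2 \<Omega> b) \<le> Phi \<Omega> w hs (curl2 \<Omega> v)) \<longrightarrow>
              l2_norm \<Omega> (\<lambda>x. b x - a x) = 0) \<and>
          (\<forall>b\<in>(H0curl2 \<Omega>). (\<forall>v\<in>(H0curl2 \<Omega>). Phi \<Omega> w hs (curl2 \<Omega> b) \<le> Phi \<Omega> w hs (curl2 \<Omega> v)) \<longleftrightarrow>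
              (\<forall>v\<in>(H0curl2 \<Omega>). l2_ip \<Omega> (\<lambda>x. grad (w x) (curl2 \<Omega> b x)) (curl2 \<Omega> v) = l2_ip \<Omega> hs (curl2 \<Omega> v))) \<and>
          (\<forall>A D T. A 0 \<in> (H0curl2 \<Omega>) \<and> (\<forall>n. lin_step \<Omega> (H0curl2 \<Omega>) (curl2 \<Omega>) w hs (\<nu> n) (A n) (D n) \<and>
                 T n \<in> armijo_set \<Omega> (curl2 \<Omega>) w hs \<rho> \<sigma> (A n) (D n) \<and>
                 (\<forall>t\<in>armijo_set \<Omega> (curl2 \<Omega>) w hs \<rho> \<sigma> (A n) (D n). t \<le> T n) \<and>
                 A (Suc n) = (\<lambda>x. A n x + T n *\<^sub>R D n x)) \<longrightarrow>
              (\<forall>n. (l2_norm \<Omega> (curl2 \<Omega> (\<lambda>x. A n x - a x)))\<^sup>2 \<le>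
                    (L / \<gamma>) * q ^ n * (l2_norm \<Omega> (curl2 \<Omega> (\<lambda>x. A 0 x - a x)))\<^sup>2) \<and>
              (\<lambda>n. l2_norm \<Omega> (\<lambda>x. A n x - a x)) \<longlonglongrightarrow> 0 \<and>
              (\<lambda>n. l2_norm \<Omega> (curl2 \<Omega> (\<lambda>x. A n x - a x))) \<longlonglongrightarrow> 0)))) \<and>
    (\<forall>(\<Omega>::(real^3) set) w hs \<nu> V0 C\<^sub>\<Omega>.
      lipschitz_domain \<Omega> \<and> simply_connected \<Omega> \<and> energy_density \<Omega> w \<gamma> L \<and>
      hs \<in> Hcurl3 \<Omega> \<and> stable_splitting_space \<Omega> V0 \<and>
      (\<forall>v\<in>V0. l2_norm \<Omega> v \<le> C\<^sub>\<Omega> * l2_norm \<Omega> (curl3 \<Omega> v)) \<and>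
      reluctivities \<Omega> \<nu> \<alpha> \<beta> \<longrightarrow>
      ((\<forall>n. \<forall>a\<in>V0. (\<exists>\<delta>. lin_step \<Omega> V0 (curl3 \<Omega>) w hs (\<nu> n) a \<delta>) \<and>
          (\<forall>\<delta>1 \<delta>2. lin_step \<Omega> V0 (curl3 \<Omega>) w hs (\<nu> n) a \<delta>1 \<and> lin_step \<Omega> V0 (curl3 \<Omega>) w hs (\<nu> n) a \<delta>2 \<longrightarrow>
              l2_norm \<Omega> (\<lambda>x. \<delta>1 x - \<delta>2 x) = 0) \<and>
          (\<forall>\<delta>. lin_step \<Omega> V0 (curl3 \<Omega>) w hs (\<nu> n) a \<delta> \<longrightarrow>
              (\<exists>\<tau>\<in>armijo_set \<Omega> (curl3 \<Omega>) w hs \<rho> \<sigma> a \<delta>. \<forall>t\<in>armijo_set \<Omega> (curl3 \<Omega>) w hs \<rho> \<sigma> a \<delta>. t \<le> \<tau>))) \<and>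
       (\<forall>a0\<in>V0. \<exists>A D T. A 0 = a0 \<and> (\<forall>n. lin_step \<Omega> V0 (curl3 \<Omega>) w hs (\<nu> n) (A n) (D n) \<and>
                 T n \<in> armijo_set \<Omega> (curl3 \<Omega>) w hs \<rho> \<sigma> (A n) (D n) \<and>
                 (\<forall>t\<in>armijo_set \<Omega> (curl3 \<Omega>) w hs \<rho> \<sigma> (A n) (D n). t \<le> T n) \<and>
                 A (Suc n) = (\<lambda>x. A n x + T n *\<^sub>R D n x))) \<and>
       (\<exists>a\<in>V0. (\<forall>v\<in>V0. Phi \<Omega> w hs (curl3 \<Omega> a) \<le> Phi \<Omega> w hs (curl3 \<Omega> v)) \<and>
          (\<forall>b\<in>V0. (\<forall>v\<in>V0. Phi \<Omega> w hs (curl3 \<Omega> b) \<le> Phi \<Omega> w hs (curl3 \<Omega> v)) \<longrightarrow>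
              l2_norm \<Omega> (\<lambda>x. b x - a x) = 0) \<and>
          (\<forall>b\<in>V0. (\<forall>v\<in>V0. Phi \<Omega> w hs (curl3 \<Omega> b) \<le> Phi \<Omega> w hs (curl3 \<Omega> v)) \<longleftrightarrow>
              (\<forall>v\<in>V0. l2_ip \<Omega> (\<lambda>x. grad (w x) (curl3 \<Omega> b x)) (curl3 \<Omega> v) = l2_ip \<Omega> hs (curl3 \<Omega> v))) \<and>
          (\<forall>A D T. A 0 \<in> V0 \<and> (\<forall>n. lin_step \<Omega> V0 (curl3 \<Omega>) w hs (\<nu> n) (A n) (D n) \<and>
                 T n \<in> armijo_set \<Omega> (curl3 \<Omega>) w hs \<rho> \<sigma> (A n) (D n) \<and>
                 (\<forall>t\<in>armijo_set \<Omega> (curl3 \<Omega>) w hs \<rho> \<sigma> (A n) (D n). t \<le> T n) \<and>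
                 A (Suc n) = (\<lambda>x. A n x + T n *\<^sub>R D n x)) \<longrightarrow>
              (\<forall>n. (l2_norm \<Omega> (curl3 \<Omega> (\<lambda>x. A n x - a x)))\<^sup>2 \<le>
                    (L / \<gamma>) * q ^ n * (l2_norm \<Omega> (curl3 \<Omega> (\<lambda>x. A 0 x - a x)))\<^sup>2) \<and>
              (\<lambda>n. l2_norm \<Omega> (\<lambda>x. A n x - a x)) \<longlonglongrightarrow> 0 \<and>
              (\<lambda>n. l2_norm \<Omega> (curl3 \<Omega> (\<lambda>x. A n x - a x))) \<longlonglongrightarrow> 0))))"
proof ((rule conjI; intro allI impI), goal_cases)
  case (1 \<Omega> w hs \<nu> C\<^sub>\<Omega>)
  interpret ai: armijo_iteration \<Omega> "H0curl2 \<Omega>" "curl2 \<Omega>" C\<^sub>\<Omega> w hs \<gamma> L \<nu> \<alpha> \<beta> \<rho> \<sigma>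
  proof (rule armijo_iterationI)
    show "curl_space \<Omega> (H0curl2 \<Omega>) (curl2 \<Omega>) C\<^sub>\<Omega>"
      using 1 by (intro curl_space_2D) (auto simp: lipschitz_domain_def)
    show "L2 \<Omega> hs" using 1 by (auto simp: Hcurl2_def weak_rot2_def)
  qed (use 1 assms in auto)
  have q: "ai.q = q" by (simp add: ai.q_def q_def)
  show ?case by (rule ai.armijo_convergence[unfolded ai.F_def ai.iterates_def q])
next
  case (2 \<Omega> w hs \<nu> V0 C\<^sub>\<Omega>)
  interpret ai: armijo_iteration \<Omega> V0 "curl3 \<Omega>" C\<^sub>\<Omega> w hs \<gamma> L \<nu> \<alpha> \<beta> \<rho> \<sigma>
  proof (rule armijo_iterationI)
    show "curl_space \<Omega> V0 (curl3 \<Omega>) C\<^sub>\<Omega>"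
      using 2 by (intro curl_space_3D) (auto simp: lipschitz_domain_def)
    show "L2 \<Omega> hs" using 2 by (auto simp: Hcurl3_def weak_curl3_def)
  qed (use 2 assms in auto)
  have q: "ai.q = q" by (simp add: ai.q_def q_def)
  show ?case by (rule ai.armijo_convergence[unfolded ai.F_def ai.iterates_def q])
qed

end
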